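(* Let $\gamma\in(0,\frac n2)$, $s=\frac n2+\gamma$ (or $\gamma=\frac n2$, $s=n$, in part (3)), and let $g^*$ be the adapted metric with parameter $s$ on $(\mathbb{B}^{n+1},\mathbb{S}^n,g_{\mathbb{B}})$, where $\rho=\frac{1-|x|^2}{2}$. Then: (1) If $\gamma\in(0,\frac n2)\setminus\frac12\mathbb{N}$, then $g^*=\psi_\gamma^{\frac{2}{n-s}}|dx|^2=\psi_\gamma^{\frac{4}{n-2\gamma}}|dx|^2$, where $$\psi_\gamma=F\left(\tfrac n2-\gamma,\tfrac12-\gamma;1-2\gamma;2\rho\right)+\rho^{2\gamma}\frac1{d_\gamma}\frac{\Gamma(\frac n2+\gamma)}{\Gamma(\frac n2-\gamma)}F\left(\tfrac12+\gamma,\tfrac n2+\gamma;1+2\gamma;2\rho\right),\qquad d_\gamma=2^{2\gamma}\frac{\Gamma(\gamma)}{\Gamma(-\gamma)}$$ (for $0<|x|<1$, with the value at $x=0$ understood by continuity). (2) If $\gamma=m+\frac12<\frac n2$ with $m=[\gamma]$, then $g^*=\psi_{m+\frac12}^{\frac{4}{n-2m-1}}|dx|^2$, where $$\psi_{m+\frac12}=\sum_{k=0}^m\frac{(\frac{n-1}{2}-m)_k(-m)_k}{(-2m)_k}\frac{(2\rho)^k}{k!}.$$ (3) If $\gamma=\frac n2$ and $n$ is an odd integer, then $$g^*=\exp\left\{2\frac{\Gamma(\frac{n+1}{2})}{\Gamma(n)}\sum_{k=1}^{(n-1)/2}\frac{\Gamma(n-k)}{\Gamma(\frac{n+1}{2}-k)\,k}(2\rho)^k\right\}|dx|^2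 .$$
   Context: $\mathbb{B}^{n+1}$ is the open unit ball of $\mathbb{R}^{n+1}$ with boundary $\mathbb{S}^n$, $|dx|^2$ the Euclidean metric, $g_{\mathbb{B}}=\frac{4}{(1-|x|^2)^2}|dx|^2=\rho^{-2}|dx|^2$ the hyperbolic metric with Laplacian $\Delta_{g_{\mathbb{B}}}$, $\rho=\frac{1-|x|^2}{2}$. $\frac12\mathbb{N}=\{0,\frac12,1,\frac32,\dots\}$. $[\cdot]$ is the integer part. $(a)_0=1$, $(a)_k=a(a+1)\cdots(a+k-1)$, and $F(a,b;c;z)=\sum_{k\ge0}\frac{(a)_k(b)_k}{(c)_k}\frac{z^k}{k!}$ is the hypergeometric function. Adapted metric: for $s=\frac n2+\gamma$, let $\vartheta_s$ be the solution of the Poisson equation $-\Delta_{g_{\mathbb{B}}}u-s(n-s)u=0$ in $\mathbb{B}^{n+1}$ of the form $u=F\rho^{n-s}+H\rho^s$ with $F,H$ smooth up to the boundary and $F|_{\mathbb{S}^n}\equiv1$. For $\gamma\in(0,\frac n2)$, $\vartheta_s>0$ and the adapted metric is $g^*=\vartheta_s^{\frac{2}{n-s}}g_{\mathbb{B}}$. In the limiting case $s=n$ ($\gamma=\frac n2$, $n$ odd), $g^*=e^{2\tau}g_{\mathbb{B}}$ where $\tau=-\frac{d}{ds}\vartheta_s\big|_{s=n}$. *)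

theory Defs
  imports "HOL-Analysis.Analysis"
begin

definition hypergeom :: "real \<Rightarrow> real \<Rightarrow> real \<Rightarrow> real \<Rightarrow> real" where
  "hypergeom a b c z =
     (\<Sum>k. pochhammer a k * pochhammer b k / pochhammer c k * (z ^ k / fact k))"

definition half_naturals :: "real set" where
  "half_naturals = range (\<lambda>k::nat. real k / 2)"

definition partial :: "'n::finite \<Rightarrow> (real^'n \<Rightarrow> real) \<Rightarrow> real^'n \<Rightarrow> real" where
  "partial i f x = frechet_derivative f (at x) (axis i 1)"

primrec Ck_on :: "nat \<Rightarrow> (real^'n::finite) set \<Rightarrow> (real^'n \<Rightarrow> real) \<Rightarrow> bool" where
  "Ck_on 0 U f \<longleftrightarrow> continuous_on U f"
| "Ck_on (Suc k) U f \<longleftrightarrow> (\<forall>x\<in>U. f differentiable (at x)) \<and> (\<forall>i. Ck_on k U (partial i f))"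

(* C^infinity on an arbitrary set, i.e. up to its boundary: smooth on an open neighbourhood. *)
definition smooth_upto :: "(real^'n::finite) set \<Rightarrow> (real^'n \<Rightarrow> real) \<Rightarrow> bool" where
  "smooth_upto A f \<longleftrightarrow> (\<exists>U. open U \<and> A \<subseteq> U \<and> (\<forall>k. Ck_on k U f))"

(* A Riemannian metric on an open subset of R^N is given by its matrix field (g_ij). *)
type_synonym 'n metric_field = "real^'n \<Rightarrow> real^'n^'n"

definition laplace_beltrami ::
    "'n::finite metric_field \<Rightarrow> (real^'n \<Rightarrow> real) \<Rightarrow> real^'n \<Rightarrow> real" where
  "laplace_beltrami g u x =
     (\<Sum>i\<in>UNIV. partial i
        (\<lambda>y. sqrt (det (g y)) * (\<Sum>j\<in>UNIV. matrix_inv (g y) $ i $ j * partial j u y)) x)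
     / sqrt (det (g x))"

definition flat_metric :: "'n::finite metric_field" where
  "flat_metric x = mat 1"

definition hyperbolic_metric :: "'n::finite metric_field" where
  "hyperbolic_metric x = (4 / (1 - (norm x)\<^sup>2)\<^sup>2) *\<^sub>R flat_metric x"

definition rho :: "real^'n::finite \<Rightarrow> real" where
  "rho x = (1 - (norm x)\<^sup>2) / 2"

(* In what follows n is the boundary dimension; it is used with CARD('n) = n + 1. *)

definition poisson_solution :: "nat \<Rightarrow> real \<Rightarrow> (real^'n::finite \<Rightarrow> real) \<Rightarrow> bool" where
  "poisson_solution n s u \<longleftrightarrow>
     (\<forall>x\<in>ball 0 1. - laplace_beltrami hyperbolic_metric u x - s * (real n - s) * u x = 0) \<and>
     (\<exists>F H. smooth_upto (cball 0 1) F \<and> smooth_upto (cball 0 1) H \<and>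
        (\<forall>x\<in>ball 0 1. u x = F x * rho x powr (real n - s) + H x * rho x powr s) \<and>
        (\<forall>x\<in>sphere 0 1. F x = 1))"

(* The solution lives on the open ball; as a total function it is made unique by the
   value 0 outside. *)
definition vartheta :: "nat \<Rightarrow> real \<Rightarrow> real^'n::finite \<Rightarrow> real" where
  "vartheta n s = (THE u. poisson_solution n s u \<and> (\<forall>x. x \<notin> ball 0 1 \<longrightarrow> u x = 0))"

definition tau :: "nat \<Rightarrow> real^'n::finite \<Rightarrow> real" where
  "tau n x = - deriv (\<lambda>s. vartheta n s x) (real n)"

definition adapted_metric :: "nat \<Rightarrow> real \<Rightarrow> 'n::finite metric_field" where
  "adapted_metric n s x =
     (if s = real n then exp (2 * tau n x) *\<^sub>R hyperbolic_metric x
      else (vartheta n s x powr (2 / (real n - s))) *\<^sub>R hyperbolic_metric x)"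

definition d_const :: "real \<Rightarrow> real" where
  "d_const \<gamma> = 2 powr (2 * \<gamma>) * (Gamma \<gamma> / Gamma (- \<gamma>))"

end

theory Submission
  imports Defs "HOL-Real_Asymp.Real_Asymp"
begin

text \<open>
  Two solutions of the Poisson problem differ by $w = F \rho^{n-s} + H \rho^s$ with $F = 0$ on the sphere, so
  $w = o(\rho^{n-s})$; comparing $w$ with a positive strict supersolution of size at least $\rho^{n-s}$ at an
  interior maximum of the quotient yields $w = 0$. Hence $\vartheta_s$ is found by exhibiting any solution.

  In the variable $t = |x|^2$ a radial function $\rho^{n-s} Y(t)$ solves the equation iff $Y$ solves the
  hypergeometric equation with parameters $n - s$, $\frac{n+1}{2} - s$, $\frac{n+1}{2}$, and the solution
  regular at the centre is the hypergeometric series in $t$. The connection formula between $t = 0$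
  and $z = 1 - t = 2\rho = 0$ puts it into the form $F \rho^{n-s} + H \rho^s$ and gives part (1); for half-integral
  $\gamma$ the series in $z$ terminates, which is part (2). For $s = n$ one differentiates
  $\rho^{n-s} C(s) Y_s(t)$ at $s = n$, where $Y_n = 1$, and rewrites the resulting polynomial in $t$ in terms of $z$.
\<close>

section \<open>Smooth functions of one real variable\<close>

text \<open>\<open>vartheta\<close> is a definite description over all solutions, so no formula can
  enter before existence and uniqueness are both known. The derivative defining \<open>tau\<close>
  is two-sided, hence both are needed for s on either side of n and at n itself, not only for
  \<gamma> below n/2.

  No single series covers the closed ball. The one in t = |x|^2 is smooth at the centre but in
  general singular at the sphere; those in z = 2\<rho> show the boundary behaviour but reach the
  centre only at the edge of their disc. The decomposition with F and H smooth on a neighbourhood of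
  the closed ball is therefore glued from both.

  The connection formula requires 2\<gamma> to be no integer. Half-integral \<gamma> and s = n are
  outside its range and get solutions of their own with H = 0: a polynomial in z and the constant 1.

  The normalizing constant C(s) is the reciprocal of the value at t = 1 given by Gauss's theorem.
  Its derivative at s = n is a difference of digamma values, which has to cancel against the value
  at t = 1 of the polynomial arising from the series.\<close>

primrec Ck_real :: "nat \<Rightarrow> real set \<Rightarrow> (real \<Rightarrow> real) \<Rightarrow> bool" where
  "Ck_real 0 S f \<longleftrightarrow> continuous_on S f"
| "Ck_real (Suc k) S f \<longleftrightarrow> (\<forall>x\<in>S. f field_differentiable at x) \<and> Ck_real k S (deriv f)"

lemma Ck_real_cong:
  assumes "open S" "\<And>x. x \<in> S \<Longrightarrow> f x = g x" "Ck_real k S f"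
  shows "Ck_real k S g"
  using assms(2,3)
proof (induction k arbitrary: f g)
  case 0
  then show ?case by (metis Ck_real.simps(1) continuous_on_cong)
next
  case (Suc k)
  have ev: "eventually (\<lambda>y. f y = g y) (nhds x)" if "x \<in> S" for x
    using eventually_nhds Suc.prems(1) assms(1) that by blast
  have "deriv f x = deriv g x" if "x \<in> S" for x
    by (rule deriv_cong_ev[OF ev[OF that]]) simp
  moreover have "g field_differentiable at x" if "x \<in> S" for x
  proof -
    have "f field_differentiable at x" using Suc.prems(2) that by simp
    then show ?thesis
      unfolding field_differentiable_def using DERIV_cong_ev[OF refl ev[OF that] refl] by auto
  qed
  ultimately show ?case using Suc.IH[of "deriv f" "deriv g"] Suc.prems(2) by auto
qed

lemma Ck_real_SucI:
  assumes "open S" "\<And>x. x \<in> S \<Longrightarrow> (f has_real_derivative f' x) (at x)" "Ck_real k S f'"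
  shows "Ck_real (Suc k) S f"
proof -
  have "Ck_real k S (deriv f)"
    by (rule Ck_real_cong[OF assms(1) _ assms(3)]) (metis DERIV_imp_deriv assms(2))
  then show ?thesis using assms(2) by (auto simp: field_differentiable_def)
qed

lemma Ck_real_SucD: "Ck_real (Suc k) S f \<Longrightarrow> Ck_real k S f"
proof (induction k arbitrary: f)
  case 0
  then show ?case
    by (auto intro!: continuous_at_imp_continuous_on field_differentiable_imp_continuous_at)
next
  case (Suc k)
  then show ?case by (metis Ck_real.simps(2))
qed

lemma Ck_real_Un:
  "Ck_real k S f \<Longrightarrow> Ck_real k T f \<Longrightarrow> open S \<Longrightarrow> open T \<Longrightarrow> Ck_real k (S \<union> T) f"
  by (induction k arbitrary: f) (auto intro: continuous_on_open_Un)

lemma Ck_real_subset: "Ck_real k S f \<Longrightarrow> T \<subseteq> S \<Longrightarrow> Ck_real k T f"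
  by (induction k arbitrary: f) (auto intro: continuous_on_subset)

lemma Ck_real_SucE:
  assumes "Ck_real (Suc k) S f"
  obtains f' where "\<And>x. x \<in> S \<Longrightarrow> (f has_real_derivative f' x) (at x)" "Ck_real k S f'"
  using assms that[of "deriv f"] by (auto simp: DERIV_deriv_iff_field_differentiable)

lemma Ck_real_const: "open S \<Longrightarrow> Ck_real k S (\<lambda>x. c)"
proof (induction k arbitrary: c)
  case (Suc k)
  then show ?case by (intro Ck_real_SucI[where f' = "\<lambda>_. 0"]) auto
qed auto

lemma Ck_real_ident: "open S \<Longrightarrow> Ck_real k S (\<lambda>x. x)"
  by (cases k) (auto intro!: Ck_real_SucI[where f' = "\<lambda>_. 1"] Ck_real_const simp del: Ck_real.simps(2))

lemma Ck_real_add: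
  assumes "open S"
  shows "Ck_real k S f \<Longrightarrow> Ck_real k S g \<Longrightarrow> Ck_real k S (\<lambda>x. f x + g x)"
proof (induction k arbitrary: f g)
  case (Suc k)
  obtain f' g' where *: "\<And>x. x \<in> S \<Longrightarrow> (f has_real_derivative f' x) (at x)" "Ck_real k S f'"
    "\<And>x. x \<in> S \<Longrightarrow> (g has_real_derivative g' x) (at x)" "Ck_real k S g'"
    using Suc.prems Ck_real_SucE by metis
  show ?case
    by (rule Ck_real_SucI[OF assms DERIV_add[OF *(1,3)] Suc.IH[OF *(2,4)]])
qed (auto intro: continuous_intros)

lemma Ck_real_mult:
  assumes "open S"
  shows "Ck_real k S f \<Longrightarrow> Ck_real k S g \<Longrightarrow> Ck_real k S (\<lambda>x. f x * g x)"
proof (induction k arbitrary: f g)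
  case (Suc k)
  obtain f' g' where *: "\<And>x. x \<in> S \<Longrightarrow> (f has_real_derivative f' x) (at x)" "Ck_real k S f'"
    "\<And>x. x \<in> S \<Longrightarrow> (g has_real_derivative g' x) (at x)" "Ck_real k S g'"
    using Suc.prems Ck_real_SucE by metis
  have "Ck_real k S (\<lambda>x. f' x * g x + f x * g' x)"
    by (intro Ck_real_add assms Suc.IH * Ck_real_SucD[OF Suc.prems(1)] Ck_real_SucD[OF Suc.prems(2)])
  moreover have "((\<lambda>x. f x * g x) has_real_derivative f' x * g x + f x * g' x) (at x)"
    if "x \<in> S" for x
    using DERIV_mult[OF *(1,3)[OF that]] by (simp add: mult.commute)
  ultimately show ?case by (rule Ck_real_SucI[OF assms, rotated -1])
qed (auto intro: continuous_intros)

text \<open>\<open>f\<close> is uncontrolled outside \<open>S\<close>, but the product is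
  identically 0 on the open set \<open>T\<close>. In this way a cutoff carries a function past the
  end of its domain of smoothness.\<close>

lemma Ck_real_mult_extend:
  assumes "open S" "open T" "Ck_real k S f" "\<And>k. Ck_real k UNIV \<eta>" "\<And>t. t \<in> T \<Longrightarrow> \<eta> t = 0"
  shows "Ck_real k (S \<union> T) (\<lambda>t. \<eta> t * f t)"
proof (rule Ck_real_Un)
  show "Ck_real k S (\<lambda>t. \<eta> t * f t)"
    by (rule Ck_real_mult[OF assms(1) Ck_real_subset[OF assms(4)] assms(3)]) simp
  show "Ck_real k T (\<lambda>t. \<eta> t * f t)"
    by (rule Ck_real_cong[OF assms(2) _ Ck_real_const[OF assms(2), of k 0]]) (simp add: assms(5))
qed (use assms in auto)

lemma Ck_real_compose:
  assumes "open S" "open T" "\<And>x. x \<in> S \<Longrightarrow> g x \<in> T"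
  shows "Ck_real k T f \<Longrightarrow> Ck_real k S g \<Longrightarrow> Ck_real k S (\<lambda>x. f (g x))"
proof (induction k arbitrary: f)
  case 0
  then show ?case using assms(3) by (auto intro: continuous_on_compose2)
next
  case (Suc k)
  obtain f' g' where *: "\<And>x. x \<in> T \<Longrightarrow> (f has_real_derivative f' x) (at x)" "Ck_real k T f'"
    "\<And>x. x \<in> S \<Longrightarrow> (g has_real_derivative g' x) (at x)" "Ck_real k S g'"
    using Suc.prems Ck_real_SucE by metis
  show ?case
  proof (rule Ck_real_SucI[OF assms(1)])
    show "((\<lambda>x. f (g x)) has_real_derivative f' (g x) * g' x) (at x)" if "x \<in> S" for x
      by (rule DERIV_chain2[OF *(1)[OF assms(3)[OF that]] *(3)[OF that]])
    show "Ck_real k S (\<lambda>x. f' (g x) * g' x)"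
      by (rule Ck_real_mult[OF assms(1) Suc.IH[OF *(2) Ck_real_SucD[OF Suc.prems(2)]] *(4)])
  qed
qed

lemma Ck_real_one_minus: "open S \<Longrightarrow> Ck_real k S (\<lambda>t. 1 - t)"
  using Ck_real_add[OF _ Ck_real_const[of _ _ 1]
      Ck_real_mult[OF _ Ck_real_const[of _ _ "-1"] Ck_real_ident], of S k]
  by simp

lemma Ck_real_powr: "Ck_real k {0<..} (\<lambda>x. x powr a)"
proof (induction k arbitrary: a)
  case (Suc k)
  show ?case
    by (rule Ck_real_SucI[OF _ has_real_derivative_powr Ck_real_mult[OF _ Ck_real_const Suc]]) auto
qed (auto intro!: continuous_intros)

text \<open>Summability on the whole open interval passes to the derived series
  \<open>diffs c\<close>, which closes the induction.\<close>

lemma Ck_real_powser: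
  "(\<And>x::real. norm x < R \<Longrightarrow> summable (\<lambda>n. c n * x ^ n))
     \<Longrightarrow> Ck_real k {-R<..<R} (\<lambda>x. \<Sum>n. c n * x ^ n)"
proof (induction k arbitrary: c)
  case 0
  have "isCont (\<lambda>x. \<Sum>n. c n * x ^ n) x" if "norm x < R" for x :: real
    using termdiffs_strong'[of R c x] 0 that DERIV_isCont by blast
  then show ?case by (auto intro!: continuous_at_imp_continuous_on)
next
  case (Suc k)
  show ?case
  proof (rule Ck_real_SucI)
    show "((\<lambda>x. \<Sum>n. c n * x ^ n) has_real_derivative (\<Sum>n. diffs c n * x ^ n)) (at x)"
      if "x \<in> {-R<..<R}" for x
      using that Suc.prems by (intro termdiffs_strong'[of R]) auto
    show "Ck_real k {-R<..<R} (\<lambda>x. \<Sum>n. diffs c n * x ^ n)"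
      by (rule Suc.IH, rule termdiff_converges[of _ R c]) (use Suc.prems in auto)
  qed auto
qed

section \<open>Flat functions and smooth cutoffs\<close>

lemma poly_times_exp_minus_tendsto_0:
  fixes p :: "real poly"
  shows "((\<lambda>y. poly p y * exp (- y)) \<longlongrightarrow> 0) at_top"
proof -
  have "((\<lambda>y. \<Sum>i\<le>degree p. coeff p i * (y ^ i / exp y)) \<longlongrightarrow> (\<Sum>i\<le>degree p. coeff p i * 0)) at_top"
    by (intro tendsto_intros tendsto_power_div_exp_0)
  then show ?thesis
    by (simp add: poly_altdef exp_minus sum_divide_distrib field_simps)
qed

text \<open>The functions $p(1/x) e^{-1/x}$, extended by $0$, form a class closed under
  differentiation, which makes $e^{-1/x}$ smooth at the origin.\<close>

definition flat :: "real poly \<Rightarrow> real \<Rightarrow> real" where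
  "flat p x = (if x > 0 then poly p (1 / x) * exp (- (1 / x)) else 0)"

text \<open>With y = 1/x one has dy/dx = -y^2, so p(y) exp(-y) has derivative y^2 (p - p')(y)
  exp(-y), which is again of the same form.\<close>

lemma flat_has_derivative:
  "(flat p has_real_derivative flat (monom 1 2 * (p - pderiv p)) x) (at x)"
proof -
  consider "x > 0" | "x < 0" | "x = 0" by linarith
  then show ?thesis
  proof cases
    case 1
    have "((\<lambda>x. poly p (1 / x) * exp (- (1 / x))) has_real_derivative
        flat (monom 1 2 * (p - pderiv p)) x) (at x)"
      using 1 by (auto intro!: derivative_eq_intros DERIV_chain2[OF poly_DERIV]
          simp: flat_def poly_monom power2_eq_square field_simps)
    then show ?thesis
      by (rule has_field_derivative_transform_within_open[of _ _ _ "{0<..}"])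
        (use 1 in \<open>auto simp: flat_def\<close>)
  next
    case 2
    have "((\<lambda>y. 0) has_real_derivative flat (monom 1 2 * (p - pderiv p)) x) (at x)"
      using 2 by (simp add: flat_def)
    then show ?thesis
      by (rule has_field_derivative_transform_within_open[of _ _ _ "{..<0}"])
        (use 2 in \<open>auto simp: flat_def\<close>)
  next
    case 3
    \<comment> \<open>\<open>pCons 0 p\<close> is the polynomial y p(y): in the variable y = 1/h the
      difference quotient at 0 is y p(y) exp(-y).\<close>
    have "((\<lambda>y. poly (pCons 0 p) y * exp (- y)) \<longlongrightarrow> 0) at_top"
      by (rule poly_times_exp_minus_tendsto_0)
    then have "((\<lambda>h. poly (pCons 0 p) (inverse h) * exp (- inverse h)) \<longlongrightarrow> 0) (at_right 0)"
      by (rule filterlim_compose) (rule filterlim_inverse_at_top_right)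
    then have "((\<lambda>h. flat p h / h) \<longlongrightarrow> 0) (at_right 0)"
      by (rule Lim_transform_eventually)
        (auto simp: flat_def eventually_at_right_less field_simps intro!:
            eventually_mono[OF eventually_at_right_less[of 0]])
    moreover have "((\<lambda>h. flat p h / h) \<longlongrightarrow> 0) (at_left 0)"
      by (rule tendsto_eventually)
        (auto simp: flat_def eventually_at_filter)
    ultimately have "((\<lambda>h. flat p h / h) \<longlongrightarrow> 0) (at 0)"
      by (simp add: filterlim_split_at)
    then show ?thesis using 3 by (simp add: DERIV_def flat_def)
  qed
qed

lemma Ck_real_flat: "Ck_real k UNIV (flat p)"
proof (induction k arbitrary: p)
  case 0
  show ?case
    by (auto intro!: continuous_at_imp_continuous_on DERIV_isCont[OF flat_has_derivative])
next
  case (Suc k)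
  show ?case by (rule Ck_real_SucI[OF _ flat_has_derivative Suc]) simp
qed

text \<open>The quotient e(t - a) / (e(t - a) + e(b - t)) with e the flat exponential. Since a < b,
  one of the two arguments is always positive and the denominator never vanishes. Division is
  written as \<open>powr (-1)\<close> so that the closure lemmas for composition and product
  apply.\<close>

lemma smooth_cutoff:
  fixes a b :: real
  assumes "a < b"
  obtains \<eta> where "\<And>k. Ck_real k UNIV \<eta>" "\<And>t. t \<le> a \<Longrightarrow> \<eta> t = 0" "\<And>t. t \<ge> b \<Longrightarrow> \<eta> t = 1"
proof
  define N where "N = (\<lambda>t. flat 1 (t - a))"
  define D where "D = (\<lambda>t. flat 1 (t - a) + flat 1 (b - t))"
  have lin: "Ck_real k UNIV (\<lambda>t. t - a)" "Ck_real k UNIV (\<lambda>t. b - t)" for k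
    using Ck_real_add[OF _ Ck_real_ident Ck_real_const[of _ _ "-a"], of UNIV k]
      Ck_real_add[OF _ Ck_real_const[of _ _ b]
          Ck_real_mult[OF _ Ck_real_const[of _ _ "-1"] Ck_real_ident], of UNIV k]
    by simp_all
  have N: "Ck_real k UNIV N" for k
    unfolding N_def by (rule Ck_real_compose[OF _ _ _ Ck_real_flat lin(1)]) auto
  have "Ck_real k UNIV (\<lambda>t. flat 1 (b - t))" for k
    by (rule Ck_real_compose[OF _ _ _ Ck_real_flat lin(2)]) auto
  with N have D: "Ck_real k UNIV D" for k
    unfolding D_def N_def by (intro Ck_real_add) auto
  have D_pos: "D t > 0" for t
    using assms by (auto simp: D_def flat_def add_pos_pos)
  show "Ck_real k UNIV (\<lambda>t. N t * D t powr (-1))" for k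
    by (rule Ck_real_mult[OF _ N Ck_real_compose[OF _ _ _ Ck_real_powr D]]) (use D_pos in auto)
  show "N t * D t powr (-1) = 0" if "t \<le> a" for t
    using that by (simp add: N_def flat_def)
  show "N t * D t powr (-1) = 1" if "t \<ge> b" for t
    using that assms by (simp add: N_def D_def flat_def powr_minus)
qed

section \<open>Smooth functions on open subsets of Euclidean space\<close>

lemma Ck_on_cong:
  assumes "open U" "\<And>x. x \<in> U \<Longrightarrow> f x = g x" "Ck_on k U f"
  shows "Ck_on k U g"
  using assms(2,3)
proof (induction k arbitrary: f g)
  case 0
  then show ?case by (metis Ck_on.simps(1) continuous_on_cong)
next
  case (Suc k)
  have d: "(g has_derivative frechet_derivative f (at x)) (at x)" if "x \<in> U" for x
    using Suc.prems that assms(1) has_derivative_transform_within_open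
    by (metis Ck_on.simps(2) frechet_derivative_works)
  then have "partial i f x = partial i g x" if "x \<in> U" for i x
    using that by (metis frechet_derivative_at partial_def)
  then have "Ck_on k U (partial i g)" for i
    using Suc by (metis Ck_on.simps(2))
  with d show ?case by (auto simp: differentiable_def)
qed

lemma partial_eq: "(f has_derivative f') (at x) \<Longrightarrow> partial i f x = f' (axis i 1)"
  by (simp add: partial_def frechet_derivative_at[symmetric])

lemma Ck_on_SucI:
  assumes "open U" "\<And>x. x \<in> U \<Longrightarrow> (f has_derivative f' x) (at x)"
    "\<And>i. Ck_on k U (\<lambda>x. f' x (axis i 1))"
  shows "Ck_on (Suc k) U f"
proof -
  have "Ck_on k U (partial i f)" for i
    by (rule Ck_on_cong[OF assms(1) _ assms(3)[of i]]) (rule partial_eq[symmetric, OF assms(2)])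
  with assms(2) show ?thesis by (auto simp: differentiable_def)
qed

lemma Ck_on_SucD: "Ck_on (Suc k) U f \<Longrightarrow> Ck_on k U f"
proof (induction k arbitrary: f)
  case 0
  then show ?case
    by (auto intro!: continuous_at_imp_continuous_on differentiable_imp_continuous_within)
next
  case (Suc k)
  then show ?case by (metis Ck_on.simps(2))
qed

lemma Ck_on_subset: "Ck_on k U f \<Longrightarrow> V \<subseteq> U \<Longrightarrow> Ck_on k V f"
  by (induction k arbitrary: f) (auto intro: continuous_on_subset)

lemma Ck_on_Suc_has_derivative:
  "Ck_on (Suc k) U f \<Longrightarrow> x \<in> U \<Longrightarrow> (f has_derivative frechet_derivative f (at x)) (at x)"
  by (auto simp: frechet_derivative_works)

lemma Ck_on_const: "open U \<Longrightarrow> Ck_on k U (\<lambda>x. c)"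
proof (induction k arbitrary: c)
  case (Suc k)
  show ?case by (rule Ck_on_SucI[OF Suc.prems has_derivative_const]) (use Suc in auto)
qed auto

lemma Ck_on_add:
  assumes "open U"
  shows "Ck_on k U f \<Longrightarrow> Ck_on k U g \<Longrightarrow> Ck_on k U (\<lambda>x. f x + g x)"
proof (induction k arbitrary: f g)
  case (Suc k)
  have "Ck_on k U (\<lambda>x. frechet_derivative f (at x) (axis i 1)
      + frechet_derivative g (at x) (axis i 1))" for i
    using Suc Suc.IH[of "partial i f" "partial i g"] by (auto simp: partial_def[abs_def])
  then show ?case
    using Ck_on_Suc_has_derivative[OF Suc.prems(1)] Ck_on_Suc_has_derivative[OF Suc.prems(2)]
    by (intro Ck_on_SucI[OF assms has_derivative_add])
qed (auto intro: continuous_intros)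

lemma Ck_on_mult:
  assumes "open U"
  shows "Ck_on k U f \<Longrightarrow> Ck_on k U g \<Longrightarrow> Ck_on k U (\<lambda>x. f x * g x)"
proof (induction k arbitrary: f g)
  case (Suc k)
  have "Ck_on k U (\<lambda>x. f x * frechet_derivative g (at x) (axis i 1)
      + frechet_derivative f (at x) (axis i 1) * g x)" for i
    using Suc.prems Ck_on_SucD[OF Suc.prems(1)] Ck_on_SucD[OF Suc.prems(2)]
    by (intro Ck_on_add assms Suc.IH) (auto simp: partial_def[abs_def])
  then show ?case
    using Ck_on_Suc_has_derivative[OF Suc.prems(1)] Ck_on_Suc_has_derivative[OF Suc.prems(2)]
    by (intro Ck_on_SucI[OF assms has_derivative_mult])
qed (auto intro: continuous_intros)

lemma Ck_on_compose:
  assumes "open U" "open S" "\<And>x. x \<in> U \<Longrightarrow> g x \<in> S"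
  shows "Ck_real k S \<phi> \<Longrightarrow> Ck_on k U g \<Longrightarrow> Ck_on k U (\<lambda>x. \<phi> (g x))"
proof (induction k arbitrary: \<phi>)
  case 0
  then show ?case using assms(3) by (auto intro: continuous_on_compose2)
next
  case (Suc k)
  obtain \<phi>' where *: "\<And>x. x \<in> S \<Longrightarrow> (\<phi> has_real_derivative \<phi>' x) (at x)" "Ck_real k S \<phi>'"
    using Suc.prems Ck_real_SucE by metis
  show ?case
  proof (rule Ck_on_SucI[OF assms(1)])
    show "((\<lambda>x. \<phi> (g x)) has_derivative (\<lambda>v. \<phi>' (g x) * frechet_derivative g (at x) v)) (at x)"
      if "x \<in> U" for x
      using has_derivative_compose[OF Ck_on_Suc_has_derivative[OF Suc.prems(2) that]
          *(1)[OF assms(3)[OF that], unfolded has_field_derivative_def]]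
      by simp
    show "Ck_on k U (\<lambda>x. \<phi>' (g x) * frechet_derivative g (at x) (axis i 1))" for i
      using Suc.prems(2)
      by (intro Ck_on_mult[OF assms(1) Suc.IH[OF *(2) Ck_on_SucD[OF Suc.prems(2)]]])
        (auto simp: partial_def[abs_def])
  qed
qed

lemma norm_square_ball: "x \<in> ball 0 1 \<Longrightarrow> (norm x)\<^sup>2 \<in> {-1<..<1}"
  for x :: "'a::real_normed_vector"
proof -
  assume "x \<in> ball 0 1"
  then have "(norm x)\<^sup>2 < 1" by (simp add: power_less_one_iff)
  then show ?thesis
    unfolding greaterThanLessThan_iff using zero_le_power2[of "norm x"] by linarith
qed

lemma has_derivative_norm_square:
  "((\<lambda>x::real^'n. (norm x)\<^sup>2) has_derivative (\<lambda>v. 2 * (x \<bullet> v))) (at x)"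
  unfolding power2_norm_eq_inner by (auto intro!: derivative_eq_intros simp: inner_commute)

lemma Ck_on_coordinate: "open U \<Longrightarrow> Ck_on k U (\<lambda>x::real^'n::finite. x $ i)"
  by (cases k)
    (auto intro!: Ck_on_SucI[where f' = "\<lambda>_ v. v $ i"] Ck_on_const continuous_intros
       bounded_linear.has_derivative[OF bounded_linear_vec_nth] derivative_eq_intros simp del:
           Ck_on.simps(2))

lemma Ck_on_norm_square: "open U \<Longrightarrow> Ck_on k U (\<lambda>x::real^'n::finite. (norm x)\<^sup>2)"
proof (cases k)
  case (Suc j)
  assume "open U"
  show ?thesis
    unfolding Suc
  proof (rule Ck_on_SucI[OF \<open>open U\<close> has_derivative_norm_square])
    show "Ck_on j U (\<lambda>x. 2 * (x \<bullet> axis i 1))" for i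
      using Ck_on_mult[OF \<open>open U\<close> Ck_on_const[of U j 2] Ck_on_coordinate[of U j i]] \<open>open U\<close>
      by (simp add: inner_axis)
  qed
qed (auto intro!: continuous_intros)

lemma Ck_on_radial:
  fixes U :: "(real^'n::finite) set"
  assumes "open U" "open S" "\<And>x. x \<in> U \<Longrightarrow> (norm x)\<^sup>2 \<in> S" "Ck_real k S \<phi>"
  shows "Ck_on k U (\<lambda>x. \<phi> ((norm x)\<^sup>2))"
  by (rule Ck_on_compose[OF assms Ck_on_norm_square[OF assms(1)]])

text \<open>Working in |x|^2 instead of |x| avoids a singularity at the centre. The interval extends
  below 0 to be an open neighbourhood of the value at the centre, and beyond 1 to give smoothness
  across the sphere.\<close>

lemma smooth_upto_radial:
  assumes "\<And>k. Ck_real k {-1<..<2} f"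
  shows "smooth_upto (cball 0 1) (\<lambda>x::real^'n::finite. f ((norm x)\<^sup>2))"
  unfolding smooth_upto_def
proof (intro exI conjI allI)
  show "open {x::real^'n. (norm x)\<^sup>2 < 2}"
    by (intro open_Collect_less continuous_intros)
  show "cball 0 1 \<subseteq> {x::real^'n. (norm x)\<^sup>2 < 2}"
  proof
    fix x :: "real^'n" assume "x \<in> cball 0 1"
    then have "(norm x)\<^sup>2 \<le> 1" by (simp add: power_le_one)
    then show "x \<in> {x. (norm x)\<^sup>2 < 2}" by simp
  qed
  have "(norm x)\<^sup>2 > -1" for x :: "real^'n"
    by (rule less_le_trans[of _ 0]) auto
  then show "Ck_on k {x::real^'n. (norm x)\<^sup>2 < 2} (\<lambda>x. f ((norm x)\<^sup>2))" for k
    by (intro Ck_on_radial[OF \<open>open {x::real^'n. (norm x)\<^sup>2 < 2}\<close> _ _ assms]) auto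
qed

section \<open>The hypergeometric equation\<close>

definition hyp_coeff :: "real \<Rightarrow> real \<Rightarrow> real \<Rightarrow> nat \<Rightarrow> real" where
  "hyp_coeff a b c k = pochhammer a k * pochhammer b k / (pochhammer c k * fact k)"

text \<open>Isolated from the closed form of the coefficients because the terminating series with c
  = -2m, whose Pochhammer denominators eventually vanish, satisfies it as well.\<close>

definition hyp_rec :: "real \<Rightarrow> real \<Rightarrow> real \<Rightarrow> (nat \<Rightarrow> real) \<Rightarrow> bool" where
  "hyp_rec a b c q \<longleftrightarrow> (\<forall>k. (real k + 1) * (c + real k) * q (Suc k) = (a + real k) * (b + real k) * q k)"

definition hyp_ode ::
  "real \<Rightarrow> real \<Rightarrow> real \<Rightarrow> real set \<Rightarrow> (real \<Rightarrow> real) \<Rightarrow> (real \<Rightarrow> real) \<Rightarrow> (real \<Rightarrow> real) \<Rightarrow> bool" where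
  "hyp_ode a b c S y y1 y2 \<longleftrightarrow>
     (\<forall>z\<in>S. (y has_real_derivative y1 z) (at z) \<and> (y1 has_real_derivative y2 z) (at z) \<and>
        z * (1 - z) * y2 z + (c - (a + b + 1) * z) * y1 z - a * b * y z = 0)"

lemma hypergeom_eq_powser: "hypergeom a b c z = (\<Sum>k. hyp_coeff a b c k * z ^ k)"
  by (simp add: hypergeom_def hyp_coeff_def)

lemma hyp_coeff_0 [simp]: "hyp_coeff a b c 0 = 1"
  by (simp add: hyp_coeff_def)

lemma hypergeom_0 [simp]: "hypergeom a b c 0 = 1"
  using powser_zero[of "hyp_coeff a b c"] by (simp add: hypergeom_eq_powser)

lemma nonpos_Ints_pochhammer:
  fixes c :: real
  assumes "c \<notin> \<int>\<^sub>\<le>\<^sub>0"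
  shows "pochhammer c k \<noteq> 0" "c + real k \<noteq> 0"
proof -
  show "pochhammer c k \<noteq> 0" for k
    using assms pochhammer_eq_0_imp_nonpos_Int by blast
  from this[of "Suc k"] show "c + real k \<noteq> 0" by (auto simp: pochhammer_Suc)
qed

lemma hyp_rec_hyp_coeff:
  assumes "c \<notin> \<int>\<^sub>\<le>\<^sub>0"
  shows "hyp_rec a b c (hyp_coeff a b c)"
  using nonpos_Ints_pochhammer[OF assms] unfolding hyp_rec_def hyp_coeff_def
  by (simp add: pochhammer_Suc divide_simps)

text \<open>The ratio of consecutive coefficients tends to 1, so consecutive terms eventually shrink
  by a factor r chosen between |z| and 1.\<close>

lemma hyp_rec_summable:
  assumes "hyp_rec a b c q" "norm (z::real) < 1"
  shows "summable (\<lambda>k. q k * z ^ k)"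
proof -
  define r where "r = (\<bar>z\<bar> + 1) / 2"
  have r: "\<bar>z\<bar> < r" "r < 1" using assms(2) by (auto simp: r_def)
  have "((\<lambda>k. \<bar>(a + real k) * (b + real k) / ((real k + 1) * (c + real k))\<bar> * \<bar>z\<bar>)
      \<longlongrightarrow> \<bar>1\<bar> * \<bar>z\<bar>) sequentially"
    by (intro tendsto_intros) real_asymp
  then have "eventually (\<lambda>k. \<bar>(a + real k) * (b + real k) / ((real k + 1) * (c + real k))\<bar> * \<bar>z\<bar>
      < r) sequentially"
    using r by (intro order_tendstoD(2)) auto
  moreover have "eventually (\<lambda>k. c + real k > 0) sequentially" by real_asymp
  ultimately have "eventually (\<lambda>k. norm (q (Suc k) * z ^ Suc k) \<le> r * norm (q k * z ^ k)) sequentially"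
  proof eventually_elim
    case (elim k)
    have "q (Suc k) = (a + real k) * (b + real k) / ((real k + 1) * (c + real k)) * q k"
    proof -
      have "(real k + 1) * (c + real k) \<noteq> 0" using elim by auto
      moreover have "(real k + 1) * (c + real k) * q (Suc k) = (a + real k) * (b + real k) * q k"
        using assms(1) by (simp add: hyp_rec_def)
      ultimately show ?thesis by (simp add: field_simps)
    qed
    then have "norm (q (Suc k) * z ^ Suc k) =
        (\<bar>(a + real k) * (b + real k) / ((real k + 1) * (c + real k))\<bar> * \<bar>z\<bar>) * norm (q k * z ^ k)"
      by (simp add: abs_mult power_abs)
    also have "\<dots> \<le> r * norm (q k * z ^ k)"
      using elim by (intro mult_right_mono) auto
    finally show ?case .
  qed
  then obtain N where "\<And>k. k \<ge> N \<Longrightarrow> norm (q (Suc k) * z ^ Suc k) \<le> r * norm (q k * z ^ k)"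
    by (auto simp: eventually_sequentially)
  then show ?thesis using r(2) by (rule summable_ratio_test[rotated])
qed

lemma powser_times_arg:
  fixes z :: real
  assumes "(\<lambda>k. d k * z ^ k) sums s"
  shows "(\<lambda>k. (case k of 0 \<Rightarrow> 0 | Suc j \<Rightarrow> d j) * z ^ k) sums (z * s)"
proof -
  have "(\<lambda>k. d k * z ^ Suc k) sums (z * s)"
    using sums_mult[OF assms, of z] by (simp add: mult_ac)
  then show ?thesis using sums_Suc_iff[of "\<lambda>k. (case k of 0 \<Rightarrow> 0 | Suc j \<Rightarrow> d j) * z ^ k"] by simp
qed

text \<open>The hypergeometric operator maps the series to the one whose coefficients are the
  left-hand sides of \<open>rec\<close>. A constant defect d in degree 0 is allowed: d = 0 is the
  homogeneous equation, d = -M the one satisfied by the logarithmic polynomials of the limiting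
  case.\<close>

lemma powser_hyp_operator:
  fixes z :: real
  assumes s0: "\<And>x::real. norm x < R \<Longrightarrow> summable (\<lambda>k. q k * x ^ k)" and z: "norm z < R"
    and rec: "\<And>k. (real k + 1) * (c + real k) * q (Suc k) - (a + real k) * (b + real k) * q k
        = (if k = 0 then d else 0)"
  shows "((\<lambda>z. \<Sum>k. q k * z ^ k) has_real_derivative (\<Sum>k. diffs q k * z ^ k)) (at z)"
    "((\<lambda>z. \<Sum>k. diffs q k * z ^ k) has_real_derivative (\<Sum>k. diffs (diffs q) k * z ^ k)) (at z)"
    "z * (1 - z) * (\<Sum>k. diffs (diffs q) k * z ^ k) + (c - (a + b + 1) * z) * (\<Sum>k. diffs q k * z ^ k)
       - a * b * (\<Sum>k. q k * z ^ k) = d"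
proof -
  have s1: "summable (\<lambda>k. diffs q k * x ^ k)" if "norm x < R" for x :: real
    using termdiff_converges[OF that s0] .
  have s2: "summable (\<lambda>k. diffs (diffs q) k * x ^ k)" if "norm x < R" for x :: real
    using termdiff_converges[OF that s1] .
  show "((\<lambda>z. \<Sum>k. q k * z ^ k) has_real_derivative (\<Sum>k. diffs q k * z ^ k)) (at z)"
    by (rule termdiffs_strong'[OF s0 z])
  show "((\<lambda>z. \<Sum>k. diffs q k * z ^ k) has_real_derivative (\<Sum>k. diffs (diffs q) k * z ^ k)) (at z)"
    by (rule termdiffs_strong'[OF s1 z])
  define Y0 Y1 Y2 where "Y0 = (\<Sum>k. q k * z ^ k)" and "Y1 = (\<Sum>k. diffs q k * z ^ k)"
    and "Y2 = (\<Sum>k. diffs (diffs q) k * z ^ k)"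
  have y0: "(\<lambda>k. q k * z ^ k) sums Y0" and y1: "(\<lambda>k. diffs q k * z ^ k) sums Y1"
    and y2: "(\<lambda>k. diffs (diffs q) k * z ^ k) sums Y2"
    unfolding Y0_def Y1_def Y2_def using s0[OF z] s1[OF z] s2[OF z] by (auto intro: summable_sums)
  note zy1 = powser_times_arg[OF y1]
  note zy2 = powser_times_arg[OF y2]
  note zzy2 = powser_times_arg[OF zy2]
  \<comment> \<open>Each case expression is the coefficient sequence after multiplication by z, the
    nested one after multiplication by z^2; \<open>e1\<close> to \<open>e4\<close> below evaluate
    them, including the low indices.\<close>
  have "(\<lambda>k. (case k of 0 \<Rightarrow> 0 | Suc j \<Rightarrow> diffs (diffs q) j) * z ^ k
       - (case k of 0 \<Rightarrow> 0 | Suc j \<Rightarrow> case j of 0 \<Rightarrow> 0 | Suc j \<Rightarrow> diffs (diffs q) j) * z ^ k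
       + (c * (diffs q k * z ^ k) - (a + b + 1) * ((case k of 0 \<Rightarrow> 0 | Suc j \<Rightarrow> diffs q j) * z ^ k))
       - a * b * (q k * z ^ k)) sums (z * Y2 - z * (z * Y2) + (c * Y1 - (a + b + 1) * (z * Y1))
           - a * b * Y0)"
    by (intro sums_add sums_diff sums_mult zy1 zy2 zzy2 y0 y1)
  moreover have "(case k of 0 \<Rightarrow> 0 | Suc j \<Rightarrow> diffs (diffs q) j) * z ^ k
       - (case k of 0 \<Rightarrow> 0 | Suc j \<Rightarrow> case j of 0 \<Rightarrow> 0 | Suc j \<Rightarrow> diffs (diffs q) j) * z ^ k
       + (c * (diffs q k * z ^ k) - (a + b + 1) * ((case k of 0 \<Rightarrow> 0 | Suc j \<Rightarrow> diffs q j) * z ^ k))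
       - a * b * (q k * z ^ k) = (if k = 0 then d else 0) * z ^ k" for k
  proof -
    have e1: "(case k of 0 \<Rightarrow> 0 | Suc j \<Rightarrow> diffs (diffs q) j) = real k * (real k + 1) * q (Suc k)"
      by (cases k) (simp_all add: diffs_def algebra_simps)
    have e2: "(case k of 0 \<Rightarrow> 0 | Suc j \<Rightarrow> case j of 0 \<Rightarrow> 0 | Suc j \<Rightarrow> diffs (diffs q) j)
        = real k * (real k - 1) * q k"
      by (auto simp add: diffs_def algebra_simps split: nat.split)
    have e3: "(case k of 0 \<Rightarrow> 0 | Suc j \<Rightarrow> diffs q j) = real k * q k"
      by (auto simp add: diffs_def algebra_simps split: nat.split)
    have e4: "diffs q k = (real k + 1) * q (Suc k)" by (simp add: diffs_def)
    have "real k * (real k + 1) * q (Suc k) - real k * (real k - 1) * q k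
      + (c * ((real k + 1) * q (Suc k)) - (a + b + 1) * (real k * q k)) - a * b * q k
      = (real k + 1) * (c + real k) * q (Suc k) - (a + real k) * (b + real k) * q k"
      by (simp add: algebra_simps)
    then have "(real k * (real k + 1) * q (Suc k) - real k * (real k - 1) * q k
      + (c * ((real k + 1) * q (Suc k)) - (a + b + 1) * (real k * q k)) - a * b * q k) * z ^ k
          = (if k = 0 then d else 0) * z ^ k"
      using rec[of k] by simp
    then show ?thesis unfolding e1 e2 e3 e4 by (simp add: algebra_simps)
  qed
  ultimately have "(\<lambda>k. (if k = 0 then d else 0) * z ^ k) sums (z * Y2 - z * (z * Y2)
      + (c * Y1 - (a + b + 1) * (z * Y1)) - a * b * Y0)"
    by simp
  moreover have "(\<lambda>k. (if k = 0 then d else 0) * z ^ k) sums d"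
    using sums_single[of 0 "\<lambda>k. d * z ^ k"] by (simp add: if_distrib[of "\<lambda>w. w * _"] cong: if_cong)
  ultimately have "z * Y2 - z * (z * Y2) + (c * Y1 - (a + b + 1) * (z * Y1)) - a * b * Y0 = d"
    using sums_unique2 by blast
  then show "z * (1 - z) * Y2 + (c - (a + b + 1) * z) * Y1 - a * b * Y0 = d"
    by (simp add: algebra_simps)
qed

lemma hyp_ode_powser:
  assumes "hyp_rec a b c q" "\<And>x::real. norm x < R \<Longrightarrow> summable (\<lambda>k. q k * x ^ k)"
  shows "hyp_ode a b c {-R<..<R} (\<lambda>z. \<Sum>k. q k * z ^ k)
    (\<lambda>z. \<Sum>k. diffs q k * z ^ k) (\<lambda>z. \<Sum>k. diffs (diffs q) k * z ^ k)"
proof -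
  \<comment> \<open>The degenerate conditional is the constant right-hand side d = 0.\<close>
  have rec: "(real k + 1) * (c + real k) * q (Suc k) - (a + real k) * (b + real k) * q k
      = (if k = 0 then 0 else 0)" for k
    using assms(1) by (simp add: hyp_rec_def)
  show ?thesis
    unfolding hyp_ode_def using powser_hyp_operator[OF assms(2) _ rec] by auto
qed

lemma hyp_ode_hypergeom:
  assumes "c \<notin> \<int>\<^sub>\<le>\<^sub>0"
  shows "hyp_ode a b c {-1<..<1} (hypergeom a b c)
    (\<lambda>z. \<Sum>k. diffs (hyp_coeff a b c) k * z ^ k) (\<lambda>z. \<Sum>k. diffs (diffs (hyp_coeff a b c)) k * z ^ k)"
  unfolding hypergeom_eq_powser[abs_def]
  by (rule hyp_ode_powser[OF hyp_rec_hyp_coeff hyp_rec_summable[OF hyp_rec_hyp_coeff]]) (use assms in auto)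

lemma hyp_ode_subset: "hyp_ode a b c S y y1 y2 \<Longrightarrow> T \<subseteq> S \<Longrightarrow> hyp_ode a b c T y y1 y2"
  by (auto simp: hyp_ode_def)

lemma hyp_ode_scale:
  assumes "hyp_ode a b c S y y1 y2"
  shows "hyp_ode a b c S (\<lambda>z. C * y z) (\<lambda>z. C * y1 z) (\<lambda>z. C * y2 z)"
  unfolding hyp_ode_def
proof (intro ballI conjI)
  fix z assume "z \<in> S"
  then have *: "(y has_real_derivative y1 z) (at z)" "(y1 has_real_derivative y2 z) (at z)"
    "z * (1 - z) * y2 z + (c - (a + b + 1) * z) * y1 z - a * b * y z = 0"
    using assms by (auto simp: hyp_ode_def)
  show "((\<lambda>z. C * y z) has_real_derivative C * y1 z) (at z)"
      "((\<lambda>z. C * y1 z) has_real_derivative C * y2 z) (at z)"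
    by (intro DERIV_cmult *)+
  have "z * (1 - z) * (C * y2 z) + (c - (a + b + 1) * z) * (C * y1 z) - a * b * (C * y z)
      = C * (z * (1 - z) * y2 z + (c - (a + b + 1) * z) * y1 z - a * b * y z)"
    by (simp only: algebra_simps)
  then show "z * (1 - z) * (C * y2 z) + (c - (a + b + 1) * z) * (C * y1 z) - a * b * (C * y z) = 0"
    unfolding *(3) by simp
qed

text \<open>The map z to 1 - z exchanges the singular points 0 and 1, and with them the parameters c
  and a + b + 1 - c.\<close>

lemma hyp_ode_reflect:
  assumes "hyp_ode a b c S y y1 y2" "c' = a + b + 1 - c" "\<And>z. z \<in> T \<Longrightarrow> 1 - z \<in> S"
  shows "hyp_ode a b c' T (\<lambda>z. y (1 - z)) (\<lambda>z. - y1 (1 - z)) (\<lambda>z. y2 (1 - z))"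
  unfolding hyp_ode_def
proof (intro ballI conjI)
  fix z assume "z \<in> T"
  then have "1 - z \<in> S" by (rule assms(3))
  then have *: "(y has_real_derivative y1 (1 - z)) (at (1 - z))"
    "(y1 has_real_derivative y2 (1 - z)) (at (1 - z))"
    "(1 - z) * (1 - (1 - z)) * y2 (1 - z) + (c - (a + b + 1) * (1 - z)) * y1 (1 - z)
        - a * b * y (1 - z) = 0"
    using assms(1) by (auto simp: hyp_ode_def)
  have d: "((\<lambda>z. 1 - z) has_real_derivative -1) (at z)" by (auto intro!: derivative_eq_intros)
  show "((\<lambda>z. y (1 - z)) has_real_derivative - y1 (1 - z)) (at z)"
    using DERIV_chain2[OF *(1) d] by simp
  show "((\<lambda>z. - y1 (1 - z)) has_real_derivative y2 (1 - z)) (at z)"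
    using DERIV_minus[OF DERIV_chain2[OF *(2) d]] by simp
  show "z * (1 - z) * y2 (1 - z) + (c' - (a + b + 1) * z) * - y1 (1 - z) - a * b * y (1 - z) = 0"
    using *(3) by (simp add: assms(2) algebra_simps)
qed

text \<open>The exponents of the equation at 0 are 0 and 1 - c. Factoring out z^(1-c) exchanges them
  and turns the equation into a hypergeometric one with shifted parameters.\<close>

lemma hyp_ode_twist:
  assumes "hyp_ode (a - c + 1) (b - c + 1) (2 - c) S k k1 k2" "\<And>z. z \<in> S \<Longrightarrow> z > 0"
  defines "e \<equiv> 1 - c"
  shows "hyp_ode a b c S (\<lambda>z. z powr e * k z) (\<lambda>z. z powr e * (k1 z + e * k z / z))
    (\<lambda>z. z powr e * (k2 z + 2 * e * k1 z / z + e * (e - 1) * k z / z\<^sup>2))"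
  unfolding hyp_ode_def
proof (intro ballI conjI)
  fix z assume zS: "z \<in> S"
  then have z: "z > 0" by (rule assms(2))
  have *: "(k has_real_derivative k1 z) (at z)" "(k1 has_real_derivative k2 z) (at z)"
    and ode: "z * (1 - z) * k2 z + (2 - c - (a - c + 1 + (b - c + 1) + 1) * z) * k1 z
        - (a - c + 1) * (b - c + 1) * k z = 0"
    using assms(1) zS by (auto simp: hyp_ode_def)
  have p: "((\<lambda>z. z powr e) has_real_derivative z powr e * (e / z)) (at z)"
    using has_real_derivative_powr[OF z, of e] z by (simp add: powr_diff field_simps)
  show "((\<lambda>z. z powr e * k z) has_real_derivative z powr e * (k1 z + e * k z / z)) (at z)"
    using DERIV_mult[OF p *(1)] by (simp add: algebra_simps)
  have "((\<lambda>z. k1 z + e * k z / z) has_real_derivative (k2 z + e * (k1 z * z - k z) / z\<^sup>2)) (at z)"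
    using z by (auto intro!: derivative_eq_intros * simp: power2_eq_square right_diff_distrib)
  from DERIV_mult[OF p this]
  show "((\<lambda>z. z powr e * (k1 z + e * k z / z)) has_real_derivative
      z powr e * (k2 z + 2 * e * k1 z / z + e * (e - 1) * k z / z\<^sup>2)) (at z)"
    by (rule DERIV_cong) (use z in \<open>simp add: divide_simps power2_eq_square, simp add: algebra_simps\<close>)
  \<comment> \<open>The terms in k/z cancel because e = 1 - c is an indicial root: e (e - 1) + c e =
    0.\<close>
  have "z * (1 - z) * (k2 z + 2 * e * k1 z / z + e * (e - 1) * k z / z\<^sup>2)
     + (c - (a + b + 1) * z) * (k1 z + e * k z / z) - a * b * k z
     = z * (1 - z) * k2 z + (2 - c - (a - c + 1 + (b - c + 1) + 1) * z) * k1 z - (a - c + 1)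
         * (b - c + 1) * k z"
    unfolding e_def using z by (simp add: divide_simps power2_eq_square) (simp add: algebra_simps)
  then have eq: "z * (1 - z) * (k2 z + 2 * e * k1 z / z + e * (e - 1) * k z / z\<^sup>2)
     + (c - (a + b + 1) * z) * (k1 z + e * k z / z) - a * b * k z = 0"
    using ode by simp
  have "z * (1 - z) * (z powr e * (k2 z + 2 * e * k1 z / z + e * (e - 1) * k z / z\<^sup>2))
     + (c - (a + b + 1) * z) * (z powr e * (k1 z + e * k z / z)) - a * b * (z powr e * k z)
    = z powr e * (z * (1 - z) * (k2 z + 2 * e * k1 z / z + e * (e - 1) * k z / z\<^sup>2)
     + (c - (a + b + 1) * z) * (k1 z + e * k z / z) - a * b * k z)"
    by (simp only: algebra_simps)
  then show "z * (1 - z) * (z powr e * (k2 z + 2 * e * k1 z / z + e * (e - 1) * k z / z\<^sup>2))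
     + (c - (a + b + 1) * z) * (z powr e * (k1 z + e * k z / z)) - a * b * (z powr e * k z) = 0"
    using eq by simp
qed

text \<open>Abel's identity. The weight is the integrating factor of (c - (a + b + 1) z) / (z (1 -
  z)) = c/z - c'/(1 - z) with c' = a + b + 1 - c.\<close>

lemma hyp_ode_wronskian:
  assumes "hyp_ode a b c {0<..<1} y y1 y2" "hyp_ode a b c {0<..<1} u u1 u2"
  obtains \<kappa> where "\<And>z. 0 < z \<Longrightarrow> z < 1 \<Longrightarrow>
    z powr c * (1 - z) powr (a + b + 1 - c) * (y z * u1 z - y1 z * u z) = \<kappa>"
proof -
  define c' where "c' = a + b + 1 - c"
  have "((\<lambda>z. z powr c * (1 - z) powr c' * (y z * u1 z - y1 z * u z))
      has_real_derivative 0) (at z within {0<..<1})"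
    if "z \<in> {0<..<1}" for z
  proof -
    have z: "0 < z" "z < 1" using that by auto
    have *: "(y has_real_derivative y1 z) (at z)" "(y1 has_real_derivative y2 z) (at z)"
      "z * (1 - z) * y2 z + (c - (a + b + 1) * z) * y1 z - a * b * y z = 0"
      "(u has_real_derivative u1 z) (at z)" "(u1 has_real_derivative u2 z) (at z)"
      "z * (1 - z) * u2 z + (c - (a + b + 1) * z) * u1 z - a * b * u z = 0"
      using assms that by (auto simp: hyp_ode_def)
    have p: "((\<lambda>z. z powr c) has_real_derivative z powr c * (c / z)) (at z)"
      using has_real_derivative_powr[OF z(1), of c] z by (simp add: powr_diff field_simps)
    have "((\<lambda>z. 1 - z) has_real_derivative -1) (at z)" by (auto intro!: derivative_eq_intros)
    from DERIV_chain2[OF has_real_derivative_powr this]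
    have q: "((\<lambda>z. (1 - z) powr c') has_real_derivative (1 - z) powr c' * (- c' / (1 - z))) (at z)"
      using z by (simp add: powr_diff field_simps)
    have w: "((\<lambda>z. y z * u1 z - y1 z * u z) has_real_derivative y z * u2 z - y2 z * u z) (at z)"
      by (rule DERIV_cong[OF DERIV_diff[OF DERIV_mult[OF *(1,5)] DERIV_mult[OF *(2,4)]]])
          (simp add: algebra_simps)
    have "z * (1 - z) * (y z * u2 z - y2 z * u z) = y z * (z * (1 - z) * u2 z) - u z * (z * (1 - z) * y2 z)"
      by (simp add: algebra_simps)
    also have "\<dots> =
        y z * (a * b * u z - (c - (a + b + 1) * z) * u1 z) - u z
            * (a * b * y z - (c - (a + b + 1) * z) * y1 z)"
    proof -
      have "z * (1 - z) * y2 z = a * b * y z - (c - (a + b + 1) * z) * y1 z"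
        "z * (1 - z) * u2 z = a * b * u z - (c - (a + b + 1) * z) * u1 z"
        using *(3,6) by simp_all
      then show ?thesis by (simp only:)
    qed
    also have "\<dots> = - (c - (a + b + 1) * z) * (y z * u1 z - y1 z * u z)"
      by (simp add: algebra_simps)
    finally have "z * (1 - z) * (y z * u2 z - y2 z * u z)
        + (c * (1 - z) - c' * z) * (y z * u1 z - y1 z * u z) = 0"
      by (simp add: c'_def algebra_simps)
    then have "(z * (1 - z) * (y z * u2 z - y2 z * u z)
        + (c * (1 - z) - c' * z) * (y z * u1 z - y1 z * u z)) / (z * (1 - z)) = 0"
      by simp
    then have zero: "(y z * u2 z - y2 z * u z) + (c / z + (- c' / (1 - z))) * (y z * u1 z - y1 z * u z) = 0"
      using z by (simp add: divide_simps) (simp add: algebra_simps)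
    have "z powr c * (1 - z) powr c' * (y z * u2 z - y2 z * u z) +
        (z powr c * ((1 - z) powr c' * (- c' / (1 - z))) + z powr c * (c / z) * (1 - z) powr c')
            * (y z * u1 z - y1 z * u z)
      = z powr c * (1 - z) powr c' * ((y z * u2 z - y2 z * u z) + (c / z + (- c' / (1 - z)))
          * (y z * u1 z - y1 z * u z))"
      by (simp only: algebra_simps)
    then have "z powr c * (1 - z) powr c' * (y z * u2 z - y2 z * u z) +
        (z powr c * ((1 - z) powr c' * (- c' / (1 - z))) + z powr c * (c / z) * (1 - z) powr c')
            * (y z * u1 z - y1 z * u z) = 0"
      using zero by simp
    then have "((\<lambda>z. z powr c * (1 - z) powr c' * (y z * u1 z - y1 z * u z)) has_real_derivative 0) (at z)"
      by (intro DERIV_cong[OF DERIV_mult[OF DERIV_mult[OF p q] w]]) (simp add: mult.commute add.commute)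
    then show ?thesis by (rule DERIV_subset) simp
  qed
  then obtain \<kappa> where "\<And>z. z \<in> {0<..<1} \<Longrightarrow> z powr c * (1 - z) powr c' * (y z * u1 z - y1 z * u z) = \<kappa>"
    using has_field_derivative_zero_constant[of "{0<..<1::real}"
        "\<lambda>z. z powr c * (1 - z) powr c' * (y z * u1 z - y1 z * u z)"]
    by (auto simp: convex_real_interval)
  then show ?thesis using that by (auto simp: c'_def)
qed

section \<open>The connection formula\<close>

lemma one_minus_powr_sums:
  fixes z :: real
  assumes "norm z < 1"
  shows "(\<lambda>k. pochhammer p k / fact k * z ^ k) sums (1 - z) powr (- p)"
proof -
  have "((- p) gchoose k) * (- z) ^ k = pochhammer p k / fact k * z ^ k" for k
    using power_mult_distrib[of "-1" "-1::real" k]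
    by (simp add: gbinomial_pochhammer power_minus[of z])
  then show ?thesis using gen_binomial_real[of "- z" "- p"] assms by simp
qed

text \<open>An Abelian theorem: the comparison series with coefficients \<open>pochhammer p k / fact k\<close> sums to
  $(1-z)^{-p}$.\<close>

lemma powser_asymp_at_1:
  fixes \<alpha> :: "nat \<Rightarrow> real" and p :: real
  assumes "p > 0" "\<And>z. norm z < 1 \<Longrightarrow> summable (\<lambda>k. \<alpha> k * z ^ k)"
    and lim: "(\<lambda>k. \<alpha> k / (pochhammer p k / fact k)) \<longlonglongrightarrow> L"
  shows "((\<lambda>z. (1 - z) powr p * (\<Sum>k. \<alpha> k * z ^ k)) \<longlongrightarrow> L) (at_left 1)"
proof (rule tendstoI)
  fix e :: real assume e: "e > 0"
  define \<beta> where "\<beta> k = pochhammer p k / fact k" for k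
  have \<beta>: "\<beta> k > 0" for k using assms(1) by (simp add: \<beta>_def pochhammer_pos)
  obtain N where N: "\<And>k. k \<ge> N \<Longrightarrow> \<bar>\<alpha> k / \<beta> k - L\<bar> < e / 2"
    using tendstoD[OF lim, of "e / 2"] e by (auto simp: eventually_sequentially dist_real_def \<beta>_def)
  define C where "C = (\<Sum>k<N. \<bar>\<alpha> k - L * \<beta> k\<bar>)"
  have bound: "\<bar>(1 - z) powr p * (\<Sum>k. \<alpha> k * z ^ k) - L\<bar> \<le> (1 - z) powr p * C + e / 2"
    if z: "0 < z" "z < 1" for z
  proof -
    have S\<beta>: "(\<lambda>k. \<beta> k * z ^ k) sums (1 - z) powr (- p)"
      unfolding \<beta>_def using z by (intro one_minus_powr_sums) auto
    have S\<alpha>: "(\<lambda>k. \<alpha> k * z ^ k) sums (\<Sum>k. \<alpha> k * z ^ k)"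
      using assms(2)[of z] z by (auto intro: summable_sums)
    have D: "(\<lambda>k. \<alpha> k * z ^ k - L * (\<beta> k * z ^ k)) sums ((\<Sum>k. \<alpha> k * z ^ k) - L * (1 - z) powr (- p))"
      by (intro sums_diff sums_mult S\<alpha> S\<beta>)
    \<comment> \<open>The error is split into finitely many early terms, whose total
      \<open>C\<close> is killed by (1 - z)^p, and e/2 times the comparison series, which the same
      factor turns into e/2.\<close>
    have maj: "(\<lambda>k. (if k \<in> {..<N} then \<bar>\<alpha> k - L * \<beta> k\<bar> else 0) + e / 2 * (\<beta> k * z ^ k)) sums
        (C + e / 2 * (1 - z) powr (- p))"
      unfolding C_def by (intro sums_add sums_mult S\<beta> sums_If_finite_set) simp
    have le: "norm (\<alpha> k * z ^ k - L * (\<beta> k * z ^ k)) \<le>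
        (if k \<in> {..<N} then \<bar>\<alpha> k - L * \<beta> k\<bar> else 0) + e / 2 * (\<beta> k * z ^ k)" for k
    proof -
      have *: "norm (\<alpha> k * z ^ k - L * (\<beta> k * z ^ k)) = \<bar>\<alpha> k - L * \<beta> k\<bar> * z ^ k"
        using z by (simp add: abs_mult flip: mult.assoc left_diff_distrib)
      show ?thesis
      proof (cases "k < N")
        case True
        have "\<bar>\<alpha> k - L * \<beta> k\<bar> * z ^ k \<le> \<bar>\<alpha> k - L * \<beta> k\<bar> * 1"
          using z by (intro mult_left_mono power_le_one) auto
        moreover have "0 \<le> e / 2 * (\<beta> k * z ^ k)" using e z \<beta>[of k] by simp
        ultimately show ?thesis unfolding * using True by simp
      next
        case False
        have "\<alpha> k - L * \<beta> k = (\<alpha> k / \<beta> k - L) * \<beta> k" using \<beta>[of k] by (simp add: field_simps)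
        then have "\<bar>\<alpha> k - L * \<beta> k\<bar> = \<bar>\<alpha> k / \<beta> k - L\<bar> * \<beta> k" using \<beta>[of k] by (simp add: abs_mult)
        also have "\<dots> \<le> e / 2 * \<beta> k" using N[of k] False \<beta>[of k] by (intro mult_right_mono) auto
        finally have "\<bar>\<alpha> k - L * \<beta> k\<bar> * z ^ k \<le> e / 2 * \<beta> k * z ^ k"
          using z by (intro mult_right_mono) auto
        then show ?thesis unfolding * using False by simp
      qed
    qed
    have "\<bar>(\<Sum>k. \<alpha> k * z ^ k) - L * (1 - z) powr (- p)\<bar> \<le> C + e / 2 * (1 - z) powr (- p)"
      using norm_suminf_le[OF le sums_summable[OF maj]] sums_unique[OF D] sums_unique[OF maj] by simp
    then have "(1 - z) powr p * \<bar>(\<Sum>k. \<alpha> k * z ^ k) - L * (1 - z) powr (- p)\<bar>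
        \<le> (1 - z) powr p * (C + e / 2 * (1 - z) powr (- p))"
      by (intro mult_left_mono) auto
    moreover have cancel: "(1 - z) powr p * (x * (1 - z) powr (- p)) = x" for x
      using z by (simp add: powr_minus field_simps)
    moreover have "(1 - z) powr p * \<bar>(\<Sum>k. \<alpha> k * z ^ k) - L * (1 - z) powr (- p)\<bar>
        = \<bar>(1 - z) powr p * ((\<Sum>k. \<alpha> k * z ^ k) - L * (1 - z) powr (- p))\<bar>"
      by (simp add: abs_mult)
    ultimately show ?thesis by (simp add: right_diff_distrib distrib_left)
  qed
  have "((\<lambda>z. (1 - z) powr p * C + e / 2) \<longlongrightarrow> 0 * C + e / 2) (at_left 1)"
    using assms(1) by (intro tendsto_intros) real_asymp
  from order_tendstoD(2)[OF this, of e]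
  have "eventually (\<lambda>z. (1 - z) powr p * C + e / 2 < e) (at_left 1)"
    using e by simp
  moreover have "eventually (\<lambda>z::real. z \<in> {0<..<1}) (at_left 1)"
    by (rule eventually_at_leftI[of 0]) auto
  ultimately show "eventually (\<lambda>z. dist ((1 - z) powr p * (\<Sum>k. \<alpha> k * z ^ k)) L < e) (at_left 1)"
    by eventually_elim (use bound in \<open>force simp: dist_real_def\<close>)
qed

lemma pochhammer_eq_rGamma_series:
  "k > 0 \<Longrightarrow> pochhammer (x::real) (Suc k) = rGamma_series x k * fact k * real k powr x"
  by (simp add: rGamma_series_def powr_def)

text \<open>The Pochhammer symbol of x with k + 1 factors is k! k^x times an approximant of
  1/Gamma(x). The balance c + c' = a + b + 1 leaves exactly the power k^(-1), compensated by the
  factor k. Writing \<open>rGamma\<close> for a and b admits terminating series.\<close>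

lemma pochhammer_quotient_asymp:
  fixes a b c c' :: real
  assumes "c \<notin> \<int>\<^sub>\<le>\<^sub>0" "c' \<notin> \<int>\<^sub>\<le>\<^sub>0" "c + c' = a + b + 1"
  shows "(\<lambda>k. real k * (pochhammer a (Suc k) * pochhammer b (Suc k) /
            (pochhammer c (Suc k) * pochhammer c' (Suc k)))) \<longlonglongrightarrow> Gamma c * Gamma c' * rGamma a * rGamma b"
proof -
  have nz: "rGamma c \<noteq> 0" "rGamma c' \<noteq> 0" using assms by (simp_all add: rGamma_eq_zero_iff)
  have "(\<lambda>k. rGamma_series a k * rGamma_series b k / (rGamma_series c k * rGamma_series c' k))
      \<longlonglongrightarrow> rGamma a * rGamma b / (rGamma c * rGamma c')"
    using nz by (intro tendsto_intros) auto
  moreover have "eventually (\<lambda>k. rGamma_series a k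
      * rGamma_series b k / (rGamma_series c k * rGamma_series c' k)
     = real k * (pochhammer a (Suc k) * pochhammer b (Suc k)
         / (pochhammer c (Suc k) * pochhammer c' (Suc k)))) sequentially"
    using eventually_gt_at_top[of 0]
  proof eventually_elim
    case (elim k)
    have "real k powr a * real k powr b * real k = real k powr c * real k powr c'"
      using elim assms(3) by (simp flip: powr_add add: powr_mult_base mult.commute add_ac)
    then have one: "real k powr a * real k powr b * real k / (real k powr c * real k powr c') = 1"
      using elim by simp
    have "real k * (pochhammer a (Suc k)
        * pochhammer b (Suc k) / (pochhammer c (Suc k) * pochhammer c' (Suc k)))
      = rGamma_series a k * rGamma_series b k / (rGamma_series c k * rGamma_series c' k) *
        (real k powr a * real k powr b * real k / (real k powr c * real k powr c'))"
      using elim by (simp add: pochhammer_eq_rGamma_series mult_ac)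
    then show ?case unfolding one by simp
  qed
  ultimately show ?thesis
    using nz by (auto intro: Lim_transform_eventually simp: Gamma_def field_simps)
qed

text \<open>Input for the Abelian theorem: the derivative of the series grows like (1 - z)^(-c') at
  z = 1, with this constant. The next lemma says that the series itself is of smaller order, its
  coefficients lacking the factor k.\<close>

lemma hyp_coeff_diffs_asymp:
  assumes "c \<notin> \<int>\<^sub>\<le>\<^sub>0" "c' > 0" "c + c' = a + b + 1"
  shows "(\<lambda>k. diffs (hyp_coeff a b c) k / (pochhammer c' k / fact k)) \<longlonglongrightarrow> Gamma c * Gamma c'
      * rGamma a * rGamma b"
proof -
  have c': "c' \<notin> \<int>\<^sub>\<le>\<^sub>0" using assms(2) by auto
  have "(\<lambda>k. (real k * (pochhammer a (Suc k) * pochhammer b (Suc k) /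
            (pochhammer c (Suc k) * pochhammer c' (Suc k)))) * ((c' + real k) / real k))
     \<longlonglongrightarrow> Gamma c * Gamma c' * rGamma a * rGamma b * 1"
    by (intro tendsto_mult pochhammer_quotient_asymp assms c') real_asymp
  moreover have "eventually (\<lambda>k. (real k * (pochhammer a (Suc k) * pochhammer b (Suc k) /
            (pochhammer c (Suc k) * pochhammer c' (Suc k)))) * ((c' + real k) / real k)
      = diffs (hyp_coeff a b c) k / (pochhammer c' k / fact k)) sequentially"
    using eventually_gt_at_top[of 0]
  proof eventually_elim
    case (elim k)
    have "c' + real k \<noteq> 0" "pochhammer c' k \<noteq> 0" "pochhammer c k \<noteq> 0" "c + real k \<noteq> 0"
      using nonpos_Ints_pochhammer assms(1) c' by auto
    with elim show ?case
      by (simp add: diffs_def hyp_coeff_def pochhammer_Suc divide_simps)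
  qed
  ultimately show ?thesis by (auto intro: Lim_transform_eventually)
qed

lemma hyp_coeff_asymp:
  assumes "c \<notin> \<int>\<^sub>\<le>\<^sub>0" "c' > 0" "c + c' = a + b + 1"
  shows "(\<lambda>k. hyp_coeff a b c k / (pochhammer c' k / fact k)) \<longlonglongrightarrow> 0"
proof (rule LIMSEQ_imp_Suc)
  have c': "c' \<notin> \<int>\<^sub>\<le>\<^sub>0" using assms(2) by auto
  have "(\<lambda>k. (real k * (pochhammer a (Suc k) * pochhammer b (Suc k) /
            (pochhammer c (Suc k) * pochhammer c' (Suc k)))) * (1 / real k))
     \<longlonglongrightarrow> Gamma c * Gamma c' * rGamma a * rGamma b * 0"
    by (intro tendsto_mult pochhammer_quotient_asymp assms c') real_asymp
  moreover have "eventually (\<lambda>k. (real k * (pochhammer a (Suc k) * pochhammer b (Suc k) /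
            (pochhammer c (Suc k) * pochhammer c' (Suc k)))) * (1 / real k)
      = hyp_coeff a b c (Suc k) / (pochhammer c' (Suc k) / fact (Suc k))) sequentially"
    using eventually_gt_at_top[of 0]
    by eventually_elim (simp add: hyp_coeff_def del: pochhammer_Suc fact_Suc)
  ultimately show "(\<lambda>k. hyp_coeff a b c (Suc k) / (pochhammer c' (Suc k) / fact (Suc k))) \<longlonglongrightarrow> 0"
    by (auto intro: Lim_transform_eventually)
qed

text \<open>The functions $f$, $h = z^{1-c} k$ at $z = 0$ and $g(1-z)$ at $z = 1$ solve the same equation, so
  their pairwise Wronskians times $z^c (1-z)^p$ are constants. The constant for $(f,h)$ is
  read off at $z = 0$, the other two at $z = 1$, where the singular behaviour of $f'$ and $k'$ comes
  from the growth of their coefficients.\<close>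

lemma hypergeom_connection:
  fixes a b c z :: real
  defines "p \<equiv> a + b + 1 - c"
  assumes c: "c \<notin> \<int>" and p: "p > 0" and z: "0 < z" "z < 1"
  shows "(1 - c) * hypergeom a b p (1 - z) =
    Gamma (2 - c) * Gamma p * rGamma (a - c + 1) * rGamma (b - c + 1) * hypergeom a b c z
    - Gamma c * Gamma p * rGamma a * rGamma b
        * (z powr (1 - c) * hypergeom (a - c + 1) (b - c + 1) (2 - c) z)"
proof -
  have cs: "c \<notin> \<int>\<^sub>\<le>\<^sub>0" "2 - c \<notin> \<int>\<^sub>\<le>\<^sub>0" "p \<notin> \<int>\<^sub>\<le>\<^sub>0"
    using c p Ints_diff[of 2 "2 - c"] by (auto dest: nonpos_Ints_Int)
  define a2 b2 where "a2 = a - c + 1" and "b2 = b - c + 1"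
  define f f1 where "f = hypergeom a b c" and "f1 = (\<lambda>z. \<Sum>k. diffs (hyp_coeff a b c) k * z ^ k)"
  define k k1 where "k = hypergeom a2 b2 (2 - c)" and
      "k1 = (\<lambda>z. \<Sum>j. diffs (hyp_coeff a2 b2 (2 - c)) j * z ^ j)"
  define g g1 where "g = hypergeom a b p" and "g1 = (\<lambda>z. \<Sum>k. diffs (hyp_coeff a b p) k * z ^ k)"
  define e where "e = 1 - c"
  define Lf Lk where "Lf = Gamma c * Gamma p * rGamma a * rGamma b"
    and "Lk = Gamma (2 - c) * Gamma p * rGamma a2 * rGamma b2"
  obtain f2 where F: "hyp_ode a b c {-1<..<1} f f1 f2"
    using hyp_ode_hypergeom[OF cs(1)] unfolding f_def f1_def by blast
  obtain k2 where K: "hyp_ode a2 b2 (2 - c) {-1<..<1} k k1 k2"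
    using hyp_ode_hypergeom[OF cs(2)] unfolding k_def k1_def by blast
  obtain g2 where G: "hyp_ode a b p {-1<..<1} g g1 g2"
    using hyp_ode_hypergeom[OF cs(3)] unfolding g_def g1_def by blast
  define h h1 where "h = (\<lambda>z. z powr e * k z)" and "h1 = (\<lambda>z. z powr e * (k1 z + e * k z / z))"
  obtain h2 where H: "hyp_ode a b c {0<..<1} h h1 h2"
    using hyp_ode_twist[OF hyp_ode_subset[OF K[unfolded a2_def b2_def], of "{0<..<1}"]]
    unfolding h_def h1_def e_def by force
  have F': "hyp_ode a b c {0<..<1} f f1 f2" by (rule hyp_ode_subset[OF F]) auto
  have G': "hyp_ode a b c {0<..<1} (\<lambda>z. g (1 - z)) (\<lambda>z. - g1 (1 - z)) (\<lambda>z. g2 (1 - z))"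
    by (rule hyp_ode_reflect[OF G]) (auto simp: p_def)
  obtain \<kappa>fh where fh: "\<And>z. 0 < z \<Longrightarrow> z < 1 \<Longrightarrow> z powr c * (1 - z) powr p * (f z * h1 z - f1 z * h z) = \<kappa>fh"
    using hyp_ode_wronskian[OF F' H] unfolding p_def by blast
  obtain \<kappa>gh where gh: "\<And>z. 0 < z \<Longrightarrow> z < 1 \<Longrightarrow>
      z powr c * (1 - z) powr p * (g (1 - z) * h1 z - (- g1 (1 - z)) * h z) = \<kappa>gh"
    using hyp_ode_wronskian[OF G' H] unfolding p_def by blast
  obtain \<kappa>fg where fg: "\<And>z. 0 < z \<Longrightarrow> z < 1 \<Longrightarrow>
      z powr c * (1 - z) powr p * (f z * (- g1 (1 - z)) - f1 z * g (1 - z)) = \<kappa>fg"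
    using hyp_ode_wronskian[OF F' G'] unfolding p_def by blast
  have cont: "isCont f 0" "isCont f1 0" "isCont k 0" "isCont k1 0" "isCont g 0" "isCont g1 0"
    using F K G by (auto simp: hyp_ode_def intro: DERIV_isCont)
  have at0: "f 0 = 1" "k 0 = 1" "g 0 = 1" by (simp_all add: f_def k_def g_def)
  have ev_right: "eventually (\<lambda>z::real. 0 < z \<and> z < 1) (at_right 0)"
    by (rule eventually_at_rightI[of 0 1]) auto
  have ev_left: "eventually (\<lambda>z::real. 0 < z \<and> z < 1) (at_left 1)"
    by (rule eventually_at_leftI[of 0 1]) auto
  have "\<kappa>fh = e"
  proof -
    have lims: "(f \<longlongrightarrow> 1) (at_right 0)" "(f1 \<longlongrightarrow> f1 0) (at_right 0)" "(k \<longlongrightarrow> 1) (at_right 0)"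
        "(k1 \<longlongrightarrow> k1 0) (at_right 0)"
      using cont at0 by (auto simp: isCont_def intro: tendsto_mono[OF at_le])
    have lim: "((\<lambda>z. (1 - z) powr p * (f z * (z * k1 z + e * k z) - z * f1 z * k z))
        \<longlongrightarrow> (1 - 0) powr p * (1 * (0 * k1 0 + e * 1) - 0 * f1 0 * 1)) (at_right 0)"
      by (intro tendsto_intros lims) auto
    have ev: "eventually (\<lambda>z. (1 - z) powr p * (f z * (z * k1 z + e * k z) - z * f1 z * k z)
        = \<kappa>fh) (at_right 0)"
      using ev_right
    proof eventually_elim
      case (elim z)
      have "z powr c * z powr e = z" using elim by (simp add: e_def flip: powr_add)
      moreover have "z powr c * (1 - z) powr p * (f z * h1 z - f1 z * h z) =
          (1 - z) powr p * ((z powr c * z powr e) * (f z * (k1 z + e * k z / z) - f1 z * k z))"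
        unfolding h_def h1_def by (simp only: algebra_simps)
      ultimately have "\<kappa>fh = (1 - z) powr p * (z * (f z * (k1 z + e * k z / z) - f1 z * k z))"
        using fh[of z] elim by simp
      moreover have "z * (f z * (k1 z + e * k z / z) - f1 z * k z)
          = f z * (z * k1 z + e * k z) - z * f1 z * k z"
        using elim by (simp add: field_simps)
      ultimately show ?case by simp
    qed
    show ?thesis
      using tendsto_unique[OF trivial_limit_at_right_real tendsto_eventually[OF ev] lim] by simp
  qed
  have lim_refl: "((\<lambda>z. g (1 - z)) \<longlongrightarrow> 1) (at_left 1)" "((\<lambda>z. g1 (1 - z)) \<longlongrightarrow> g1 0) (at_left 1)"
  proof -
    have "filterlim (\<lambda>z::real. 1 - z) (nhds 0) (at_left 1)" by real_asymp
    then show "((\<lambda>z. g (1 - z)) \<longlongrightarrow> 1) (at_left 1)" "((\<lambda>z. g1 (1 - z)) \<longlongrightarrow> g1 0) (at_left 1)"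
      using cont at0 isCont_tendsto_compose by fastforce+
  qed
  have sm: "norm x < 1 \<Longrightarrow> summable (\<lambda>j. hyp_coeff a b c j * x ^ j)"
      "norm x < 1 \<Longrightarrow> summable (\<lambda>j. hyp_coeff a2 b2 (2 - c) j * x ^ j)" for x :: real
    by (auto intro!: hyp_rec_summable[OF hyp_rec_hyp_coeff] cs simp del: real_norm_def)
  \<comment> \<open>Both series have the same exponent p at z = 1, since (2 - c) + p = a2 + b2 +
    1.\<close>
  have lims: "((\<lambda>z. (1 - z) powr p * f z) \<longlongrightarrow> 0) (at_left 1)" "((\<lambda>z. (1 - z) powr p * k z) \<longlongrightarrow> 0) (at_left 1)"
    "((\<lambda>z. (1 - z) powr p * f1 z) \<longlongrightarrow> Lf) (at_left 1)" "((\<lambda>z. (1 - z) powr p * k1 z) \<longlongrightarrow> Lk) (at_left 1)"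
    unfolding f_def k_def f1_def k1_def Lf_def Lk_def hypergeom_eq_powser
    by (intro powser_asymp_at_1 p sm termdiff_converges hyp_coeff_asymp hyp_coeff_diffs_asymp cs;
        simp add: p_def a2_def b2_def)+
  have "\<kappa>gh = Lk"
  proof -
    have lim: "((\<lambda>z. z powr c * z powr e
        * (g (1 - z) * ((1 - z) powr p * k1 z + e * ((1 - z) powr p * k z) / z) + g1 (1 - z)
        * ((1 - z) powr p * k z)))
        \<longlongrightarrow> 1 powr c * 1 powr e * (1 * (Lk + e * 0 / 1) + g1 0 * 0)) (at_left 1)"
      by (intro tendsto_intros lims lim_refl) auto
    have ev: "eventually (\<lambda>z. z powr c * z powr e
        * (g (1 - z) * ((1 - z) powr p * k1 z + e * ((1 - z) powr p * k z) / z) + g1 (1 - z)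
        * ((1 - z) powr p * k z)) = \<kappa>gh) (at_left 1)"
      using ev_left
    proof eventually_elim
      case (elim z)
      then have "\<kappa>gh = z powr c * (1 - z) powr p * (g (1 - z) * h1 z - (- g1 (1 - z)) * h z)"
        by (intro gh[symmetric]) auto
      then show ?case unfolding h_def h1_def by (simp add: algebra_simps)
    qed
    show ?thesis
      using tendsto_unique[OF trivial_limit_at_left_real tendsto_eventually[OF ev] lim] by simp
  qed
  have "\<kappa>fg = - Lf"
  proof -
    have lim: "((\<lambda>z. z powr c * (- ((1 - z) powr p * f z) * g1 (1 - z) - (1 - z) powr p * f1 z * g (1 - z)))
        \<longlongrightarrow> 1 powr c * (- 0 * g1 0 - Lf * 1)) (at_left 1)"
      by (intro tendsto_intros lims lim_refl) auto
    have ev: "eventually (\<lambda>z. z powr c * (- ((1 - z) powr p * f z) * g1 (1 - z)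
        - (1 - z) powr p * f1 z * g (1 - z)) = \<kappa>fg) (at_left 1)"
      using ev_left
    proof eventually_elim
      case (elim z)
      then have "\<kappa>fg = z powr c * (1 - z) powr p * (f z * (- g1 (1 - z)) - f1 z * g (1 - z))"
        by (intro fg[symmetric]) auto
      then show ?case unfolding h_def h1_def by (simp add: algebra_simps)
    qed
    show ?thesis
      using tendsto_unique[OF trivial_limit_at_left_real tendsto_eventually[OF ev] lim] by simp
  qed
  \<comment> \<open>A 3 by 3 determinant with a repeated row of values of f, g, h vanishes;
    expanding it along that row expresses g in terms of f and h with the Wronskians as
    coefficients.\<close>
  have "g (1 - z) * \<kappa>fh = f z * \<kappa>gh + h z * \<kappa>fg"
    unfolding fh[OF z, symmetric] gh[OF z, symmetric] fg[OF z, symmetric] by (simp only: algebra_simps)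
  then have "(1 - c) * g (1 - z) = Lk * f z - Lf * h z"
    unfolding \<open>\<kappa>fh = e\<close> \<open>\<kappa>gh = Lk\<close> \<open>\<kappa>fg = - Lf\<close> e_def by (simp add: mult.commute)
  then show ?thesis
    unfolding g_def f_def h_def k_def Lf_def Lk_def a2_def b2_def e_def .
qed

section \<open>The hyperbolic Laplacian\<close>

lemma matrix_inv_scaled_identity:
  fixes c :: real
  assumes "c \<noteq> 0"
  shows "matrix_inv (c *\<^sub>R mat 1 :: real^'n^'n) = (1 / c) *\<^sub>R mat 1"
proof -
  let ?A = "c *\<^sub>R mat 1 :: real^'n^'n" and ?B = "(1 / c) *\<^sub>R mat 1 :: real^'n^'n"
  have AB: "?A ** ?B = mat 1" "?B ** ?A = mat 1"
    using assms by (simp_all add: matrix_scalar_ac flip: scalar_matrix_assoc)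
  have "?A ** matrix_inv ?A = mat 1"
    unfolding matrix_inv_def by (rule conjunct1[OF
        someI[of "\<lambda>A'. ?A ** A' = mat 1 \<and> A' ** ?A = mat 1" ?B]]) (use AB in simp)
  then have "?B ** (?A ** matrix_inv ?A) = ?B" by simp
  then show ?thesis by (simp only: matrix_mul_assoc AB(2) matrix_mul_lid)
qed

lemma det_scaled_identity: "det (c *\<^sub>R mat 1 :: real^'n::finite^'n) = c ^ CARD('n)"
  by (subst det_diagonal) (simp_all add: mat_def)

lemma rho_pos: "x \<in> ball 0 1 \<Longrightarrow> 0 < rho x"
  by (simp add: rho_def power_less_one_iff)

lemma hyperbolic_metric_eq: "hyperbolic_metric x = (1 / (rho x)\<^sup>2) *\<^sub>R mat 1"
  by (simp add: hyperbolic_metric_def flat_metric_def rho_def power2_eq_square divide_simps)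

lemma has_derivative_rho: "(rho has_derivative (\<lambda>v. - (x \<bullet> v))) (at x)"
  unfolding rho_def[abs_def]
  by (auto intro!: derivative_eq_intros has_derivative_norm_square)

lemma partial_transform:
  assumes "open U" "x \<in> U" "\<And>y. y \<in> U \<Longrightarrow> f y = g y" "(g has_derivative g') (at x)"
  shows "partial i f x = g' (axis i 1)"
  by (rule partial_eq, rule has_derivative_transform_within_open[OF assms(4,1,2)]) (simp add: assms(3))

text \<open>This holds without differentiability: both functions have the same set of derivatives at
  x, so the choice inside \<open>frechet_derivative\<close> is the same.\<close>

lemma partial_cong:
  assumes "open U" "x \<in> U" "\<And>y. y \<in> U \<Longrightarrow> f y = g y"
  shows "partial i f x = partial i g x"
proof -
  have "(f has_derivative D) (at x) \<longleftrightarrow> (g has_derivative D) (at x)" for D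
    using has_derivative_transform_within_open[OF _ assms(1,2)] assms(3) by (metis (no_types, lifting))
  then show ?thesis by (simp add: partial_def frechet_derivative_def)
qed

text \<open>Allows a solution to be replaced by 0 outside the ball, as the normalization in
  \<open>vartheta\<close> demands.\<close>

lemma laplace_beltrami_cong:
  assumes "open U" "x \<in> U" "\<And>y. y \<in> U \<Longrightarrow> u y = v y"
  shows "laplace_beltrami g u x = laplace_beltrami g v x"
proof -
  have "partial j u y = partial j v y" if "y \<in> U" for y j
    using partial_cong[OF assms(1) that] assms(3) by blast
  then show ?thesis
    unfolding laplace_beltrami_def
    by (intro arg_cong2[where f = "(/)"] sum.cong refl partial_cong[OF assms(1,2)]) auto
qed

text \<open>The expansion of \<rho>^(n+1) div(\<rho>^(1-n) grad u), the Laplacian of the conformal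
  metric \<rho>^(-2) |dx|^2 in dimension n + 1, using that the gradient of \<rho> is -x.\<close>

definition hyp_laplacian :: "nat \<Rightarrow> (real^'n::finite \<Rightarrow> real) \<Rightarrow> real^'n \<Rightarrow> real" where
  "hyp_laplacian n u x = (rho x)\<^sup>2 * (\<Sum>i\<in>UNIV. partial i (partial i u) x)
     + (real n - 1) * rho x * (\<Sum>i\<in>UNIV. x $ i * partial i u x)"

lemma Ck_on_2_partial:
  assumes "Ck_on (Suc (Suc 0)) U u" "x \<in> U"
  shows "(u has_derivative frechet_derivative u (at x)) (at x)"
    "(partial i u has_derivative frechet_derivative (partial i u) (at x)) (at x)"
  using assms by (auto simp: frechet_derivative_works)

lemma laplace_beltrami_hyperbolic:
  fixes u :: "real^'n::finite \<Rightarrow> real"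
  assumes card: "CARD('n) = n + 1" and u: "Ck_on (Suc (Suc 0)) (ball 0 1) u" and x: "x \<in> ball 0 1"
  shows "laplace_beltrami hyperbolic_metric u x = hyp_laplacian n u x"
proof -
  have vol: "sqrt (det (hyperbolic_metric y :: real^'n^'n)) = rho y powr (- (real n + 1))" if
      "y \<in> ball 0 1" for y :: "real^'n"
  proof -
    have "sqrt ((1 / (rho y)\<^sup>2) ^ (n + 1)) = (1 / rho y) ^ (n + 1)"
      using rho_pos[OF that] by (simp add: real_sqrt_power real_sqrt_divide del: power_Suc)
    also have "\<dots> = rho y powr (- (real n + 1))"
      using powr_realpow[OF rho_pos[OF that], of "n + 1"] powr_minus_divide[of "rho y" "real n + 1"]
      by (simp add: power_one_over add_ac del: power_Suc)
    finally show ?thesis by (simp add: hyperbolic_metric_eq det_scaled_identity card)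
  qed
  have inner: "sqrt (det (hyperbolic_metric y))
      * (\<Sum>j\<in>UNIV. matrix_inv (hyperbolic_metric y) $ i $ j * partial j u y)
      = rho y powr (1 - real n) * partial i u y" if "y \<in> ball 0 1" for y i
  proof -
    have "matrix_inv (hyperbolic_metric y :: real^'n^'n) = (rho y)\<^sup>2 *\<^sub>R mat 1"
      using rho_pos[OF that] by (simp add: hyperbolic_metric_eq matrix_inv_scaled_identity)
    then have "(\<Sum>j\<in>UNIV. matrix_inv (hyperbolic_metric y) $ i $ j * partial j u y)
        = (rho y)\<^sup>2 * partial i u y"
      by (simp add: mat_def if_distrib[of "\<lambda>z. z * _"] if_distrib[of "\<lambda>z. _ * z"] cong: if_cong)
    moreover have "rho y powr (- (real n + 1)) * (rho y)\<^sup>2 = rho y powr (1 - real n)"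
      using rho_pos[OF that] by (simp flip: powr_add powr_numeral)
    ultimately show ?thesis using vol[OF that] by (simp flip: mult.assoc)
  qed
  have "partial i (\<lambda>y. sqrt (det (hyperbolic_metric y))
      * (\<Sum>j\<in>UNIV. matrix_inv (hyperbolic_metric y) $ i $ j * partial j u y)) x
      = rho x powr (1 - real n) * partial i (partial i u) x
        - (1 - real n) * rho x powr (- real n) * x $ i * partial i u x" for i
  proof -
    have r: "rho x > 0" using rho_pos[OF x] .
    have "((\<lambda>r. r powr (1 - real n)) has_derivative (\<lambda>v. (1 - real n) * rho x powr (- real n)
        * v)) (at (rho x))"
      using has_real_derivative_powr[OF r, of "1 - real n"] by (simp add: has_field_derivative_def)
    from has_derivative_compose[OF has_derivative_rho this]
    have d: "((\<lambda>y. rho y powr (1 - real n)) has_derivative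
        (\<lambda>v. (1 - real n) * rho x powr (- real n) * (- (x \<bullet> v)))) (at x)" .
    show ?thesis
      by (subst partial_transform[OF open_ball x inner
          has_derivative_mult[OF d Ck_on_2_partial(2)[OF u x]]])
        (simp_all add: partial_def inner_axis)
  qed
  then have "laplace_beltrami hyperbolic_metric u x =
      (\<Sum>i\<in>UNIV. rho x powr (1 - real n) * partial i (partial i u) x
        - (1 - real n) * rho x powr (- real n) * x $ i * partial i u x) / rho x powr (- (real n + 1))"
    using vol[OF x] by (simp add: laplace_beltrami_def)
  also have "\<dots> = rho x powr (1 - real n) / rho x powr (- (real n + 1))
      * (\<Sum>i\<in>UNIV. partial i (partial i u) x)
      - (1 - real n) * (rho x powr (- real n) / rho x powr (- (real n + 1)))
          * (\<Sum>i\<in>UNIV. x $ i * partial i u x)"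
    by (simp add: sum_subtractf sum_distrib_left sum_divide_distrib diff_divide_distrib mult.assoc)
  also have "rho x powr (1 - real n) / rho x powr (- (real n + 1)) = (rho x)\<^sup>2"
    using rho_pos[OF x] by (simp flip: powr_diff)
  also have "rho x powr (- real n) / rho x powr (- (real n + 1)) = rho x"
    using rho_pos[OF x] by (simp flip: powr_diff)
  finally show ?thesis by (simp add: hyp_laplacian_def algebra_simps)
qed

lemma Ck_on_2_partial_linear:
  fixes u v :: "real^'n::finite \<Rightarrow> real"
  assumes u: "Ck_on (Suc (Suc 0)) U u" and v: "Ck_on (Suc (Suc 0)) U v" and U: "open U" and x: "x \<in> U"
  shows "partial i (\<lambda>y. u y + c * v y) x = partial i u x + c * partial i v x"
    "partial i (partial i (\<lambda>y. u y + c * v y)) x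
        = partial i (partial i u) x + c * partial i (partial i v) x"
proof -
  have 1: "partial i (\<lambda>y. u y + c * v y) x = partial i u x + c * partial i v x" if "x \<in> U" for x
    by (subst partial_eq[OF has_derivative_add[OF Ck_on_2_partial(1)[OF u that]
        has_derivative_mult_right[OF Ck_on_2_partial(1)[OF v that]]]])
      (simp add: partial_def)
  show "partial i (partial i (\<lambda>y. u y + c * v y)) x
      = partial i (partial i u) x + c * partial i (partial i v) x"
    by (subst partial_transform[OF U x 1
        has_derivative_add[OF Ck_on_2_partial(2)[OF u x]
        has_derivative_mult_right[OF Ck_on_2_partial(2)[OF v x]]]])
      (simp_all add: partial_def)
  show "partial i (\<lambda>y. u y + c * v y) x = partial i u x + c * partial i v x" by (rule 1[OF x])
qed

lemma hyp_laplacian_linear: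
  fixes u v :: "real^'n::finite \<Rightarrow> real"
  assumes "Ck_on (Suc (Suc 0)) U u" "Ck_on (Suc (Suc 0)) U v" "open U" "x \<in> U"
  shows "hyp_laplacian n (\<lambda>y. u y + c * v y) x = hyp_laplacian n u x + c * hyp_laplacian n v x"
  unfolding hyp_laplacian_def Ck_on_2_partial_linear[OF assms]
  by (simp add: sum.distrib sum_distrib_left algebra_simps)

lemma hyp_laplacian_radial:
  fixes x :: "real^'n::finite"
  assumes card: "CARD('n) = n + 1"
    and d: "\<And>t. 0 \<le> t \<Longrightarrow> t < 1 \<Longrightarrow> (\<phi> has_real_derivative \<phi>1 t) (at t)"
      "\<And>t. 0 \<le> t \<Longrightarrow> t < 1 \<Longrightarrow> (\<phi>1 has_real_derivative \<phi>2 t) (at t)"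
    and x: "x \<in> ball 0 1"
  defines "t \<equiv> (norm x)\<^sup>2"
  shows "hyp_laplacian n (\<lambda>x::real^'n. \<phi> ((norm x)\<^sup>2)) x =
    ((1 - t) / 2)\<^sup>2 * (2 * (real n + 1) * \<phi>1 t + 4 * t * \<phi>2 t) + (real n - 1) * (1 - t) * t * \<phi>1 t"
proof -
  have t: "0 \<le> (norm y)\<^sup>2 \<and> (norm y)\<^sup>2 < 1" if "y \<in> ball 0 1" for y :: "real^'n"
    using that by (simp add: power_less_one_iff)
  have d1: "((\<lambda>y::real^'n. \<phi> ((norm y)\<^sup>2)) has_derivative (\<lambda>v. \<phi>1 ((norm y)\<^sup>2) * (2 * (y \<bullet> v)))) (at y)"
    if "y \<in> ball 0 1" for y
    using has_derivative_compose[OF has_derivative_norm_square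
        d(1)[unfolded has_field_derivative_def]] t[OF that] by blast
  have d2: "((\<lambda>y::real^'n. \<phi>1 ((norm y)\<^sup>2)) has_derivative (\<lambda>v. \<phi>2 ((norm y)\<^sup>2) * (2 * (y \<bullet> v)))) (at y)"
    if "y \<in> ball 0 1" for y
    using has_derivative_compose[OF has_derivative_norm_square
        d(2)[unfolded has_field_derivative_def]] t[OF that] by blast
  have p1: "partial i (\<lambda>y::real^'n. \<phi> ((norm y)\<^sup>2)) y = \<phi>1 ((norm y)\<^sup>2) * (2 * y $ i)" if
      "y \<in> ball 0 1" for i y
    by (subst partial_eq[OF d1[OF that]]) (simp add: inner_axis)
  have "((\<lambda>y::real^'n. 2 * y $ i) has_derivative (\<lambda>v. 2 * v $ i)) (at x)" for i
    by (intro has_derivative_mult_right bounded_linear.has_derivative[OF bounded_linear_vec_nth]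
        has_derivative_ident)
  note dd = has_derivative_mult[OF d2[OF x] this]
  have p2: "partial i (partial i (\<lambda>y::real^'n. \<phi> ((norm y)\<^sup>2))) x = 2 * \<phi>1 t + 4 * (x $ i)\<^sup>2 * \<phi>2 t" for i
    by (subst partial_transform[OF open_ball x p1 dd]) (simp_all add: t_def inner_axis power2_eq_square)
  have sq: "(\<Sum>i\<in>UNIV. x $ i * x $ i) = t"
    by (simp add: t_def power2_norm_eq_inner inner_vec_def)
  have "(\<Sum>i\<in>UNIV. 2 * \<phi>1 t + 4 * (x $ i)\<^sup>2 * \<phi>2 t) = 2 * (real n + 1) * \<phi>1 t + 4 * t * \<phi>2 t"
    unfolding sq[symmetric] by (simp add: sum.distrib card power2_eq_square sum_distrib_left
        sum_distrib_right)
  moreover have "(\<Sum>i\<in>UNIV. x $ i * (\<phi>1 t * (2 * x $ i))) = 2 * t * \<phi>1 t"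
    unfolding sq[symmetric] by (simp add: sum_distrib_left sum_distrib_right mult_ac)
  moreover have r: "rho x = (1 - t) / 2" by (simp add: rho_def t_def)
  ultimately show ?thesis
    unfolding hyp_laplacian_def p2 p1[OF x] t_def[symmetric] r by simp
qed

section \<open>Interior maxima and powers of the defining function\<close>

lemma second_derivative_at_local_max:
  fixes h :: "real \<Rightarrow> real"
  assumes "r > 0" "\<And>\<tau>. \<bar>\<tau>\<bar> < r \<Longrightarrow> (h has_real_derivative h1 \<tau>) (at \<tau>)"
    "(h1 has_real_derivative D) (at 0)" "\<And>\<tau>. \<bar>\<tau>\<bar> < r \<Longrightarrow> h \<tau> \<le> h 0"
  shows "h1 0 = 0" "D \<le> 0"
proof -
  show h10: "h1 0 = 0"
    using DERIV_local_max[OF assms(2)[of 0] assms(1)] assms(1,4) by auto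
  show "D \<le> 0"
  proof (rule ccontr)
    \<comment> \<open>If D > 0, then \<open>h1\<close> is positive just to the right of 0, and the
      mean value theorem lifts \<open>h\<close> above \<open>h 0\<close>.\<close>
    assume "\<not> D \<le> 0"
    then obtain d where d: "d > 0" "\<And>\<tau>. 0 < \<tau> \<Longrightarrow> \<tau> < d \<Longrightarrow> h1 0 < h1 (0 + \<tau>)"
      using DERIV_pos_inc_right[OF assms(3)] by auto
    define \<tau> where "\<tau> = min d r / 2"
    have \<tau>: "0 < \<tau>" "\<tau> < d" "\<tau> < r" using d assms(1) by (auto simp: \<tau>_def)
    obtain \<xi> where \<xi>: "0 < \<xi>" "\<xi> < \<tau>" "h \<tau> - h 0 = (\<tau> - 0) * h1 \<xi>"
      using MVT2[OF \<tau>(1), of h h1] assms(2) \<tau> by auto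
    moreover have "\<tau> * h1 \<xi> > 0" using d(2)[of \<xi>] \<xi> h10 \<tau> by (intro mult_pos_pos) auto
    ultimately have "h \<tau> > h 0" by simp
    with assms(4)[of \<tau>] \<tau> show False by auto
  qed
qed

lemma partial_at_max:
  fixes e :: "real^'n::finite \<Rightarrow> real"
  assumes e: "Ck_on (Suc (Suc 0)) (ball 0 1) e" and p: "p \<in> ball 0 1"
    and max: "\<And>x. x \<in> ball 0 1 \<Longrightarrow> e x \<le> e p"
  shows "partial i e p = 0" "partial i (partial i e) p \<le> 0"
proof -
  define r where "r = 1 - norm p"
  have r: "r > 0" using p by (simp add: r_def)
  have in_ball: "p + \<tau> *\<^sub>R axis i 1 \<in> ball 0 1" if "\<bar>\<tau>\<bar> < r" for \<tau>
    using norm_triangle_ineq[of p "\<tau> *\<^sub>R axis i 1"] that by (simp add: r_def norm_axis_1)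
  have line: "((\<lambda>\<tau>. p + \<tau> *\<^sub>R axis i 1) has_derivative (\<lambda>\<tau>. \<tau> *\<^sub>R axis i 1)) (at \<tau>)" for \<tau>
    by (auto intro!: derivative_eq_intros)
  have scale: "frechet_derivative f (at x) (v *\<^sub>R w) = frechet_derivative f (at x) w * v"
    if "(f has_derivative frechet_derivative f (at x)) (at x)" for f and x w :: "real^'n" and v :: real
    using linear_scale[OF has_derivative_linear[OF that]] by simp
  have h1: "((\<lambda>\<tau>. e (p + \<tau> *\<^sub>R axis i 1)) has_real_derivative partial i e (p + \<tau> *\<^sub>R axis i 1)) (at \<tau>)"
    if "\<bar>\<tau>\<bar> < r" for \<tau>
    using has_derivative_compose[OF line Ck_on_2_partial(1)[OF e in_ball[OF that]]]
    by (simp add: has_field_derivative_def partial_def scale[OF Ck_on_2_partial(1)[OF e in_ball[OF that]]])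
  have h2: "((\<lambda>\<tau>. partial i e (p + \<tau> *\<^sub>R axis i 1))
      has_real_derivative partial i (partial i e) (p + 0 *\<^sub>R axis i 1)) (at 0)"
    using has_derivative_compose[OF line Ck_on_2_partial(2)[OF e in_ball[of 0]]] r
    unfolding has_field_derivative_def partial_def[of i "partial i e"]
    by (simp add: scale[OF Ck_on_2_partial(2)[OF e p]])
  have h3: "e (p + \<tau> *\<^sub>R axis i 1) \<le> e (p + 0 *\<^sub>R axis i 1)" if "\<bar>\<tau>\<bar> < r" for \<tau>
    using max[OF in_ball[OF that]] by simp
  from second_derivative_at_local_max[where h = "\<lambda>\<tau>. e (p + \<tau> *\<^sub>R axis i 1)", OF r h1 h2 h3]
  show "partial i e p = 0" "partial i (partial i e) p \<le> 0" by simp_all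
qed

lemma hyp_laplacian_at_max:
  fixes e :: "real^'n::finite \<Rightarrow> real"
  assumes "Ck_on (Suc (Suc 0)) (ball 0 1) e" "p \<in> ball 0 1"
    "\<And>x. x \<in> ball 0 1 \<Longrightarrow> e x \<le> e p"
  shows "hyp_laplacian n e p \<le> 0"
  using partial_at_max[OF assms]
  by (simp add: hyp_laplacian_def mult_nonneg_nonpos sum_nonpos)

lemma Ck_on_radial_ball:
  assumes "Ck_real k {-1<..<1} \<phi>"
  shows "Ck_on k (ball 0 1) (\<lambda>x::real^'n::finite. \<phi> ((norm x)\<^sup>2))"
by (rule Ck_on_radial[OF _ _ norm_square_ball assms]) auto

lemma Ck_real_half_powr: "Ck_real k {..<1} (\<lambda>t. ((1 - t) / 2) powr b)"
proof -
  have "Ck_real k {..<1} (\<lambda>t. 1 / 2 + (-1/2) * t)"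
    by (intro Ck_real_add Ck_real_mult Ck_real_const Ck_real_ident) auto
  then have "Ck_real k {..<1} (\<lambda>t. (1 / 2 + (-1/2) * t) powr b)"
    by (intro Ck_real_compose[OF _ _ _ Ck_real_powr]) auto
  then show ?thesis by (simp add: diff_divide_distrib)
qed

lemma Ck_on_rho_powr: "Ck_on k (ball 0 1) (\<lambda>x::real^'n::finite. rho x powr b)"
  unfolding rho_def by (rule Ck_on_radial_ball[OF Ck_real_subset[OF Ck_real_half_powr]]) auto

lemma half_powr_derivative:
  "t < 1 \<Longrightarrow> ((\<lambda>t. c * ((1 - t) / 2) powr b)
      has_real_derivative c * (- (b / 2)) * ((1 - t) / 2) powr (b - 1)) (at t)"
  by (auto intro!: derivative_eq_intros simp: powr_diff field_simps)

text \<open>Adding s (n - s) to the leading coefficient b (b - n) gives the indicial polynomial (b -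
  s)(b - (n - s)); the remainder is one order smaller in \<rho>.\<close>

lemma hyp_laplacian_rho_powr:
  fixes x :: "real^'n::finite"
  assumes "CARD('n) = n + 1" "x \<in> ball 0 1"
  shows "hyp_laplacian n (\<lambda>x::real^'n. rho x powr b) x =
    rho x powr b * (b * (b - real n) - b * (2 * b - real n + 1) * rho x)"
proof -
  define t where "t = (norm x)\<^sup>2"
  have r: "rho x = (1 - t) / 2" "rho x > 0" and t: "t = 1 - 2 * rho x"
    using rho_pos[OF assms(2)] by (auto simp: rho_def t_def diff_divide_distrib)
  have *: "rho x powr (b - 1) = rho x powr b / rho x" "rho x powr (b - 2) = rho x powr b / (rho x)\<^sup>2"
    using r(2) by (simp_all add: powr_diff)
  have "hyp_laplacian n (\<lambda>x::real^'n. rho x powr b) x =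
    (rho x)\<^sup>2 * (2 * (real n + 1) * (- (b / 2) * rho x powr (b - 1))
      + 4 * t * ((- (b / 2)) * (- ((b - 1) / 2)) * rho x powr (b - 2))) + (real n - 1)
          * (2 * rho x) * t * (- (b / 2) * rho x powr (b - 1))"
  proof -
    have "((\<lambda>t. ((1 - t) / 2) powr b) has_real_derivative - (b / 2) * ((1 - t) / 2) powr (b - 1)) (at t)"
      "((\<lambda>t. - (b / 2) * ((1 - t) / 2) powr (b - 1)) has_real_derivative
         - (b / 2) * - ((b - 1) / 2) * ((1 - t) / 2) powr (b - 2)) (at t)" if "0 \<le> t" "t < 1" for t
      using half_powr_derivative[OF that(2), of 1 b]
          half_powr_derivative[OF that(2), of "- (b / 2)" "b - 1"]
      by simp_all
    from hyp_laplacian_radial[OF assms(1) this assms(2)] show ?thesis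
      by (simp add: rho_def[abs_def] t_def)
  qed
  also have "\<dots> = rho x powr b * (b * (b - real n) - b * (2 * b - real n + 1) * rho x)"
    unfolding * t using r(2) by (simp add: field_simps power2_eq_square)
  finally show ?thesis .
qed

section \<open>Uniqueness for the Poisson problem\<close>

text \<open>Below a threshold r0 the power r^\<delta> beats K r because \<delta> < 1; above it N
  r^\<gamma> is at least K. The denominator K + 1 makes the first comparison strict and covers K =
  0.\<close>

lemma supersolution_coefficient:
  fixes c0 K \<gamma> \<delta> :: real
  assumes "\<gamma> > 0" "0 < \<delta>" "\<delta> < 1" "c0 > 0" "K \<ge> 0"
  obtains N where "N \<ge> 0" "\<And>r. 0 < r \<Longrightarrow> r \<le> 1 \<Longrightarrow> K * r < c0 * r powr \<delta> + N * r powr \<gamma>"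
proof -
  define r0 where "r0 = (c0 / (K + 1)) powr (1 / (1 - \<delta>))"
  have r0: "r0 > 0" "r0 powr (1 - \<delta>) = c0 / (K + 1)"
    using assms by (auto simp: r0_def powr_powr)
  define N where "N = K / r0 powr \<gamma>"
  have N: "N \<ge> 0" using assms by (simp add: N_def)
  have "K * r < c0 * r powr \<delta> + N * r powr \<gamma>" if r: "0 < r" "r \<le> 1" for r
  proof (cases "r < r0")
    case True
    have "r powr (1 - \<delta>) \<le> r0 powr (1 - \<delta>)"
      using True r assms by (intro powr_mono2) auto
    then have "K * r powr (1 - \<delta>) \<le> K * (c0 / (K + 1))"
      unfolding r0(2) using assms by (intro mult_left_mono) auto
    also have "\<dots> < c0" using assms by (simp add: field_simps)
    finally have "K * r powr (1 - \<delta>) * r powr \<delta> < c0 * r powr \<delta>"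
      using r by (intro mult_strict_right_mono) auto
    also have "K * r powr (1 - \<delta>) * r powr \<delta> = K * r"
      using r by (simp add: mult.assoc flip: powr_add)
    finally show ?thesis using N by (simp add: add_strict_increasing2 add.commute)
  next
    case False
    then have "r0 powr \<gamma> \<le> r powr \<gamma>" using r0 assms by (intro powr_mono2) auto
    then have "N * r0 powr \<gamma> \<le> N * r powr \<gamma>" using N by (intro mult_left_mono)
    then have "K \<le> N * r powr \<gamma>" using r0 by (simp add: N_def)
    moreover have "K * r \<le> K * 1" using r assms by (intro mult_left_mono) auto
    moreover have "0 < c0 * r powr \<delta>" using r assms by simp
    ultimately show ?thesis by linarith
  qed
  with N show ?thesis using that by blast
qed

text \<open>With $a = n - s$ the barrier is $\rho^a + \rho^{a+\delta} + M \rho^{n/2}$. The middle term beats the error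
  terms of order $\rho^{a+1}$ near the sphere because $a + \delta$ lies strictly between the indicial roots
  $n - s$ and $s$; the last one, an exact strict supersolution, takes over in the interior.\<close>

lemma strict_supersolution:
  assumes card: "CARD('n::finite) = n + 1" and s: "s > real n / 2"
  obtains \<Phi> :: "real^'n \<Rightarrow> real" where "Ck_on (Suc (Suc 0)) (ball 0 1) \<Phi>"
    "\<And>x. x \<in> ball 0 1 \<Longrightarrow> rho x powr (real n - s) \<le> \<Phi> x"
    "\<And>x. x \<in> ball 0 1 \<Longrightarrow> hyp_laplacian n \<Phi> x + s * (real n - s) * \<Phi> x < 0"
proof -
  define \<gamma> where "\<gamma> = s - real n / 2"
  define a where "a = real n - s"
  \<comment> \<open>Half the minimum gives both \<delta> < 1, so that \<rho>^\<delta> dominates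
    \<rho>, and \<delta> < 2\<gamma>, so that a + \<delta> stays below the root s.\<close>
  define \<delta> where "\<delta> = min 1 \<gamma> / 2"
  have g: "\<gamma> > 0" "0 < \<delta>" "\<delta> < 1" "\<delta> < \<gamma>" using s by (auto simp: \<gamma>_def \<delta>_def)
  define E where "E = (\<lambda>b r. b * (b - real n) - b * (2 * b - real n + 1) * r + s * (real n - s))"
  define K where "K = \<bar>a * (2 * a - real n + 1)\<bar> + \<bar>(a + \<delta>) * (2 * (a + \<delta>) - real n + 1)\<bar>"
  \<comment> \<open>\<open>- c0\<close> is the indicial polynomial at a + \<delta>, that is \<delta>
    (\<delta> - 2\<gamma>).\<close>
  define c0 where "c0 = \<delta> * (2 * \<gamma> - \<delta>)"
  have "c0 > 0" "K \<ge> 0" using g by (auto simp: c0_def K_def)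
  then obtain N where N: "N \<ge> 0" "\<And>r. 0 < r \<Longrightarrow> r \<le> 1 \<Longrightarrow> K * r < c0 * r powr \<delta> + N * r powr \<gamma>"
    using supersolution_coefficient g by metis
  \<comment> \<open>The exponent n/2 = a + \<gamma> is the midpoint of the two roots, where the
    indicial polynomial is -\<gamma>^2; hence the division.\<close>
  define M where "M = N / \<gamma>\<^sup>2"
  have M: "M \<ge> 0" "M * \<gamma>\<^sup>2 = N" using N g by (auto simp: M_def)
  \<comment> \<open>The coefficient 1 is kept so that both sums have the shape u + c v of
    \<open>hyp_laplacian_linear\<close>.\<close>
  define \<Phi> where "\<Phi> = (\<lambda>x::real^'n. (rho x powr a + 1 * rho x powr (a + \<delta>)) + M * rho x powr (a + \<gamma>))"
  have C1: "Ck_on (Suc (Suc 0)) (ball 0 1) (\<lambda>x::real^'n. rho x powr a + 1 * rho x powr (a + \<delta>))"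
    by (intro Ck_on_add Ck_on_mult Ck_on_const Ck_on_rho_powr open_ball)
  have C2: "Ck_on (Suc (Suc 0)) (ball 0 1) \<Phi>"
    unfolding \<Phi>_def by (intro Ck_on_add[OF _ C1] Ck_on_mult Ck_on_const Ck_on_rho_powr open_ball)
  have neg: "hyp_laplacian n \<Phi> x + s * (real n - s) * \<Phi> x < 0" if x: "x \<in> ball 0 1" for x
  proof -
    define r where "r = rho x"
    have "0 < r" using rho_pos[OF x] by (simp add: r_def)
    moreover have "(1 - (norm x)\<^sup>2) / 2 \<le> (1 - 0) / 2"
      by (intro divide_right_mono diff_left_mono) auto
    then have "r \<le> (1 - 0) / 2" by (simp only: r_def rho_def)
    ultimately have r: "0 < r" "r \<le> 1" by auto
    have "hyp_laplacian n \<Phi> x = (hyp_laplacian n (\<lambda>x::real^'n. rho x powr a) x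
        + 1 * hyp_laplacian n (\<lambda>x::real^'n. rho x powr (a + \<delta>)) x)
        + M * hyp_laplacian n (\<lambda>x::real^'n. rho x powr (a + \<gamma>)) x"
      unfolding \<Phi>_def
      by (simp only: hyp_laplacian_linear[OF C1 Ck_on_rho_powr open_ball x]
          hyp_laplacian_linear[OF Ck_on_rho_powr Ck_on_rho_powr open_ball x])
    then have "hyp_laplacian n \<Phi> x + s * (real n - s) * \<Phi> x =
        r powr a * E a r + r powr (a + \<delta>) * E (a + \<delta>) r + M * (r powr (a + \<gamma>) * E (a + \<gamma>) r)"
      unfolding hyp_laplacian_rho_powr[OF card x] \<Phi>_def E_def r_def by (simp add: algebra_simps)
    also have "\<dots> = r powr a * (E a r + r powr \<delta> * E (a + \<delta>) r + M * (r powr \<gamma> * E (a + \<gamma>) r))"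
      by (simp add: powr_add algebra_simps)
    finally have eq: "hyp_laplacian n \<Phi> x + s * (real n - s) * \<Phi> x =
      r powr a * (E a r + r powr \<delta> * E (a + \<delta>) r + M * (r powr \<gamma> * E (a + \<gamma>) r))" .
    have s_eq: "s = real n / 2 + \<gamma>" "a = real n / 2 - \<gamma>" by (auto simp: a_def \<gamma>_def)
    have "E a r = - (a * (2 * a - real n + 1)) * r"
      unfolding E_def a_def by (simp add: algebra_simps)
    also have "\<dots> \<le> \<bar>a * (2 * a - real n + 1)\<bar> * r"
      using r by (intro mult_right_mono) auto
    finally have Ea: "E a r \<le> \<bar>a * (2 * a - real n + 1)\<bar> * r" .
    have "E (a + \<delta>) r = - c0 - ((a + \<delta>) * (2 * (a + \<delta>) - real n + 1)) * r"
      unfolding E_def c0_def s_eq by (simp add: field_simps)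
    also have "\<dots> \<le> - c0 + \<bar>(a + \<delta>) * (2 * (a + \<delta>) - real n + 1)\<bar> * r"
      using mult_right_mono[OF abs_ge_minus_self[of "(a + \<delta>) * (2 * (a + \<delta>) - real n + 1)"], of r] r by simp
    finally have "r powr \<delta> * E (a + \<delta>) r \<le> r powr \<delta> * (- c0 + \<bar>(a + \<delta>) * (2 * (a + \<delta>) - real n + 1)\<bar> * r)"
      by (intro mult_left_mono) auto
    also have "\<dots> = - c0 * r powr \<delta> + r powr \<delta> * (\<bar>(a + \<delta>) * (2 * (a + \<delta>) - real n + 1)\<bar> * r)"
      by (simp add: algebra_simps)
    also have "\<dots> \<le> - c0 * r powr \<delta> + 1 * (\<bar>(a + \<delta>) * (2 * (a + \<delta>) - real n + 1)\<bar> * r)"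
      using r g by (intro add_left_mono mult_right_mono powr_le1) auto
    finally have Ed: "r powr \<delta> * E (a + \<delta>) r \<le> - c0 * r powr \<delta> + \<bar>(a + \<delta>) * (2 * (a + \<delta>) - real n + 1)\<bar> * r"
      by simp
    have "E (a + \<gamma>) r = - \<gamma>\<^sup>2 - (real n / 2) * r"
      unfolding E_def s_eq by (simp add: field_simps power2_eq_square)
    also have "\<dots> \<le> - \<gamma>\<^sup>2" using r by simp
    finally have "M * (r powr \<gamma> * E (a + \<gamma>) r) \<le> M * (r powr \<gamma> * - \<gamma>\<^sup>2)"
      using M by (intro mult_left_mono) auto
    also have "\<dots> = - (N * r powr \<gamma>)" unfolding M(2)[symmetric] by simp
    finally have "E a r + r powr \<delta> * E (a + \<delta>) r + M * (r powr \<gamma> * E (a + \<gamma>) r) \<le>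
        K * r - c0 * r powr \<delta> - N * r powr \<gamma>"
      using Ea Ed unfolding K_def by (simp add: algebra_simps)
    also have "\<dots> < 0" using N(2)[OF r] by simp
    finally show ?thesis unfolding eq using r by (simp add: mult_pos_neg)
  qed
  have "rho x powr (real n - s) \<le> \<Phi> x" if "x \<in> ball 0 1" for x
    using M by (simp add: \<Phi>_def a_def)
  with C2 neg show ?thesis using that by blast
qed

text \<open>For s < n the coefficient s (n - s) is positive, so the maximum principle fails for w
  itself; dividing by a positive strict supersolution restores it. The lower bound on
  \<open>\<Phi>\<close> makes the quotient small near the sphere, which forces a positive maximum
  into the interior.\<close>

lemma poisson_nonpos:
  fixes w F H :: "real^'n::finite \<Rightarrow> real"
  assumes card: "CARD('n) = n + 1" and s: "s > real n / 2"
    and w: "Ck_on (Suc (Suc 0)) (ball 0 1) w"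
    and eq: "\<And>x. x \<in> ball 0 1 \<Longrightarrow> hyp_laplacian n w x + s * (real n - s) * w x = 0"
    and cont: "continuous_on (cball 0 1) F" "continuous_on (cball 0 1) H"
    and form: "\<And>x. x \<in> ball 0 1 \<Longrightarrow> w x = F x * rho x powr (real n - s) + H x * rho x powr s"
    and bd: "\<And>x. x \<in> sphere 0 1 \<Longrightarrow> F x = 0"
    and x0: "x0 \<in> ball 0 1"
  shows "w x0 \<le> 0"
proof (rule ccontr)
  assume neg: "\<not> w x0 \<le> 0"
  obtain \<Phi> :: "real^'n \<Rightarrow> real" where C\<Phi>: "Ck_on (Suc (Suc 0)) (ball 0 1) \<Phi>"
    and low: "\<And>x. x \<in> ball 0 1 \<Longrightarrow> rho x powr (real n - s) \<le> \<Phi> x"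
    and super: "\<And>x. x \<in> ball 0 1 \<Longrightarrow> hyp_laplacian n \<Phi> x + s * (real n - s) * \<Phi> x < 0"
    using strict_supersolution[OF card s] by metis
  have pos: "\<Phi> x > 0" if "x \<in> ball 0 1" for x
  proof -
    have "rho x powr (real n - s) > 0" using rho_pos[OF that] by simp
    then show ?thesis using low[OF that] by linarith
  qed
  define m where "m = (\<lambda>x. w x / \<Phi> x)"
  \<comment> \<open>A majorant of the quotient that, unlike the quotient, is given up to the sphere:
    it is continuous there and vanishes, so its superlevel set \<open>T\<close> is a compact subset
    of the open ball.\<close>
  define B where "B = (\<lambda>x. \<bar>F x\<bar> + \<bar>H x\<bar> * rho x powr (2 * s - real n))"
  have mB: "m x \<le> B x" if x: "x \<in> ball 0 1" for x
  proof -
    have "B x * rho x powr (real n - s) = \<bar>F x\<bar> * rho x powr (real n - s) + \<bar>H x\<bar> * rho x powr s"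
      by (simp add: B_def distrib_right mult.assoc flip: powr_add)
    moreover have "F x * rho x powr (real n - s) \<le> \<bar>F x\<bar> * rho x powr (real n - s)"
      "H x * rho x powr s \<le> \<bar>H x\<bar> * rho x powr s"
      by (intro mult_right_mono; simp)+
    ultimately have "w x \<le> B x * rho x powr (real n - s)"
      using form[OF x] by linarith
    also have "\<dots> \<le> B x * \<Phi> x" using low[OF x] by (intro mult_left_mono) (auto simp: B_def)
    finally show ?thesis using pos[OF x] by (simp add: m_def field_simps)
  qed
  define \<kappa>0 where "\<kappa>0 = m x0"
  have \<kappa>0: "\<kappa>0 > 0" using neg pos[OF x0] by (simp add: \<kappa>0_def m_def)
  have rho_nonneg: "rho x \<ge> 0" if "x \<in> cball 0 1" for x :: "real^'n"
    using that by (simp add: rho_def power_le_one)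
  have contB: "continuous_on (cball 0 1) B"
    unfolding B_def
    by (intro continuous_intros cont continuous_on_powr') 
      (use s rho_nonneg in \<open>auto simp: rho_def[abs_def] intro!: continuous_intros\<close>)
  define T where "T = {x \<in> cball 0 1. B x \<in> {\<kappa>0..}}"
  have "T = cball 0 1 \<inter> B -` {\<kappa>0..}" by (auto simp: T_def)
  then have "closed T" using continuous_closed_preimage[OF contB closed_cball closed_atLeast] by simp
  moreover have "bounded T" by (rule bounded_subset[OF bounded_cball[of 0 1]]) (auto simp: T_def)
  ultimately have "compact T" by (simp add: compact_eq_bounded_closed)
  have T_ball: "T \<subseteq> ball 0 1"
  proof
    fix x assume x: "x \<in> T"
    have "x \<notin> sphere 0 1"
    proof
      assume "x \<in> sphere 0 1"
      then have "B x = 0" using bd[of x] s by (simp add: B_def rho_def)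
      with x \<kappa>0 show False by (simp add: T_def)
    qed
    with x show "x \<in> ball 0 1" by (auto simp: T_def)
  qed
  have contm: "continuous_on (ball 0 1) m"
    unfolding m_def
    using Ck_on_SucD[OF Ck_on_SucD[OF w]] Ck_on_SucD[OF Ck_on_SucD[OF C\<Phi>]] pos
    by (intro continuous_intros) (auto, metis less_irrefl)
  have "x0 \<in> T" using x0 mB[OF x0] by (auto simp: T_def \<kappa>0_def)
  then obtain p where p: "p \<in> T" "\<And>x. x \<in> T \<Longrightarrow> m x \<le> m p"
    using continuous_attains_sup[OF \<open>compact T\<close> _ continuous_on_subset[OF contm T_ball]] by auto
  have p_ball: "p \<in> ball 0 1" using p T_ball by auto
  have \<kappa>: "m p \<ge> \<kappa>0" using p(2)[OF \<open>x0 \<in> T\<close>] by (simp add: \<kappa>0_def)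
  have max: "m x \<le> m p" if x: "x \<in> ball 0 1" for x
  proof (cases "x \<in> T")
    case False
    then have "B x < \<kappa>0" using x by (auto simp: T_def)
    then show ?thesis using mB[OF x] \<kappa> by linarith
  qed (use p in auto)
  \<comment> \<open>The multiple of \<open>\<Phi>\<close> touching w from above at p. At p the
    Laplacian of \<open>e\<close> is at most 0 and \<open>e\<close> itself is 0, whereas strictness
    of \<open>\<Phi>\<close> makes the operator applied to \<open>e\<close> positive.\<close>
  define e where "e = (\<lambda>x. w x + (- m p) * \<Phi> x)"
  have Ce: "Ck_on (Suc (Suc 0)) (ball 0 1) e"
    unfolding e_def by (intro Ck_on_add w Ck_on_mult Ck_on_const C\<Phi> open_ball)
  have ep: "e p = 0" using pos[OF p_ball] by (simp add: e_def m_def)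
  have "e x \<le> e p" if x: "x \<in> ball 0 1" for x
    using max[OF x] pos[OF x] unfolding ep by (simp add: e_def m_def pos_divide_le_eq)
  then have "hyp_laplacian n e p \<le> 0" by (rule hyp_laplacian_at_max[OF Ce p_ball])
  moreover have "hyp_laplacian n e p = hyp_laplacian n w p + (- m p) * hyp_laplacian n \<Phi> p"
    unfolding e_def by (rule hyp_laplacian_linear[OF w C\<Phi> open_ball p_ball])
  moreover have "s * (real n - s) * w p = m p * (s * (real n - s) * \<Phi> p)"
    using pos[OF p_ball] by (simp add: m_def)
  ultimately have "m p * hyp_laplacian n \<Phi> p + m p * (s * (real n - s) * \<Phi> p) \<ge> 0"
    using eq[OF p_ball] by linarith
  then have "m p * (hyp_laplacian n \<Phi> p + s * (real n - s) * \<Phi> p) \<ge> 0"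
    by (simp only: distrib_left)
  moreover have "m p * (hyp_laplacian n \<Phi> p + s * (real n - s) * \<Phi> p) < 0"
    using super[OF p_ball] \<kappa> \<kappa>0 by (intro mult_pos_neg) auto
  ultimately show False by simp
qed

lemma smooth_upto_ball:
  assumes "smooth_upto (cball 0 1) F"
  shows "Ck_on k (ball 0 1) F" "continuous_on (cball 0 1) F"
proof -
  obtain U where U: "cball 0 1 \<subseteq> U" "\<And>k. Ck_on k U F" using assms by (auto simp: smooth_upto_def)
  show "Ck_on k (ball 0 1) F" by (rule Ck_on_subset[OF U(2)]) (use U(1) in auto)
  show "continuous_on (cball 0 1) F" using U(2)[of 0] U(1) by (auto intro: continuous_on_subset)
qed

text \<open>Interior smoothness of a solution is read off from its boundary form, \<rho> being
  positive inside. It justifies replacing the Laplace-Beltrami operator by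
  \<open>hyp_laplacian\<close>.\<close>

lemma Ck_on_poisson_form:
  assumes "smooth_upto (cball 0 1) F" "smooth_upto (cball 0 1) H"
    and "\<And>x. x \<in> ball 0 1 \<Longrightarrow> u x = F x * rho x powr p + H x * rho x powr q"
  shows "Ck_on k (ball 0 1) u"
  by (rule Ck_on_cong[OF open_ball assms(3)[symmetric]])
    (use smooth_upto_ball(1) assms(1,2) in \<open>auto intro!: Ck_on_add Ck_on_mult Ck_on_rho_powr\<close>)

lemma poisson_solution_le:
  fixes u v :: "real^'n::finite \<Rightarrow> real"
  assumes card: "CARD('n) = n + 1" and s: "s > real n / 2"
    and u: "poisson_solution n s u" and v: "poisson_solution n s v" and x: "x \<in> ball 0 1"
  shows "u x \<le> v x"
proof -
  obtain F H where F: "smooth_upto (cball 0 1) F" "smooth_upto (cball 0 1) H"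
    "\<And>x. x \<in> ball 0 1 \<Longrightarrow> u x = F x * rho x powr (real n - s) + H x * rho x powr s"
    "\<And>x. x \<in> sphere 0 1 \<Longrightarrow> F x = 1"
    using u unfolding poisson_solution_def by blast
  obtain F' H' where F': "smooth_upto (cball 0 1) F'" "smooth_upto (cball 0 1) H'"
    "\<And>x. x \<in> ball 0 1 \<Longrightarrow> v x = F' x * rho x powr (real n - s) + H' x * rho x powr s"
    "\<And>x. x \<in> sphere 0 1 \<Longrightarrow> F' x = 1"
    using v unfolding poisson_solution_def by blast
  have Cu: "Ck_on (Suc (Suc 0)) (ball 0 1) u" by (rule Ck_on_poisson_form[OF F(1-3)])
  have Cv: "Ck_on (Suc (Suc 0)) (ball 0 1) v" by (rule Ck_on_poisson_form[OF F'(1-3)])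
  have "u x + (-1) * v x \<le> 0"
  proof (rule poisson_nonpos[OF card s, where F = "\<lambda>x. F x - F' x" and H = "\<lambda>x. H x - H' x"])
    show "Ck_on (Suc (Suc 0)) (ball 0 1) (\<lambda>x. u x + (-1) * v x)"
      by (intro Ck_on_add Ck_on_mult Ck_on_const Cu Cv open_ball)
    show "hyp_laplacian n (\<lambda>x. u x + (-1) * v x) x + s * (real n - s) * (u x + (-1) * v x) = 0"
      if x: "x \<in> ball 0 1" for x
    proof -
      have "- hyp_laplacian n u x - s * (real n - s) * u x = 0"
        "- hyp_laplacian n v x - s * (real n - s) * v x = 0"
        using conjunct1[OF u[unfolded poisson_solution_def]]
            conjunct1[OF v[unfolded poisson_solution_def]] x
          laplace_beltrami_hyperbolic[OF card Cu x] laplace_beltrami_hyperbolic[OF card Cv x]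
        by metis+
      then show ?thesis
        unfolding hyp_laplacian_linear[OF Cu Cv open_ball x] by (simp add: algebra_simps)
    qed
    show "continuous_on (cball 0 1) (\<lambda>x. F x - F' x)" "continuous_on (cball 0 1) (\<lambda>x. H x - H' x)"
      using F F' smooth_upto_ball(2) by (auto intro!: continuous_intros)
    show "u x + (-1) * v x = (F x - F' x) * rho x powr (real n - s) + (H x - H' x) * rho x powr s"
      if "x \<in> ball 0 1" for x
      using F(3)[OF that] F'(3)[OF that] by (simp add: algebra_simps)
    show "F x - F' x = 0" if "x \<in> sphere 0 1" for x
      using F(4)[OF that] F'(4)[OF that] by simp
  qed (rule x)
  then show ?thesis by simp
qed

text \<open>Evaluates the definite description from any solution at hand. Equality is asserted
  inside the ball only, as the values of \<open>u\<close> outside are arbitrary.\<close>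

lemma vartheta_eqI:
  fixes u :: "real^'n::finite \<Rightarrow> real"
  assumes card: "CARD('n) = n + 1" and s: "s > real n / 2"
    and u: "poisson_solution n s u" and x: "x \<in> ball 0 1"
  shows "vartheta n s x = u x"
proof -
  define v where "v = (\<lambda>x. if x \<in> ball 0 1 then u x else 0)"
  have lb: "laplace_beltrami hyperbolic_metric v x = laplace_beltrami hyperbolic_metric u x" if
      "x \<in> ball 0 1" for x
    by (rule laplace_beltrami_cong[OF open_ball that]) (simp add: v_def)
  have v: "poisson_solution n s v"
    using u lb unfolding poisson_solution_def by (simp add: v_def)
  have "(THE u::real^'n \<Rightarrow> real. poisson_solution n s u \<and> (\<forall>x. x \<notin> ball 0 1 \<longrightarrow> u x = 0)) = v"
  proof (rule the_equality)
    show "poisson_solution n s v \<and> (\<forall>x. x \<notin> ball 0 1 \<longrightarrow> v x = 0)"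
      using v by (simp add: v_def)
    show "u' = v" if u': "poisson_solution n s u' \<and> (\<forall>x. x \<notin> ball 0 1 \<longrightarrow> u' x = 0)" for u'
    proof
      fix y
      show "u' y = v y"
      proof (cases "y \<in> ball 0 1")
        case True
        show ?thesis
          by (rule antisym; rule poisson_solution_le[OF card s]) (use u' v True in auto)
      next
        case False
        then show ?thesis using u' by (simp add: v_def)
      qed
    qed
  qed
  then show ?thesis using x by (simp add: vartheta_def v_def)
qed

section \<open>Radial solutions\<close>

text \<open>Factoring out \<rho>^(n-s) moves one exponent at t = 1 to 0; the other becomes c - a - b
  = 2s - n and accounts for the \<rho>^s part. After clearing denominators the radial equation is
  ((1 - t)/2)^a (1 - t) times the hypergeometric one.\<close>

lemma hyp_laplacian_radial_hypergeometric:
  fixes x :: "real^'n::finite" and n :: nat and s :: real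
  defines "a \<equiv> real n - s" and "b \<equiv> (real n + 1) / 2 - s" and "t \<equiv> (norm x)\<^sup>2"
  assumes card: "CARD('n) = n + 1"
    and ode: "hyp_ode (a) (b) ((real n + 1) / 2) {-1<..<1} Y Y1 Y2"
    and x: "x \<in> ball 0 1"
  shows "hyp_laplacian n (\<lambda>x::real^'n. rho x powr a * Y ((norm x)\<^sup>2)) x
    + s * (real n - s) * (rho x powr a * Y t) = 0"
proof -
  define p where "p = a"
  define \<phi> where "\<phi> = (\<lambda>t. ((1 - t) / 2) powr p * Y t)"
  define \<phi>1 where "\<phi>1 = (\<lambda>t. ((1 - t) / 2) powr p * (Y1 t - p * Y t / (1 - t)))"
  define \<phi>2 where "\<phi>2 = (\<lambda>t. ((1 - t) / 2) powr p
      * (Y2 t - 2 * p * Y1 t / (1 - t) + p * (p - 1) * Y t / (1 - t)\<^sup>2))"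
  have der: "(\<phi> has_real_derivative \<phi>1 t) (at t)" "(\<phi>1 has_real_derivative \<phi>2 t) (at t)"
    if t: "0 \<le> t" "t < 1" for t
  proof -
    have *: "(Y has_real_derivative Y1 t) (at t)" "(Y1 has_real_derivative Y2 t) (at t)"
      using ode t by (auto simp: hyp_ode_def)
    have "((\<lambda>t. ((1 - t) / 2) powr p) has_real_derivative - (p / 2) * ((1 - t) / 2) powr (p - 1)) (at t)"
      using half_powr_derivative[OF t(2), of 1 p] by simp
    also have "- (p / 2) * ((1 - t) / 2) powr (p - 1) = ((1 - t) / 2) powr p * (- p / (1 - t))"
      using t by (simp add: powr_diff field_simps)
    finally have P: "((\<lambda>t. ((1 - t) / 2) powr p)
        has_real_derivative ((1 - t) / 2) powr p * (- p / (1 - t))) (at t)" .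
    show "(\<phi> has_real_derivative \<phi>1 t) (at t)"
      using DERIV_mult[OF P *(1)] by (simp add: \<phi>_def \<phi>1_def algebra_simps)
    have "((\<lambda>t. Y1 t - p * Y t / (1 - t))
        has_real_derivative Y2 t - p * (Y1 t * (1 - t) + Y t) / (1 - t)\<^sup>2) (at t)"
      using t by (auto intro!: derivative_eq_intros * simp: power2_eq_square distrib_left)
    from DERIV_mult[OF P this] show "(\<phi>1 has_real_derivative \<phi>2 t) (at t)"
      unfolding \<phi>1_def \<phi>2_def
      by (rule DERIV_cong) (use t in \<open>simp add: divide_simps power2_eq_square, simp add: algebra_simps\<close>)
  qed
  have t: "0 \<le> t" "t < 1" using x by (auto simp: t_def power_less_one_iff)
  have eq: "t * (1 - t) * Y2 t + ((real n + 1) / 2 - (a + b + 1) * t) * Y1 t - a * b * Y t = 0"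
    using ode t by (auto simp: hyp_ode_def)
  define R where "R = ((1 - t) / 2) powr p"
  have s_eq: "s = real n - p" by (simp add: p_def a_def)
  have "((1 - t) / 2)\<^sup>2 * (2 * (real n + 1) * (R * (Y1 t - p * Y t / (1 - t)))
      + 4 * t * (R * (Y2 t - 2 * p * Y1 t / (1 - t) + p * (p - 1) * Y t / (1 - t)\<^sup>2)))
      + (real n - 1) * (1 - t) * t * (R * (Y1 t - p * Y t / (1 - t))) + s * (real n - s) * (R * Y t)
    = R * (1 - t) * (t * (1 - t) * Y2 t + ((real n + 1) / 2 - (a + b + 1) * t) * Y1 t - a * b * Y t)"
    unfolding a_def b_def s_eq using t
    by (simp add: divide_simps power2_eq_square) (simp add: algebra_simps)
  then have "((1 - t) / 2)\<^sup>2 * (2 * (real n + 1) * \<phi>1 t + 4 * t * \<phi>2 t) + (real n - 1) * (1 - t) * t * \<phi>1 t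
     + s * (real n - s) * \<phi> t = 0"
    unfolding eq by (simp add: \<phi>1_def \<phi>2_def \<phi>_def R_def)
  moreover have "rho x powr a * Y t = \<phi> t"
      "(\<lambda>x::real^'n. rho x powr a * Y ((norm x)\<^sup>2)) = (\<lambda>x. \<phi> ((norm x)\<^sup>2))"
    by (auto simp: \<phi>_def rho_def p_def t_def)
  ultimately show ?thesis
    using hyp_laplacian_radial[OF card der x] by (simp add: t_def)
qed

text \<open>The Poisson problem reduced to one variable. All cases use it: generic s with F and H
  glued by a cutoff, half-integral \<gamma> with a polynomial F and H = 0, and s = n with F = 1 and
  H = 0.\<close>

lemma vartheta_radial:
  fixes x :: "real^'n::finite"
  assumes card: "CARD('n) = n + 1" and s: "s > real n / 2"
    and ode: "hyp_ode (real n - s) ((real n + 1) / 2 - s) ((real n + 1) / 2) {-1<..<1} Y Y1 Y2"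
    and smooth: "\<And>k. Ck_real k {-1<..<2} F" "\<And>k. Ck_real k {-1<..<2} H"
    and form: "\<And>t. 0 \<le> t \<Longrightarrow> t < 1 \<Longrightarrow> Y t = F t + H t * ((1 - t) / 2) powr (2 * s - real n)"
    and F1: "F 1 = 1" and x: "x \<in> ball 0 1"
  shows "vartheta n s x = rho x powr (real n - s) * Y ((norm x)\<^sup>2)"
proof -
  define u where "u = (\<lambda>x::real^'n. rho x powr (real n - s) * Y ((norm x)\<^sup>2))"
  have sm: "smooth_upto (cball 0 1) (\<lambda>x::real^'n. F ((norm x)\<^sup>2))"
      "smooth_upto (cball 0 1) (\<lambda>x::real^'n. H ((norm x)\<^sup>2))"
    using smooth by (auto intro: smooth_upto_radial)
  have uform: "u x = F ((norm x)\<^sup>2) * rho x powr (real n - s) + H ((norm x)\<^sup>2) * rho x powr s"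
    if "x \<in> ball 0 1" for x
  proof -
    have "rho x powr (2 * s - real n) * rho x powr (real n - s) = rho x powr s"
      by (simp flip: powr_add)
    moreover have "Y ((norm x)\<^sup>2) = F ((norm x)\<^sup>2) + H ((norm x)\<^sup>2) * rho x powr (2 * s - real n)"
      unfolding rho_def using that by (intro form) (auto simp: power_less_one_iff)
    ultimately show ?thesis by (simp add: u_def algebra_simps)
  qed
  have Cu: "Ck_on (Suc (Suc 0)) (ball 0 1) u"
    by (rule Ck_on_poisson_form[OF sm uform])
  have eq: "- laplace_beltrami hyperbolic_metric u x - s * (real n - s) * u x = 0" if "x \<in> ball 0 1" for x
    using hyp_laplacian_radial_hypergeometric[OF card ode that] laplace_beltrami_hyperbolic[OF card Cu that]
    by (simp add: u_def)
  have bd: "F ((norm x)\<^sup>2) = 1" if "x \<in> sphere 0 1" for x :: "real^'n"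
    using that F1 by simp
  have "poisson_solution n s u"
    unfolding poisson_solution_def
    by (intro conjI ballI eq, assumption, rule exI[of _ "\<lambda>x. F ((norm x)\<^sup>2)"], rule
        exI[of _ "\<lambda>x. H ((norm x)\<^sup>2)"])
      (intro conjI ballI sm uform bd)
  from vartheta_eqI[OF card s this x] show ?thesis by (simp add: u_def)
qed

text \<open>The reciprocal of the value at t = 1 that Gauss's summation theorem gives for the series
  regular at the centre.\<close>

definition poisson_const :: "nat \<Rightarrow> real \<Rightarrow> real" where
  "poisson_const n s =
     Gamma s * Gamma (s - (real n - 1) / 2) / (Gamma (2 * s - real n) * Gamma ((real n + 1) / 2))"

text \<open>The choice c = 1 - \<nu> makes p = (n + 1)/2. Dividing by the coefficient of the first
  series normalizes the boundary value to 1, and Gamma(1 + \<nu>) = \<nu> Gamma(\<nu>) absorbs the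
  factor 1 - c.\<close>

lemma hypergeom_connection_poisson:
  fixes n :: nat and s z :: real
  defines "\<nu> \<equiv> 2 * s - real n"
  assumes s: "s > real n / 2" and \<nu>: "\<nu> \<notin> \<int>" and z: "0 < z" "z < 1"
  shows "poisson_const n s * hypergeom (real n - s) ((real n + 1) / 2 - s) ((real n + 1) / 2) (1 - z) =
    hypergeom (real n - s) ((real n + 1) / 2 - s) (1 - \<nu>) z
    - Gamma (1 - \<nu>) * rGamma (real n - s) * rGamma ((real n + 1) / 2 - s) *
      (Gamma s * Gamma (s - (real n - 1) / 2) / Gamma (1 + \<nu>)) *
      (z powr \<nu> * hypergeom s (s - (real n - 1) / 2) (1 + \<nu>) z)"
proof -
  define a b where "a = real n - s" and "b = (real n + 1) / 2 - s"
  have p: "a + b + 1 - (1 - \<nu>) = (real n + 1) / 2" by (simp add: a_def b_def \<nu>_def field_simps)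
  have c: "1 - \<nu> \<notin> \<int>" using \<nu> Ints_diff[of 1 "1 - \<nu>"] by auto
  have e: "a - (1 - \<nu>) + 1 = s" "b - (1 - \<nu>) + 1 = s - (real n - 1) / 2" "2 - (1 - \<nu>) = 1 + \<nu>"
      "1 - (1 - \<nu>) = \<nu>"
    by (simp_all add: a_def b_def \<nu>_def field_simps)
  have \<nu>0: "\<nu> > 0" using s by (simp add: \<nu>_def)
  define S B G P where "S = Gamma s" and "B = Gamma (s - (real n - 1) / 2)" and "G = Gamma (1 + \<nu>)"
    and "P = Gamma ((real n + 1) / 2)"
  have pos: "S > 0" "B > 0" "G > 0" "P > 0"
    unfolding S_def B_def G_def P_def using s \<nu>0 by (auto intro!: Gamma_real_pos simp: \<nu>_def field_simps)
  have "\<nu> \<notin> \<int>\<^sub>\<le>\<^sub>0" using \<nu>0 nonpos_Ints_nonpos[of \<nu>] by linarith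
  then have G: "G = \<nu> * Gamma \<nu>" using Gamma_plus1[of \<nu>] by (simp add: G_def add.commute)
  have rg: "rGamma s = 1 / S" "rGamma (s - (real n - 1) / 2) = 1 / B"
    by (simp_all add: rGamma_inverse_Gamma S_def B_def inverse_eq_divide)
  have "\<nu> * hypergeom a b ((real n + 1) / 2) (1 - z) =
    G * P * (1 / S) * (1 / B) * hypergeom a b (1 - \<nu>) z
    - Gamma (1 - \<nu>) * P * rGamma a * rGamma b * (z powr \<nu> * hypergeom s (s - (real n - 1) / 2) (1 + \<nu>) z)"
    using hypergeom_connection[OF c, of a b z] z
    unfolding p e rg G_def[symmetric] P_def[symmetric] by simp
  then have "S * B / (G * P) * (\<nu> * hypergeom a b ((real n + 1) / 2) (1 - z)) =
    S * B / (G * P) * (G * P * (1 / S) * (1 / B) * hypergeom a b (1 - \<nu>) z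
    - Gamma (1 - \<nu>) * P * rGamma a * rGamma b * (z powr \<nu> * hypergeom s (s - (real n - 1) / 2) (1 + \<nu>) z))"
    by simp
  also have "S * B / (G * P) * (\<nu> * hypergeom a b ((real n + 1) / 2) (1 - z)) =
    poisson_const n s * hypergeom a b ((real n + 1) / 2) (1 - z)"
    using \<nu>0 unfolding poisson_const_def G by (simp add: S_def B_def P_def \<nu>_def)
  also have "S * B / (G * P) * (G * P * (1 / S) * (1 / B) * hypergeom a b (1 - \<nu>) z
    - Gamma (1 - \<nu>) * P * rGamma a * rGamma b * (z powr \<nu> * hypergeom s (s - (real n - 1) / 2) (1 + \<nu>) z))
    = hypergeom a b (1 - \<nu>) z - Gamma (1 - \<nu>) * rGamma a * rGamma b * (S * B / G)
        * (z powr \<nu> * hypergeom s (s - (real n - 1) / 2) (1 + \<nu>) z)"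
    using pos by (simp add: right_diff_distrib)
  finally show ?thesis by (simp add: a_def b_def S_def B_def G_def)
qed

text \<open>The two hypergeometric series in $z = 2\rho$ are singular at the centre of the ball, so $F$ and $H$
  are obtained from them by a cutoff, with the remainder absorbed into $H$.\<close>

lemma vartheta_hypergeom:
  fixes x :: "real^'n::finite"
  assumes card: "CARD('n) = n + 1" and s: "s > real n / 2" and nint: "2 * s - real n \<notin> \<int>"
    and x: "x \<in> ball 0 1"
  shows "vartheta n s x = rho x powr (real n - s) *
    (poisson_const n s * hypergeom (real n - s) ((real n + 1) / 2 - s) ((real n + 1) / 2) ((norm x)\<^sup>2))"
proof -
  define a b p \<nu> where "a = real n - s" and "b = (real n + 1) / 2 - s" and "p = (real n + 1) / 2"
      and "\<nu> = 2 * s - real n"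
  define C where "C = poisson_const n s"
  \<comment> \<open>The second connection coefficient; the factor 2^\<nu> converts the power of z =
    2\<rho> into the same power of \<rho>.\<close>
  define E where "E = - (Gamma (1 - \<nu>) * rGamma a * rGamma b
      * (Gamma s * Gamma (s - (real n - 1) / 2) / Gamma (1 + \<nu>))) * 2 powr \<nu>"
  have p: "p \<notin> \<int>\<^sub>\<le>\<^sub>0" by (auto simp: p_def dest: nonpos_Ints_nonpos)
  have \<nu>: "\<nu> > 0" "\<nu> \<notin> \<int>" using s nint by (auto simp: \<nu>_def)
  have c: "1 - \<nu> \<notin> \<int>\<^sub>\<le>\<^sub>0" "1 + \<nu> \<notin> \<int>\<^sub>\<le>\<^sub>0"
    using \<nu> Ints_diff[of 1 "1 - \<nu>"] by (auto dest: nonpos_Ints_Int nonpos_Ints_nonpos)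
  have conn: "C * hypergeom a b p t = hypergeom a b (1 - \<nu>) (1 - t)
      + E * hypergeom s (s - (real n - 1) / 2) (1 + \<nu>) (1 - t) * ((1 - t) / 2) powr \<nu>" if "0 <
          t" "t < 1" for t
  proof -
    have "(1 - t) powr \<nu> = 2 powr \<nu> * ((1 - t) / 2) powr \<nu>"
    proof -
      have "2 * ((1 - t) / 2) = 1 - t" by (simp add: field_simps)
      then show ?thesis using powr_mult[of 2 "(1 - t) / 2" \<nu>] by (simp only:)
    qed
    then show ?thesis
      using hypergeom_connection_poisson[OF s nint, of "1 - t"] that
      unfolding C_def a_def b_def p_def \<nu>_def[symmetric] E_def by (simp add: mult_ac)
  qed
  obtain \<eta> :: "real \<Rightarrow> real" where \<eta>: "\<And>k. Ck_real k UNIV \<eta>" "\<And>t. t \<le> 1/3 \<Longrightarrow> \<eta> t = 0" "\<And>t. t \<ge> 2/3 \<Longrightarrow> \<eta> t = 1"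
    using smooth_cutoff[of "1/3" "2/3"] by auto
  have \<eta>': "Ck_real k UNIV (\<lambda>t. 1 - \<eta> t)" for k
    by (rule Ck_real_compose[OF open_UNIV open_UNIV UNIV_I Ck_real_one_minus[OF open_UNIV] \<eta>(1)])
  have hyp: "Ck_real k {-1<..<1} (hypergeom a' b' c')" if "c' \<notin> \<int>\<^sub>\<le>\<^sub>0" for k a' b' c'
    unfolding hypergeom_eq_powser[abs_def]
    by (rule Ck_real_powser, rule hyp_rec_summable[OF hyp_rec_hyp_coeff[OF that]])
  have hyp1: "Ck_real k {0<..<2} (\<lambda>t. hypergeom a' b' c' (1 - t))" if "c' \<notin> \<int>\<^sub>\<le>\<^sub>0" for k a' b' c'
    by (rule Ck_real_compose[OF _ _ _ hyp[OF that] Ck_real_one_minus]) auto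
  have U1: "{-1<..<2::real} = {0<..<2} \<union> {-1<..<1/3}" and U2: "{-1<..<2::real} = {-1<..<1} \<union> {2/3<..<2}"
    by auto
  have half: "Ck_real k {-1<..<1} (\<lambda>t. ((1 - t) / 2) powr (- \<nu>))" for k
    by (rule Ck_real_subset[OF Ck_real_half_powr]) auto
  have "vartheta n s x = rho x powr (real n - s) * (\<lambda>t. C * hypergeom a b p t) ((norm x)\<^sup>2)"
  proof (rule vartheta_radial[OF card s _ _ _ _ _ x])
    have G: "hyp_ode a b p {-1<..<1} (hypergeom a b p)
       (\<lambda>z. \<Sum>k. diffs (hyp_coeff a b p) k * z ^ k) (\<lambda>z. \<Sum>k. diffs (diffs (hyp_coeff a b p)) k * z ^ k)"
      by (rule hyp_ode_hypergeom[OF p])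
    show "hyp_ode (real n - s) ((real n + 1) / 2 - s) ((real n + 1) / 2) {-1<..<1}
        (\<lambda>t. C * hypergeom a b p t)
       (\<lambda>z. C * (\<Sum>k. diffs (hyp_coeff a b p) k * z ^ k))
           (\<lambda>z. C * (\<Sum>k. diffs (diffs (hyp_coeff a b p)) k * z ^ k))"
      using hyp_ode_scale[OF G, of C] unfolding a_def b_def p_def .
    show "Ck_real k {-1<..<2} (\<lambda>t. \<eta> t * hypergeom a b (1 - \<nu>) (1 - t))" for k
      unfolding U1 by (rule Ck_real_mult_extend[OF _ _ hyp1[OF c(1)] \<eta>(1)]) (auto simp: \<eta>(2))
    have 1: "Ck_real k {-1<..<2} (\<lambda>t. \<eta> t * (E * hypergeom s (s - (real n - 1) / 2) (1 + \<nu>) (1 - t)))" for k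
      unfolding U1
      by (rule Ck_real_mult_extend[OF _ _ Ck_real_mult[OF _ Ck_real_const hyp1[OF c(2)]] \<eta>(1)])
          (auto simp: \<eta>(2))
    \<comment> \<open>The part of the solution away from the sphere is put into H by dividing it by
      \<rho>^\<nu>; this is harmless because 1 - \<eta> vanishes for t > 2/3.\<close>
    have 2: "Ck_real k {-1<..<2} (\<lambda>t. (1 - \<eta> t) * (C * hypergeom a b p t * ((1 - t) / 2) powr (- \<nu>)))" for k
      unfolding U2
      by (rule Ck_real_mult_extend[OF _ _
          Ck_real_mult[OF _ Ck_real_mult[OF _ Ck_real_const hyp[OF p]] half] \<eta>'])
        (auto simp: \<eta>(3))
    show "Ck_real k {-1<..<2} (\<lambda>t. \<eta> t * (E * hypergeom s (s - (real n - 1) / 2) (1 + \<nu>) (1 - t)) +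
        (1 - \<eta> t) * (C * hypergeom a b p t * ((1 - t) / 2) powr (- \<nu>)))" for k
      by (rule Ck_real_add[OF _ 1 2]) simp
    show "C * hypergeom a b p t = \<eta> t * hypergeom a b (1 - \<nu>) (1 - t) +
       (\<eta> t * (E * hypergeom s (s - (real n - 1) / 2) (1 + \<nu>) (1 - t)) +
        (1 - \<eta> t) * (C * hypergeom a b p t * ((1 - t) / 2) powr (- \<nu>))) * ((1 - t) / 2) powr
            (2 * s - real n)"
      if t: "0 \<le> t" "t < 1" for t
    proof -
      have inv: "((1 - t) / 2) powr (- \<nu>) * ((1 - t) / 2) powr \<nu> = 1"
        using t by (simp flip: powr_add)
      have "\<eta> t * (C * hypergeom a b p t) = \<eta> t * (hypergeom a b (1 - \<nu>) (1 - t)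
         + E * hypergeom s (s - (real n - 1) / 2) (1 + \<nu>) (1 - t) * ((1 - t) / 2) powr \<nu>)"
      \<comment> \<open>At t = 0 the series in z sit at z = 1, outside the connection formula; there
        \<eta> is 0 and both sides vanish.\<close>
      proof (cases "t = 0")
        case False
        then show ?thesis using conn[of t] t by simp
      qed (simp add: \<eta>(2))
      moreover have "(1 - \<eta> t) * (C * hypergeom a b p t) =
          (1 - \<eta> t) * (C * hypergeom a b p t * (((1 - t) / 2) powr (- \<nu>) * ((1 - t) / 2) powr \<nu>))"
        unfolding inv by simp
      ultimately show ?thesis
        unfolding \<nu>_def[symmetric] by (simp add: algebra_simps)
    qed
    show "\<eta> 1 * hypergeom a b (1 - \<nu>) (1 - 1) = 1" by (simp add: \<eta>(3))
  qed
  then show ?thesis by (simp add: C_def a_def b_def p_def)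
qed

section \<open>The metric for generic parameter\<close>

lemma adapted_metric_eq:
  assumes "x \<in> ball 0 1" "s \<noteq> real n" "vartheta n s x = rho x powr (real n - s) * \<psi>"
  shows "adapted_metric n s x = (\<psi> powr (2 / (real n - s))) *\<^sub>R flat_metric x"
proof -
  have r: "rho x > 0" by (rule rho_pos[OF assms(1)])
  \<comment> \<open>The exponent 2/(n - s) turns \<rho>^(n-s) into \<rho>^2, which cancels the
    conformal factor of the hyperbolic metric.\<close>
  have "(rho x powr (real n - s) * \<psi>) powr (2 / (real n - s)) = (rho x)\<^sup>2 * \<psi> powr (2 / (real n - s))"
  proof -
    have "(real n - s) * (2 / (real n - s)) = 2" using assms(2) by (simp add: field_simps)
    then have "(rho x powr (real n - s)) powr (2 / (real n - s)) = (rho x)\<^sup>2"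
      using r by (simp only: powr_powr powr_numeral)
    then show ?thesis by (simp add: powr_mult)
  qed
  then show ?thesis
    using r assms(2,3) by (simp add: adapted_metric_def hyperbolic_metric_eq flat_metric_def)
qed

lemma Gamma_legendre_duplication_real:
  fixes z :: real
  assumes "z \<notin> \<int>\<^sub>\<le>\<^sub>0" "z + 1/2 \<notin> \<int>\<^sub>\<le>\<^sub>0"
  shows "Gamma z * Gamma (z + 1/2) = 2 powr (1 - 2 * z) * sqrt pi * Gamma (2 * z)"
proof -
  have e: "complex_of_real z + 1/2 = complex_of_real (z + 1/2)"
      "2 * complex_of_real z = complex_of_real (2 * z)"
    "(1 - complex_of_real (2 * z)) * of_real (ln 2) = complex_of_real ((1 - 2 * z) * ln 2)" by simp_all
  have "complex_of_real z \<notin> \<int>\<^sub>\<le>\<^sub>0" "complex_of_real z + 1/2 \<notin> \<int>\<^sub>\<le>\<^sub>0"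
    unfolding e of_real_in_nonpos_Ints_iff using assms by auto
  from Gamma_legendre_duplication[OF this]
  have "complex_of_real (Gamma z * Gamma (z + 1/2))
      = complex_of_real (exp ((1 - 2 * z) * ln 2) * sqrt pi * Gamma (2 * z))"
    unfolding e Gamma_complex_of_real exp_of_real by (simp only: of_real_mult)
  then show ?thesis unfolding of_real_eq_iff by (simp add: powr_def)
qed

text \<open>Legendre duplication at -\<gamma> cancels Gamma(1/2 - \<gamma>), and at \<gamma> it
  eliminates Gamma(1/2 + \<gamma>), leaving the quotient in \<open>d_const\<close>. The sign comes
  from Gamma(1 - 2\<gamma>) = -2\<gamma> Gamma(-2\<gamma>).\<close>

lemma connection_coefficient:
  fixes \<gamma> :: real
  assumes "\<gamma> > 0" "2 * \<gamma> \<notin> \<int>"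
  shows "Gamma (1 - 2 * \<gamma>) * rGamma (1/2 - \<gamma>) * Gamma (1/2 + \<gamma>) / Gamma (1 + 2 * \<gamma>) * 2 powr (2 * \<gamma>)
    = - (1 / d_const \<gamma>)"
proof -
  have nz: "x \<notin> \<int>\<^sub>\<le>\<^sub>0" if "2 * x \<notin> \<int>" for x :: real
    using that by (auto dest!: nonpos_Ints_Int intro: Ints_mult)
  have half: "x + 1/2 \<notin> \<int>\<^sub>\<le>\<^sub>0" if "2 * x \<notin> \<int>" for x :: real
  proof (rule nz)
    show "2 * (x + 1 / 2) \<notin> \<int>"
      using that Ints_diff[of "2 * (x + 1/2)" 1] by auto
  qed
  have m: "2 * (- \<gamma>) \<notin> \<int>" using assms(2) by simp
  have nz': "Gamma \<gamma> \<noteq> 0" "Gamma (1/2 - \<gamma>) \<noteq> 0" "Gamma (2 * \<gamma>) \<noteq> 0"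
    using nz[OF assms(2)] half[OF m] nonpos_Ints_Int[of "2 * \<gamma>"] assms(2)
    by (auto simp: Gamma_eq_zero_iff)
  have "Gamma (- \<gamma>) * Gamma (1/2 - \<gamma>) = 2 * 2 powr (2 * \<gamma>) * sqrt pi * Gamma (- 2 * \<gamma>)"
    using Gamma_legendre_duplication_real[OF nz[OF m] half[OF m]] by (simp add: powr_add)
  then have 1: "Gamma (- 2 * \<gamma>) = Gamma (- \<gamma>) * Gamma (1/2 - \<gamma>) / (2 * 2 powr (2 * \<gamma>) * sqrt pi)"
    by simp
  have "Gamma \<gamma> * Gamma (1/2 + \<gamma>) = 2 / 2 powr (2 * \<gamma>) * sqrt pi * Gamma (2 * \<gamma>)"
    using Gamma_legendre_duplication_real[OF nz[OF assms(2)] half[OF assms(2)]] by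
        (simp add: powr_diff add.commute)
  then have 2: "Gamma (1/2 + \<gamma>) = 2 / 2 powr (2 * \<gamma>) * sqrt pi * Gamma (2 * \<gamma>) / Gamma \<gamma>"
    using nz'(1) by (simp add: field_simps)
  have 3: "Gamma (1 - 2 * \<gamma>) = - 2 * \<gamma> * Gamma (- 2 * \<gamma>)"
    using Gamma_plus1[of "- 2 * \<gamma>"] nonpos_Ints_Int[of "- 2 * \<gamma>"] assms(2) by auto
  have 4: "Gamma (1 + 2 * \<gamma>) = 2 * \<gamma> * Gamma (2 * \<gamma>)"
    using Gamma_plus1[of "2 * \<gamma>"] nonpos_Ints_Int[of "2 * \<gamma>"] assms(2) by (auto simp: add.commute)
  show ?thesis
    unfolding 3 4 1 2 d_const_def rGamma_inverse_Gamma using assms(1) nz' by (simp add: field_simps)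
qed

lemma half_naturals_iff: "\<gamma> > 0 \<Longrightarrow> 2 * \<gamma> \<in> \<int> \<longleftrightarrow> \<gamma> \<in> half_naturals"
proof
  assume "\<gamma> > 0" "2 * \<gamma> \<in> \<int>"
  then obtain k where "2 * \<gamma> = of_int k" by (auto elim: Ints_cases)
  with \<open>\<gamma> > 0\<close> have "\<gamma> = real (nat k) / 2" by simp
  then show "\<gamma> \<in> half_naturals" by (auto simp: half_naturals_def)
qed (auto simp: half_naturals_def)

text \<open>\<open>\<psi>\<close> is taken to be the normalized series in |x|^2, which is continuous
  at the centre; the formula in 2\<rho> then follows off the centre. This realizes the value by
  continuity without computing a limit.\<close>

lemma adapted_metric_generic:
  fixes n :: nat and \<gamma> s :: real
  assumes card: "CARD('n::finite) = n + 1" and s: "s = real n / 2 + \<gamma>"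
    and \<gamma>: "0 < \<gamma>" "\<gamma> < real n / 2" "\<gamma> \<notin> half_naturals"
  obtains \<psi> :: "real^'n \<Rightarrow> real" where "continuous_on (ball 0 1) \<psi>"
    "\<And>x. x \<in> ball 0 1 - {0} \<Longrightarrow> \<psi> x =
       hypergeom (real n / 2 - \<gamma>) (1 / 2 - \<gamma>) (1 - 2 * \<gamma>) (2 * rho x)
       + rho x powr (2 * \<gamma>) * (1 / d_const \<gamma>)
         * (Gamma (real n / 2 + \<gamma>) / Gamma (real n / 2 - \<gamma>))
         * hypergeom (1 / 2 + \<gamma>) (real n / 2 + \<gamma>) (1 + 2 * \<gamma>) (2 * rho x)"
    "\<And>x. x \<in> ball 0 1 \<Longrightarrow> adapted_metric n s x = (\<psi> x powr (2 / (real n - s))) *\<^sub>R flat_metric x"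
proof
  define \<psi> where "\<psi> = (\<lambda>x::real^'n. poisson_const n s *
    hypergeom (real n - s) ((real n + 1) / 2 - s) ((real n + 1) / 2) ((norm x)\<^sup>2))"
  have e: "2 * s - real n = 2 * \<gamma>" "real n - s = real n / 2 - \<gamma>" "(real n + 1) / 2 - s = 1 / 2 - \<gamma>"
    "s - (real n - 1) / 2 = 1 / 2 + \<gamma>"
    using s by (auto simp: field_simps)
  have s': "s > real n / 2" "s \<noteq> real n" "2 * s - real n \<notin> \<int>"
    using s \<gamma> half_naturals_iff[OF \<gamma>(1)] unfolding e by auto
  have "(real n + 1) / 2 \<notin> \<int>\<^sub>\<le>\<^sub>0" by (auto dest: nonpos_Ints_nonpos)
  then have "isCont (hypergeom a b ((real n + 1) / 2)) t" if "t \<in> {-1<..<1}" for a b t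
    using hyp_ode_hypergeom[of "(real n + 1) / 2" a b] that by (auto simp: hyp_ode_def intro: DERIV_isCont)
  then have "continuous_on {-1<..<1} (hypergeom a b ((real n + 1) / 2))" for a b
    by (intro continuous_at_imp_continuous_on) auto
  then have "continuous_on (ball 0 1) (\<lambda>x::real^'n. hypergeom a b ((real n + 1) / 2) ((norm x)\<^sup>2))" for a b
    by (rule continuous_on_compose2) (auto intro!: continuous_intros norm_square_ball simp del:
        greaterThanLessThan_iff)
  then show "continuous_on (ball 0 1) \<psi>"
    unfolding \<psi>_def by (rule continuous_on_mult_left)
  show "\<psi> x = hypergeom (real n / 2 - \<gamma>) (1 / 2 - \<gamma>) (1 - 2 * \<gamma>) (2 * rho x)
       + rho x powr (2 * \<gamma>) * (1 / d_const \<gamma>)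
         * (Gamma (real n / 2 + \<gamma>) / Gamma (real n / 2 - \<gamma>))
         * hypergeom (1 / 2 + \<gamma>) (real n / 2 + \<gamma>) (1 + 2 * \<gamma>) (2 * rho x)"
    if x: "x \<in> ball 0 1 - {0}" for x
  proof -
    define z where "z = 2 * rho x"
    have z: "0 < z" "z < 1" "(norm x)\<^sup>2 = 1 - z"
      using x rho_pos[of x] by (auto simp: z_def rho_def field_simps)
    define h where "h = hypergeom s (1 / 2 + \<gamma>) (1 + 2 * \<gamma>) z"
    have "\<psi> x = hypergeom (real n / 2 - \<gamma>) (1 / 2 - \<gamma>) (1 - 2 * \<gamma>) z
      - Gamma (1 - 2 * \<gamma>) * rGamma (real n / 2 - \<gamma>) * rGamma (1 / 2 - \<gamma>) *
      (Gamma s * Gamma (1 / 2 + \<gamma>) / Gamma (1 + 2 * \<gamma>)) * (z powr (2 * \<gamma>) * h)"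
      using hypergeom_connection_poisson[OF s'(1,3), of z] z unfolding \<psi>_def e h_def by simp
    also have "z powr (2 * \<gamma>) = 2 powr (2 * \<gamma>) * rho x powr (2 * \<gamma>)"
      unfolding z_def by (rule powr_mult)
    also have "Gamma (1 - 2 * \<gamma>) * rGamma (real n / 2 - \<gamma>) * rGamma (1 / 2 - \<gamma>) *
      (Gamma s * Gamma (1 / 2 + \<gamma>) / Gamma (1 + 2 * \<gamma>)) * (2 powr (2 * \<gamma>) * rho x powr (2 * \<gamma>) * h)
      = (Gamma (1 - 2 * \<gamma>) * rGamma (1/2 - \<gamma>) * Gamma (1/2 + \<gamma>) / Gamma (1 + 2 * \<gamma>) * 2 powr (2 * \<gamma>)) *
        (rho x powr (2 * \<gamma>) * (Gamma s * rGamma (real n / 2 - \<gamma>)) * h)"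
      by (simp add: mult_ac)
    also have "Gamma (1 - 2 * \<gamma>) * rGamma (1/2 - \<gamma>) * Gamma (1/2 + \<gamma>) / Gamma (1 + 2 * \<gamma>) * 2 powr (2 * \<gamma>)
       = - (1 / d_const \<gamma>)"
      by (rule connection_coefficient[OF \<gamma>(1)]) (use s'(3) e(1) in simp)
    finally have "\<psi> x = hypergeom (real n / 2 - \<gamma>) (1 / 2 - \<gamma>) (1 - 2 * \<gamma>) z
      - (- (1 / d_const \<gamma>)) * (rho x powr (2 * \<gamma>) * (Gamma s * rGamma (real n / 2 - \<gamma>)) * h)" .
    also have "h = hypergeom (1 / 2 + \<gamma>) (real n / 2 + \<gamma>) (1 + 2 * \<gamma>) z"
      by (simp add: h_def hypergeom_def s mult.commute)
    also have "Gamma s * rGamma (real n / 2 - \<gamma>) = Gamma (real n / 2 + \<gamma>) / Gamma (real n / 2 - \<gamma>)"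
      by (simp add: s rGamma_inverse_Gamma inverse_eq_divide)
    finally show ?thesis
      unfolding z_def[symmetric] by (simp only: mult_minus_left diff_minus_eq_add mult_ac)
  qed
  show "adapted_metric n s x = (\<psi> x powr (2 / (real n - s))) *\<^sub>R flat_metric x" if "x \<in> ball 0 1" for x
    using vartheta_hypergeom[OF card s'(1,3) that] that s'(2)
    by (intro adapted_metric_eq) (auto simp: \<psi>_def)
qed

section \<open>Half-integral parameter: terminating series\<close>

lemma pochhammer_minus_two_nonzero:
  assumes "j \<le> M"
  shows "pochhammer (- 2 * real M) j \<noteq> 0"
proof
  assume "pochhammer (- 2 * real M) j = 0"
  then obtain i where "i < j" "- 2 * real M = - real i" by (auto simp: pochhammer_eq_0_iff)
  then show False using assms by linarith
qed

text \<open>The numerator factor with parameter -m vanishes from k = m + 1 on, the denominator with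
  -2m only from k = 2m + 1 on, so division by 0 meets only vanishing numerators.\<close>

lemma hyp_rec_terminating:
  "hyp_rec a (- real m) (- 2 * real m) (hyp_coeff a (- real m) (- 2 * real m))"
proof -
  have "(real k + 1) * (- 2 * real m + real k) * hyp_coeff a (- real m) (- 2 * real m) (Suc k) =
      (a + real k) * (- real m + real k) * hyp_coeff a (- real m) (- 2 * real m) k" for k
  proof (cases "k < m")
    case True
    have "pochhammer (- 2 * real m) k \<noteq> 0"
      using True by (intro pochhammer_minus_two_nonzero) simp
    moreover have "- 2 * real m + real k \<noteq> 0" using True by linarith
    ultimately show ?thesis
      by (simp add: hyp_coeff_def pochhammer_Suc divide_simps)
  next
    case False
    have "pochhammer (- real m) (Suc k) = 0" using False by (simp add: pochhammer_of_nat_eq_0_iff)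
    \<comment> \<open>At k = m the factor -m + k vanishes, beyond it the coefficient does.\<close>
    moreover have "k = m \<or> pochhammer (- real m) k = 0" using False by
        (auto simp: pochhammer_of_nat_eq_0_iff)
    ultimately show ?thesis by (auto simp: hyp_coeff_def simp del: pochhammer_Suc)
  qed
  then show ?thesis by (simp add: hyp_rec_def)
qed

lemma adapted_metric_half_integer:
  fixes x :: "real^'n::finite"
  assumes card: "CARD('n) = n + 1" and \<gamma>: "\<gamma> = real m + 1 / 2" "\<gamma> < real n / 2" and s: "s = real n / 2 + \<gamma>"
    and x: "x \<in> ball 0 1"
  shows "adapted_metric n s x =
    ((\<Sum>k=0..m. pochhammer ((real n - 1) / 2 - real m) k * pochhammer (- real m) k
       / pochhammer (- 2 * real m) k * ((2 * rho x) ^ k / fact k)) powr (2 / (real n - s))) *\<^sub>R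
           flat_metric x"
proof -
  define a where "a = (real n - 1) / 2 - real m"
  define q where "q = hyp_coeff a (- real m) (- 2 * real m)"
  define y where "y = (\<lambda>z. \<Sum>k. q k * z ^ k)"
  have q0: "q k = 0" if "k > m" for k
    using that by (simp add: q_def hyp_coeff_def pochhammer_of_nat_eq_0_iff)
  have sm: "summable (\<lambda>k. q k * z ^ k)" for z :: real
    by (rule summable_finite[of "{..m}"]) (auto simp: q0)
  have fin: "y z = (\<Sum>k=0..m. q k * z ^ k)" for z
    unfolding y_def by (subst suminf_finite[of "{0..m}"]) (auto simp: q0)
  have e: "a = real n - s" "- real m = (real n + 1) / 2 - s"
    using \<gamma> s by (auto simp: a_def field_simps)
  \<comment> \<open>Being a polynomial, \<open>y\<close> solves the equation beyond the unit disc;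
    the interval has to contain 1 - t for -1 < t < 2. Reflection then turns c = -2m into a + b + 1 -
    c = (n + 1)/2.\<close>
  have "hyp_ode a (- real m) (- 2 * real m) {-3<..<3} y
      (\<lambda>z. \<Sum>k. diffs q k * z ^ k) (\<lambda>z. \<Sum>k. diffs (diffs q) k * z ^ k)"
    unfolding y_def by (rule hyp_ode_powser[OF hyp_rec_terminating[of a m, folded q_def] sm])
  then have ode: "hyp_ode a (- real m) ((real n + 1) / 2) {-1<..<1} (\<lambda>t. y (1 - t))
      (\<lambda>t. - (\<Sum>k. diffs q k * (1 - t) ^ k)) (\<lambda>t. \<Sum>k. diffs (diffs q) k * (1 - t) ^ k)"
    by (rule hyp_ode_reflect) (auto simp: a_def field_simps)
  have Cy: "Ck_real k {-3<..<3} y" for k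
    unfolding y_def by (rule Ck_real_powser[OF sm])
  have "vartheta n s x = rho x powr (real n - s) * (\<lambda>t. y (1 - t)) ((norm x)\<^sup>2)"
  proof (rule vartheta_radial[OF card _ ode[unfolded e] _ _ _ _ x])
    show "Ck_real k {-1<..<2} (\<lambda>t. y (1 - t))" for k
      by (rule Ck_real_compose[OF _ _ _ Cy Ck_real_one_minus]) auto
    show "Ck_real k {-1<..<2} (\<lambda>t. 0)" for k by (rule Ck_real_const) simp
    show "y (1 - 1) = 1" by (simp add: y_def q_def)
  qed (use \<gamma> s in auto)
  moreover have "1 - (norm x)\<^sup>2 = 2 * rho x" by (simp add: rho_def)
  ultimately have "vartheta n s x = rho x powr (real n - s) * (\<Sum>k=0..m. q k * (2 * rho x) ^ k)"
    by (simp add: fin)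
  from adapted_metric_eq[OF x _ this] show ?thesis
    using \<gamma> s by (simp add: q_def hyp_coeff_def a_def)
qed

section \<open>The limiting case\<close>

text \<open>Caratheodory's criterion: continuity of \<open>f\<close> at 0 suffices, so a series
  depending on a parameter is differentiated below without differentiating its terms.\<close>

lemma has_derivative_ident_mult_at_0:
  fixes f :: "real \<Rightarrow> real"
  assumes "isCont f 0"
  shows "((\<lambda>a. a * f a) has_real_derivative f 0) (at 0)"
  unfolding CARAT_DERIV by (rule exI[of _ f]) (use assms in auto)

lemma abs_pochhammer_le: "\<bar>x\<bar> \<le> y \<Longrightarrow> \<bar>pochhammer x k\<bar> \<le> pochhammer (y::real) k"
  unfolding pochhammer_prod abs_prod by (rule prod_mono) auto

text \<open>For $k \ge 1$ this is the derivative at $a = 0$ of \<open>hyp_coeff a (- M) c k\<close>; for $k = 0$ it is $0$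
  because of the division by zero, as it should be.\<close>

definition log_coeff :: "nat \<Rightarrow> real \<Rightarrow> nat \<Rightarrow> real" where
  "log_coeff M c k = pochhammer (- real M) k / (pochhammer c k * real k)"

definition log_poly :: "nat \<Rightarrow> real \<Rightarrow> real \<Rightarrow> real" where
  "log_poly M c t = (\<Sum>k. log_coeff M c k * t ^ k)"

lemma log_coeff_eq_0: "k > M \<or> k = 0 \<Longrightarrow> log_coeff M c k = 0"
  by (auto simp: log_coeff_def pochhammer_of_nat_eq_0_iff)

lemma log_poly_eq: "log_poly M c t = (\<Sum>k=1..M. log_coeff M c k * t ^ k)"
  unfolding log_poly_def by (subst suminf_finite[of "{1..M}"]) (auto intro: log_coeff_eq_0 simp: not_le)

lemma summable_log_coeff: "summable (\<lambda>k. log_coeff M c k * t ^ k)"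
  by (rule summable_finite[of "{1..M}"]) (auto intro: log_coeff_eq_0 simp: not_le)

text \<open>The derivative at a = 0 of the hypergeometric recurrence with b = -M. Differentiating
  the factor a + k leaves (k - M) q_k at a = 0, which is -M for k = 0 and zero afterwards.\<close>

lemma log_coeff_rec:
  assumes "\<And>j. j \<le> M \<Longrightarrow> pochhammer c j \<noteq> 0"
  shows "(real k + 1) * (c + real k) * log_coeff M c (Suc k)
      - (0 + real k) * (- real M + real k) * log_coeff M c k
    = (if k = 0 then - real M else 0)"
proof (cases "k < M")
  case True
  have "pochhammer c k \<noteq> 0" "pochhammer c (Suc k) \<noteq> 0" using assms[of k] assms[of "Suc k"] True by auto
  then have "pochhammer c k \<noteq> 0" "c + real k \<noteq> 0" by (auto simp: pochhammer_Suc)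
  then show ?thesis by (simp add: log_coeff_def pochhammer_Suc divide_simps)
next
  case False
  then have "log_coeff M c (Suc k) = 0" by (intro log_coeff_eq_0) auto
  moreover have "(- real M + real k) * log_coeff M c k = 0"
    using False log_coeff_eq_0[of M k c] by (cases "k = M") auto
  ultimately show ?thesis using False by (auto simp: mult.assoc)
qed

text \<open>As functions of $z$ both sides solve the hypergeometric equation with $a = 0$, $b = -M$, $c = -2M$ and
  right-hand side $-M$. Their difference has constant Wronskian with the solution $1$, and this
  constant vanishes because the weight does at $z = 1$.\<close>

lemma log_poly_reflect:
  assumes z: "0 \<le> z" "z \<le> 1"
  shows "log_poly M (- 2 * real M) z = log_poly M (real M + 1) (1 - z) - log_poly M (real M + 1) 1"
proof -
  define c p where "c = - 2 * real M" and "p = real M + 1"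
  define q q' where "q = log_coeff M c" and "q' = log_coeff M p"
  define Q1 Q2 P1 P2 where "Q1 = (\<lambda>z. \<Sum>k. diffs q k * z ^ k)" and "Q2 = (\<lambda>z. \<Sum>k. diffs (diffs q) k * z ^ k)"
    and "P1 = (\<lambda>z. \<Sum>k. diffs q' k * z ^ k)" and "P2 = (\<lambda>z. \<Sum>k. diffs (diffs q') k * z ^ k)"
  have nz: "pochhammer c j \<noteq> 0" "pochhammer p j \<noteq> 0" if "j \<le> M" for j
    using pochhammer_minus_two_nonzero[OF that] pochhammer_pos[of p j] by (auto simp: c_def p_def)
  have Q: "(log_poly M c has_real_derivative Q1 z) (at z)" "(Q1 has_real_derivative Q2 z) (at z)"
     "z * (1 - z) * Q2 z + (c - (0 + - real M + 1) * z) * Q1 z - 0 * - real M * log_poly M c z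
         = - real M" for z
    using powser_hyp_operator[OF summable_log_coeff _ log_coeff_rec[OF nz(1)], of z "\<bar>z\<bar> + 1"]
    unfolding Q1_def Q2_def q_def log_poly_def[abs_def] by auto
  have P: "(log_poly M p has_real_derivative P1 z) (at z)" "(P1 has_real_derivative P2 z) (at z)"
     "z * (1 - z) * P2 z + (p - (0 + - real M + 1) * z) * P1 z - 0 * - real M * log_poly M p z
         = - real M" for z
    using powser_hyp_operator[OF summable_log_coeff _ log_coeff_rec[OF nz(2)], of z "\<bar>z\<bar> + 1"]
    unfolding P1_def P2_def q'_def log_poly_def[abs_def] by auto
  define R R1 where "R = (\<lambda>z. log_poly M c z - log_poly M p (1 - z))" and "R1 = (\<lambda>z. Q1 z + P1 (1 - z))"
  have d: "((\<lambda>z. 1 - z) has_real_derivative -1) (at z)" for z :: real by (auto intro!: derivative_eq_intros)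
  have R: "(R has_real_derivative R1 z) (at z)" for z
    using DERIV_diff[OF Q(1) DERIV_chain2[OF P(1) d]] by (simp add: R_def R1_def)
  have R1: "(R1 has_real_derivative Q2 z - P2 (1 - z)) (at z)" for z
    using DERIV_add[OF Q(2) DERIV_chain2[OF P(2) d]] by (simp add: R1_def)
  \<comment> \<open>Since c + p = 1 - M = a + b + 1, reflection exchanges the equations for c and p,
    and the equal right-hand sides -M cancel in the difference.\<close>
  have h1: "hyp_ode 0 (- real M) c {0<..<1} R R1 (\<lambda>z. Q2 z - P2 (1 - z))"
    unfolding hyp_ode_def
  proof (intro ballI conjI R R1)
    fix z :: real
    show "z * (1 - z) * (Q2 z - P2 (1 - z)) + (c - (0 + - real M + 1) * z) * R1 z - 0 * - real M * R z = 0"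
      using Q(3)[of z] P(3)[of "1 - z"] by (simp add: R1_def p_def c_def algebra_simps)
  qed
  have h2: "hyp_ode 0 (- real M) c {0<..<1} (\<lambda>_. 1) (\<lambda>_. 0) (\<lambda>_. 0)"
    by (simp add: hyp_ode_def)
  obtain \<kappa> where \<kappa>: "\<And>z. 0 < z \<Longrightarrow> z < 1 \<Longrightarrow>
      z powr c * (1 - z) powr (0 + - real M + 1 - c) * (1 * R1 z - 0 * R z) = \<kappa>"
    using hyp_ode_wronskian[OF h2 h1] by blast
  have "\<kappa> = 0"
  proof -
    \<comment> \<open>The exponent of 1 - z in the weight is a + b + 1 - c = M + 1 > 0, while
      \<open>R1\<close> stays bounded at z = 1.\<close>
    have "((\<lambda>z. (1 - z) powr (real M + 1)) \<longlongrightarrow> 0) (at_left 1)" by real_asymp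
    moreover have "(R1 \<longlongrightarrow> R1 1) (at_left 1)"
      using DERIV_isCont[OF R1, of 1] by (auto simp: isCont_def intro: tendsto_mono[OF at_le])
    ultimately have lim: "((\<lambda>z. z powr c * (1 - z) powr (real M + 1) * R1 z)
        \<longlongrightarrow> 1 powr c * 0 * R1 1) (at_left 1)"
      by (intro tendsto_intros) auto
    have "eventually (\<lambda>z::real. 0 < z \<and> z < 1) (at_left 1)"
      by (rule eventually_at_leftI[of 0 1]) auto
    then have ev: "eventually (\<lambda>z. z powr c * (1 - z) powr (real M + 1) * R1 z = \<kappa>) (at_left 1)"
      by eventually_elim (use \<kappa> in \<open>simp add: c_def add.commute\<close>)
    show ?thesis
      using tendsto_unique[OF trivial_limit_at_left_real tendsto_eventually[OF ev] lim] by simp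
  qed
  then have "R1 z = 0" if "0 < z" "z < 1" for z using \<kappa>[OF that] that by simp
  then have "(R has_real_derivative 0) (at z)" if "0 < z" "z < 1" for z using R[of z] that by simp
  moreover have "continuous_on {0..1} R"
    using DERIV_isCont[OF R] by (intro continuous_at_imp_continuous_on) auto
  ultimately have "R z = R 0"
    using DERIV_isconst2[of 0 1 R z] z by simp
  moreover have "log_poly M c 0 = 0" by (simp add: log_poly_eq)
  ultimately show ?thesis by (simp add: R_def c_def p_def)
qed

text \<open>The left-hand side is the derivative at a = 0 of the terminating sum \<open>L\<close>.
  Chu-Vandermonde evaluates \<open>L\<close> as a Gamma quotient equal to 1 at a = 0, so its
  derivative there is a difference of digamma values.\<close>

lemma log_poly_1: "log_poly M (real M + 1) 1 = Digamma (real M + 1) - Digamma (2 * real M + 1)"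
proof -
  define p where "p = real M + 1"
  have np: "x \<notin> \<int>\<^sub>\<le>\<^sub>0" if "x > 0" for x :: real using that nonpos_Ints_nonpos[of x] by linarith
  define L where "L = (\<lambda>a. \<Sum>k=0..M. (pochhammer a k * pochhammer (- real M) k) / (fact k * pochhammer p k))"
  have "((\<lambda>a. pochhammer a k * (pochhammer (- real M) k / (fact k * pochhammer p k))) has_real_derivative
      log_coeff M p k) (at 0)" for k
  proof (cases k)
    case (Suc j)
    have "isCont (\<lambda>a. pochhammer (a + 1) j) (0::real)" by
        (intro continuous_intros isCont_o2[OF _ isCont_pochhammer])
    from has_derivative_ident_mult_at_0[OF this]
    have "((\<lambda>a. pochhammer a (Suc j)) has_real_derivative fact j) (at 0)"
      by (simp add: pochhammer_rec pochhammer_fact[symmetric])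
    then show ?thesis
      unfolding Suc by (rule DERIV_cong[OF DERIV_cmult_right]) (simp add: log_coeff_def)
  qed (simp add: log_coeff_def)
  from DERIV_sum[OF this] have "(L has_real_derivative (\<Sum>k=0..M. log_coeff M p k)) (at 0)"
    by (simp add: L_def)
  also have "(\<Sum>k=0..M. log_coeff M p k) = log_poly M p 1"
    by (simp add: log_poly_eq sum.atLeast_Suc_atMost log_coeff_eq_0)
  finally have L: "(L has_real_derivative log_poly M p 1) (at 0)" .
  have L_eq: "L a = Gamma (2 * real M + 1 - a) / Gamma (p
      - a) / (Gamma (2 * real M + 1) / Gamma p)" if "a \<in> {..<1}" for a
  proof -
    have "L a = pochhammer (p - a) M / pochhammer p M"
      unfolding L_def using Vandermonde_pochhammer[of M p a] by (simp add: p_def)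
    also have "pochhammer (p - a) M = Gamma (p - a + real M) / Gamma (p - a)"
      using that by (intro pochhammer_Gamma np) (simp add: p_def)
    also have "pochhammer p M = Gamma (p + real M) / Gamma p"
      by (intro pochhammer_Gamma np) (simp add: p_def)
    finally show ?thesis by (simp add: p_def algebra_simps)
  qed
  define q where "q = 2 * real M + 1"
  have pq: "p > 0" "q > 0" by (auto simp: p_def q_def)
  have D: "((\<lambda>a. Gamma (y - a)) has_real_derivative - (Gamma y * Digamma y)) (at 0)" if "y > 0"
      for y :: real
    using np[OF that] by (auto intro!: derivative_eq_intros)
  have "((\<lambda>a. Gamma (2 * real M + 1 - a) / Gamma (p - a) / (Gamma (2 * real M + 1) / Gamma p))
      has_real_derivative
      Digamma p - Digamma (2 * real M + 1)) (at 0)"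
    unfolding q_def[symmetric]
    by (rule DERIV_cong[OF DERIV_cdivide[OF DERIV_divide[OF D[OF pq(2)] D[OF pq(1)]]]])
      (use Gamma_real_pos[OF pq(1)] Gamma_real_pos[OF pq(2)] in \<open>simp_all add: field_simps\<close>)
  then have "(L has_real_derivative Digamma p - Digamma (2 * real M + 1)) (at 0)"
    by (rule has_field_derivative_transform_within_open[of _ _ _ "{..<1}"]) (auto simp: L_eq)
  with L show ?thesis unfolding p_def by (rule DERIV_unique)
qed

text \<open>Every term after the first contains the factor a, so the series is 1 + a S(a) and only
  continuity of S at 0 is required. That the second parameter moves with a is invisible to first
  order for the same reason.\<close>

lemma hypergeom_derivative_at_0:
  fixes t :: real
  assumes t: "\<bar>t\<bar> < 1"
  shows "((\<lambda>a. hypergeom a (a - real M) (real M + 1) t)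
      has_real_derivative log_poly M (real M + 1) t) (at 0)"
    and "hypergeom 0 (- real M) (real M + 1) t = 1"
proof -
  define p where "p = real M + 1"
  define \<sigma> where "\<sigma> = (\<lambda>k a. pochhammer (a + 1) k * pochhammer (a - real M) (Suc k)
      / (pochhammer p (Suc k) * fact (Suc k)) * t ^ Suc k)"
  define S where "S = (\<lambda>a. \<Sum>k. \<sigma> k a)"
  have p: "p \<notin> \<int>\<^sub>\<le>\<^sub>0" using nonpos_Ints_nonpos[of p] by (auto simp: p_def)
  have sum_t: "summable (\<lambda>k. \<bar>t\<bar> ^ Suc k)"
    using t by (simp add: summable_Suc_iff summable_geometric del: power_Suc)
  \<comment> \<open>For |a| <= 1 one has |a + 1| <= 2, whose Pochhammer symbol is (k + 1)!, and |a -
    M| <= M + 1 = p. Hence each coefficient is at most 1 and the majorant is geometric, uniformly in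
    a.\<close>
  have bound: "norm (\<sigma> k a) \<le> \<bar>t\<bar> ^ Suc k" if a: "a \<in> {-1..1}" for k a
  proof -
    have "\<bar>pochhammer (a + 1) k\<bar> \<le> pochhammer 2 k" using a by (intro abs_pochhammer_le) auto
    also have "\<dots> = fact (Suc k)" by (simp only: pochhammer_fact pochhammer_rec) simp
    finally have 1: "\<bar>pochhammer (a + 1) k\<bar> \<le> fact (Suc k)" .
    have 2: "\<bar>pochhammer (a - real M) (Suc k)\<bar> \<le> pochhammer p (Suc k)"
      using a by (intro abs_pochhammer_le) (auto simp: p_def)
    have pos: "pochhammer p (Suc k) > 0" by (rule pochhammer_pos) (simp add: p_def)
    have "\<bar>pochhammer (a + 1) k * pochhammer (a - real M) (Suc k)\<bar> \<le> fact (Suc k) * pochhammer p (Suc k)"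
      unfolding abs_mult by (intro mult_mono 1 2) auto
    then have "\<bar>pochhammer (a + 1) k * pochhammer (a - real M) (Suc k)
        / (pochhammer p (Suc k) * fact (Suc k))\<bar> \<le> 1"
      using pos by (simp add: abs_mult mult.commute del: pochhammer_Suc fact_Suc)
    then have "\<bar>pochhammer (a + 1) k * pochhammer (a - real M) (Suc k)
        / (pochhammer p (Suc k) * fact (Suc k))\<bar> * \<bar>t\<bar> ^ Suc k
       \<le> 1 * \<bar>t\<bar> ^ Suc k"
      by (intro mult_right_mono) auto
    then show ?thesis by (simp only: \<sigma>_def real_norm_def abs_mult power_abs mult_1)
  qed
  have "uniform_limit {-1..1} (\<lambda>n a. \<Sum>k<n. \<sigma> k a) S sequentially"
    unfolding S_def by (rule Weierstrass_m_test[OF bound sum_t])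
  moreover have "continuous_on {-1..1} (\<lambda>a. \<Sum>k<N. \<sigma> k a)" for N
    unfolding \<sigma>_def by (intro continuous_intros) (use nonpos_Ints_pochhammer[OF p] in auto)
  ultimately have "continuous_on {-1..1} S"
    by (intro uniform_limit_theorem[OF always_eventually]) auto
  then have S: "isCont S 0" by (rule continuous_on_interior) simp
  have F: "hypergeom a (a - real M) p t = 1 + a * S a" if a: "a \<in> {-1..1}" for a
  proof -
    have sm: "summable (\<lambda>k. hyp_coeff a (a - real M) p k * t ^ k)"
      by (rule hyp_rec_summable[OF hyp_rec_hyp_coeff[OF p]]) (use t in auto)
    have "summable (\<lambda>k. \<sigma> k a)"
      by (rule summable_comparison_test'[OF sum_t]) (use bound[OF a] in auto)
    then have "a * S a = (\<Sum>k. a * \<sigma> k a)" by (simp add: S_def suminf_mult)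
    also have "\<dots> = (\<Sum>k. hyp_coeff a (a - real M) p (Suc k) * t ^ Suc k)"
      by (simp add: \<sigma>_def hyp_coeff_def pochhammer_rec[of a] mult.assoc)
    also have "\<dots> = hypergeom a (a - real M) p t - 1"
      using suminf_split_head[OF sm] by (simp add: hypergeom_eq_powser)
    finally show ?thesis by simp
  qed
  have "S 0 = (\<Sum>k. log_coeff M p (Suc k) * t ^ Suc k)"
    unfolding S_def \<sigma>_def log_coeff_def
    by (intro suminf_cong) (simp add: pochhammer_fact[symmetric] divide_simps del: pochhammer_Suc)
  also have "\<dots> = log_poly M p t"
    using suminf_split_head[OF summable_log_coeff, of M p t] by (simp add: log_poly_def log_coeff_eq_0)
  finally have S0: "S 0 = log_poly M p t" .
  have "((\<lambda>a. 1 + a * S a) has_real_derivative log_poly M p t) (at 0)"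
    using DERIV_add[OF DERIV_const[of 1] has_derivative_ident_mult_at_0[OF S]] by (simp add: S0)
  then show "((\<lambda>a. hypergeom a (a - real M) (real M + 1) t)
      has_real_derivative log_poly M (real M + 1) t) (at 0)"
    unfolding p_def[symmetric]
    by (rule has_field_derivative_transform_within_open[of _ _ _ "{-1<..<1}"]) (auto simp: F)
  show "hypergeom 0 (- real M) (real M + 1) t = 1"
    using F[of 0] by (simp add: p_def)
qed

text \<open>Within distance 1/4 of n the number 2s - n is an integer only at s = n. There the
  constant function 1 gives a solution, and the formula agrees because the Gamma quotient and the
  series both equal 1; so it may be differentiated at n.\<close>

lemma vartheta_near_n:
  fixes x :: "real^'n::finite"
  assumes card: "CARD('n) = n + 1" and n: "n = 2 * M + 1" and s: "\<bar>s - real n\<bar> < 1 / 4" and x: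
      "x \<in> ball 0 1"
  shows "vartheta n s x = rho x powr (real n - s) *
    (Gamma s * Gamma (s - real M) / (Gamma (2 * s - real n) * Gamma (real M + 1)) *
     hypergeom (real n - s) (real n - s - real M) (real M + 1) ((norm x)\<^sup>2))"
proof (cases "s = real n")
  case False
  have "2 * s - real n \<notin> \<int>"
  proof
    assume "2 * s - real n \<in> \<int>"
    then obtain k where k: "2 * s - real n = of_int k" by (rule Ints_cases)
    then have "of_int (k - int n) = 2 * (s - real n)" by simp
    then have "\<bar>of_int (k - int n) :: real\<bar> < 1" using s by (simp only: abs_mult) simp
    then have "k = int n" by linarith
    then show False using k False by simp
  qed
  moreover have "real n \<ge> 1" using n by simp
  then have "s > real n / 2" using s by linarith
  moreover have e: "(real n + 1) / 2 = real M + 1" "(real n - 1) / 2 = real M" using n by auto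
  moreover have e': "real M + 1 - s = real n - s - real M" using n by simp
  ultimately show ?thesis
    using vartheta_hypergeom[OF card _ _ x, of s] unfolding poisson_const_def e e' by blast
next
  case True
  have t: "\<bar>(norm x)\<^sup>2\<bar> < 1" using x by (simp add: power_less_one_iff)
  have G: "Gamma (real n) > 0" "Gamma (real M + 1) > 0" using n by (auto intro!: Gamma_real_pos)
  have nM: "real n - real M = real M + 1" "2 * real n - real n = real n" using n by simp_all
  have "vartheta n s x = rho x powr (real n - s) * (\<lambda>_. 1) ((norm x)\<^sup>2)"
  proof (rule vartheta_radial[OF card _ _ _ _ _ _ x])
    show "hyp_ode (real n - s) ((real n + 1) / 2 - s) ((real n + 1) / 2) {-1<..<1} (\<lambda>_. 1) (\<lambda>_. 0) (\<lambda>_. 0)"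
      by (simp add: hyp_ode_def True)
    show "Ck_real k {-1<..<2} (\<lambda>_. 1)" "Ck_real k {-1<..<2} (\<lambda>_. 0)" for k
      by (rule Ck_real_const; simp)+
  qed (use True n in auto)
  then show ?thesis
    unfolding True nM using hypergeom_derivative_at_0(2)[OF t, of M]
    by (simp add: G[THEN less_imp_neq, THEN not_sym])
qed

text \<open>The three factors contribute -ln \<rho>, the digamma difference from the normalizing
  constant, and minus a logarithmic polynomial in t. The digamma difference is that polynomial's
  value at t = 1, which is the constant required by the reflection to z.\<close>

lemma tau_eq:
  fixes x :: "real^'n::finite"
  assumes card: "CARD('n) = n + 1" and n: "n = 2 * M + 1" and x: "x \<in> ball 0 1"
  shows "tau n x = ln (rho x) + log_poly M (- 2 * real M) (2 * rho x)"
proof -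
  define t where "t = (norm x)\<^sup>2"
  have t: "\<bar>t\<bar> < 1" using x by (simp add: t_def power_less_one_iff)
  have r: "rho x > 0" by (rule rho_pos[OF x])
  have np: "y \<notin> \<int>\<^sub>\<le>\<^sub>0" if "y > 0" for y :: real using that nonpos_Ints_nonpos[of y] by linarith
  have 1: "((\<lambda>s. rho x powr (real n - s)) has_real_derivative - ln (rho x)) (at (real n))"
    using r by (auto intro!: derivative_eq_intros)
  have nM: "real n - real M = real M + 1" using n by simp
  have pos: "Gamma (real n) > 0" "Gamma (real M + 1) > 0" using n by (auto intro!: Gamma_real_pos)
  have 2: "((\<lambda>s. Gamma s * Gamma (s - real M) / (Gamma (2 * s - real n) * Gamma (real M + 1)))
     has_real_derivative Digamma (real M + 1) - Digamma (real n)) (at (real n))"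
  proof -
    have D: "(Gamma has_real_derivative Gamma (real n) * Digamma (real n)) (at (real n))"
      "((\<lambda>s. Gamma (s - real M)) has_real_derivative Gamma (real M + 1) * Digamma (real M + 1))
          (at (real n))"
      "((\<lambda>s. Gamma (2 * s - real n)) has_real_derivative Gamma (real n) * Digamma (real n) * 2)
          (at (real n))"
      using np[of "real n"] np[of "real M + 1"] n
      by (auto intro!: derivative_eq_intros simp: nM)
    have e: "2 * real n - real n = real n" by simp
    \<comment> \<open>The logarithmic derivative of the Gamma quotient at s = n, where the quotient
      is 1; the argument 2s - n supplies the factor 2, so dg + dh - 2 dg remains.\<close>
    have alg: "((g * dg * h + h * dh * g) * (g * h) - g * h * (g * dg * 2 * h))
        / (g * h * (g * h)) = dh - dg"
      if "g > 0" "h > 0" for g h dg dh :: real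
      using that by (simp add: field_simps)
    note D' = DERIV_divide[OF DERIV_mult[OF D(1,2)] DERIV_cmult_right[OF D(3)], of "Gamma (real M + 1)"]
    show ?thesis
      by (rule DERIV_cong[OF D'[unfolded nM e] alg[OF pos]])
        (rule mult_pos_pos[OF pos, THEN less_imp_neq, symmetric])
  qed
  have d: "((\<lambda>s. real n - s) has_real_derivative -1) (at (real n))" by (auto intro!: derivative_eq_intros)
  have 3: "((\<lambda>s. hypergeom (real n - s) (real n - s - real M) (real M + 1) t) has_real_derivative
      - log_poly M (real M + 1) t) (at (real n))"
    using DERIV_chain2[of "\<lambda>a. hypergeom a (a - real M) (real M + 1) t" _ "\<lambda>s. real n - s", OF _ d]
      hypergeom_derivative_at_0(1)[OF t, of M] by simp
  have one: "hypergeom 0 (- real M) (real M + 1) t = 1" by (rule hypergeom_derivative_at_0(2)[OF t])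
  have "((\<lambda>s. rho x powr (real n - s) *
    (Gamma s * Gamma (s - real M) / (Gamma (2 * s - real n) * Gamma (real M + 1)) *
     hypergeom (real n - s) (real n - s - real M) (real M + 1) t)) has_real_derivative
     - ln (rho x) + (Digamma (real M + 1) - Digamma (real n)) - log_poly M (real M + 1) t) (at (real n))"
    by (rule DERIV_cong[OF DERIV_mult[OF 1 DERIV_mult[OF 2 3]]])
        (use r in \<open>simp add: one nM pos[THEN less_imp_neq, THEN not_sym]\<close>)
  then have "((\<lambda>s. vartheta n s x) has_real_derivative
     - ln (rho x) + (Digamma (real M + 1) - Digamma (real n)) - log_poly M (real M + 1) t) (at (real n))"
    by (rule has_field_derivative_transform_within_open[of _ _ _ "ball (real n) (1/4)"])
      (auto simp: vartheta_near_n[OF card n _ x] t_def dist_real_def abs_minus_commute)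
  then have "tau n x = ln (rho x) + (log_poly M (real M + 1) t - (Digamma (real M + 1) - Digamma (real n)))"
    by (simp add: tau_def DERIV_imp_deriv)
  also have "Digamma (real M + 1) - Digamma (real n) = log_poly M (real M + 1) 1"
  proof -
    have "2 * real M + 1 = real n" using n by simp
    then show ?thesis using log_poly_1[of M] by (simp only:)
  qed
  also have "log_poly M (real M + 1) t - log_poly M (real M + 1) 1 = log_poly M (- 2 * real M) (1 - t)"
    using log_poly_reflect[of "1 - t" M] t by (simp add: t_def)
  also have "1 - t = 2 * rho x" by (simp add: rho_def t_def)
  finally show ?thesis .
qed

text \<open>Both Pochhammer symbols have negative argument -b with b >= k; turning them into Gamma
  quotients produces the sign (-1)^k twice, so it cancels.\<close>

lemma log_coeff_Gamma:
  assumes "1 \<le> k" "k \<le> M"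
  shows "log_coeff M (- 2 * real M) k = Gamma (real M + 1) / Gamma (2 * real M + 1) *
    (Gamma (2 * real M + 1 - real k) / (Gamma (real M + 1 - real k) * real k))"
proof -
  have *: "pochhammer (- b) k = (-1) ^ k * (Gamma (b + 1) / Gamma (b + 1 - real k))" if "b \<ge> real k" for b
  proof -
    have "b - real k + 1 \<notin> \<int>\<^sub>\<le>\<^sub>0" using that nonpos_Ints_nonpos[of "b - real k + 1"] by linarith
    moreover have e: "b - real k + 1 = b + 1 - real k" by simp
    ultimately show ?thesis
      unfolding pochhammer_minus[of b k] e using pochhammer_Gamma[of "b + 1 - real k" k] by simp
  qed
  show ?thesis
    using *[of "real M"] *[of "2 * real M"] assms by (simp add: log_coeff_def)
qed

lemma adapted_metric_limiting:
  fixes x :: "real^'n::finite"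
  assumes card: "CARD('n) = n + 1" and n: "odd n" and x: "x \<in> ball 0 1"
  shows "adapted_metric n (real n) x =
    exp (2 * (Gamma ((real n + 1) / 2) / Gamma (real n))
      * (\<Sum>k=1..(n - 1) div 2. Gamma (real n - real k)
          / (Gamma ((real n + 1) / 2 - real k) * real k) * (2 * rho x) ^ k)) *\<^sub>R flat_metric x"
proof -
  obtain M where M: "n = 2 * M + 1" using n by (auto elim: oddE)
  have r: "rho x > 0" by (rule rho_pos[OF x])
  have "log_poly M (- 2 * real M) (2 * rho x) =
      (\<Sum>k=1..M. Gamma (real M + 1) / Gamma (2 * real M + 1) *
        (Gamma (2 * real M + 1 - real k) / (Gamma (real M + 1 - real k) * real k)) * (2 * rho x) ^ k)"
    unfolding log_poly_eq by (intro sum.cong refl arg_cong2[where f = "(*)"] log_coeff_Gamma) auto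
  also have "\<dots> = Gamma (real M + 1) / Gamma (2 * real M + 1) *
      (\<Sum>k=1..M. Gamma (2 * real M + 1 - real k) / (Gamma (real M + 1 - real k) * real k) * (2 * rho x) ^ k)"
    by (simp add: sum_distrib_left mult.assoc)
  finally have L: "log_poly M (- 2 * real M) (2 * rho x) = \<dots>" .
  \<comment> \<open>The term ln \<rho> in \<open>tau\<close> becomes the factor \<rho>^2, which
    cancels the conformal factor of the hyperbolic metric.\<close>
  have "exp (2 * tau n x) = (rho x)\<^sup>2 * exp (2 * log_poly M (- 2 * real M) (2 * rho x))"
    using r unfolding tau_eq[OF card M x] by (simp add: distrib_left exp_add exp_double)
  moreover have e: "(real n + 1) / 2 = real M + 1" "(n - 1) div 2 = M" and nM:
      "2 * real M + 1 = real n" using M by auto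
  ultimately show ?thesis
    using r unfolding L[unfolded nM] e
    by (simp add: adapted_metric_def hyperbolic_metric_eq flat_metric_def mult.assoc)
qed

theorem proposition3p4:
  fixes n :: nat and \<gamma> s :: real and gstar :: "'n::finite metric_field"
  assumes "CARD('n) = n + 1"
    and "s = real n / 2 + \<gamma>"
    and "gstar = adapted_metric n s"
  shows
    "(0 < \<gamma> \<and> \<gamma> < real n / 2 \<and> \<gamma> \<notin> half_naturals \<longrightarrow>
       (\<exists>\<psi> :: real^'n \<Rightarrow> real. continuous_on (ball 0 1) \<psi> \<and>
          (\<forall>x\<in>ball 0 1 - {0}. \<psi> x =
             hypergeom (real n / 2 - \<gamma>) (1 / 2 - \<gamma>) (1 - 2 * \<gamma>) (2 * rho x)
             + rho x powr (2 * \<gamma>) * (1 / d_const \<gamma>)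
               * (Gamma (real n / 2 + \<gamma>) / Gamma (real n / 2 - \<gamma>))
               * hypergeom (1 / 2 + \<gamma>) (real n / 2 + \<gamma>) (1 + 2 * \<gamma>) (2 * rho x)) \<and>
          (\<forall>x\<in>ball 0 1.
             gstar x = (\<psi> x powr (2 / (real n - s))) *\<^sub>R flat_metric x \<and>
             gstar x = (\<psi> x powr (4 / (real n - 2 * \<gamma>))) *\<^sub>R flat_metric x)))
     \<and>
     (\<forall>m::nat. 0 < \<gamma> \<and> \<gamma> < real n / 2 \<and> int m = \<lfloor>\<gamma>\<rfloor> \<and> \<gamma> = real m + 1 / 2 \<longrightarrow>
       (\<forall>x\<in>ball 0 1. gstar x =
          ((\<Sum>k=0..m. pochhammer ((real n - 1) / 2 - real m) k * pochhammer (- real m) k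
               / pochhammer (- 2 * real m) k * ((2 * rho x) ^ k / fact k))
             powr (4 / (real n - 2 * real m - 1))) *\<^sub>R flat_metric x))
     \<and>
     (\<gamma> = real n / 2 \<and> odd n \<longrightarrow>
       (\<forall>x\<in>ball 0 1. gstar x =
          exp (2 * (Gamma ((real n + 1) / 2) / Gamma (real n))
             * (\<Sum>k=1..(n - 1) div 2. Gamma (real n - real k)
                  / (Gamma ((real n + 1) / 2 - real k) * real k) * (2 * rho x) ^ k))
            *\<^sub>R flat_metric x))"
proof (intro conjI impI allI ballI)
  assume \<gamma>: "0 < \<gamma> \<and> \<gamma> < real n / 2 \<and> \<gamma> \<notin> half_naturals"
  obtain \<psi> :: "real^'n \<Rightarrow> real" where \<psi>: "continuous_on (ball 0 1) \<psi>"
    "\<And>x. x \<in> ball 0 1 - {0} \<Longrightarrow> \<psi> x =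
       hypergeom (real n / 2 - \<gamma>) (1 / 2 - \<gamma>) (1 - 2 * \<gamma>) (2 * rho x)
       + rho x powr (2 * \<gamma>) * (1 / d_const \<gamma>)
         * (Gamma (real n / 2 + \<gamma>) / Gamma (real n / 2 - \<gamma>))
         * hypergeom (1 / 2 + \<gamma>) (real n / 2 + \<gamma>) (1 + 2 * \<gamma>) (2 * rho x)"
    "\<And>x. x \<in> ball 0 1 \<Longrightarrow> gstar x = (\<psi> x powr (2 / (real n - s))) *\<^sub>R flat_metric x"
    using adapted_metric_generic[OF assms(1,2)] \<gamma> unfolding assms(3) by metis
  have e: "2 / (real n - s) = 4 / (real n - 2 * \<gamma>)"
    using \<gamma> assms(2) by (simp add: field_simps)
  show "\<exists>\<psi> :: real^'n \<Rightarrow> real. continuous_on (ball 0 1) \<psi> \<and>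
          (\<forall>x\<in>ball 0 1 - {0}. \<psi> x =
             hypergeom (real n / 2 - \<gamma>) (1 / 2 - \<gamma>) (1 - 2 * \<gamma>) (2 * rho x)
             + rho x powr (2 * \<gamma>) * (1 / d_const \<gamma>)
               * (Gamma (real n / 2 + \<gamma>) / Gamma (real n / 2 - \<gamma>))
               * hypergeom (1 / 2 + \<gamma>) (real n / 2 + \<gamma>) (1 + 2 * \<gamma>) (2 * rho x)) \<and>
          (\<forall>x\<in>ball 0 1.
             gstar x = (\<psi> x powr (2 / (real n - s))) *\<^sub>R flat_metric x \<and>
             gstar x = (\<psi> x powr (4 / (real n - 2 * \<gamma>))) *\<^sub>R flat_metric x)"
    unfolding e[symmetric] by (intro exI[of _ \<psi>] conjI ballI \<psi>)
next
  fix m :: nat and x :: "real^'n"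
  assume m: "0 < \<gamma> \<and> \<gamma> < real n / 2 \<and> int m = \<lfloor>\<gamma>\<rfloor> \<and> \<gamma> = real m + 1 / 2" and x: "x \<in> ball 0 1"
  have e: "2 / (real n - s) = 4 / (real n - 2 * real m - 1)"
    using m assms(2) by (simp add: field_simps)
  show "gstar x =
          ((\<Sum>k=0..m. pochhammer ((real n - 1) / 2 - real m) k * pochhammer (- real m) k
               / pochhammer (- 2 * real m) k * ((2 * rho x) ^ k / fact k))
             powr (4 / (real n - 2 * real m - 1))) *\<^sub>R flat_metric x"
    unfolding assms(3) e[symmetric]
    by (rule adapted_metric_half_integer[OF assms(1) _ _ assms(2) x]) (use m in auto)
next
  fix x :: "real^'n"
  assume n: "\<gamma> = real n / 2 \<and> odd n" and x: "x \<in> ball 0 1"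
  then have "s = real n" using assms(2) by simp
  then show "gstar x =
          exp (2 * (Gamma ((real n + 1) / 2) / Gamma (real n))
             * (\<Sum>k=1..(n - 1) div 2. Gamma (real n - real k)
                  / (Gamma ((real n + 1) / 2 - real k) * real k) * (2 * rho x) ^ k))
            *\<^sub>R flat_metric x"
    using adapted_metric_limiting[OF assms(1) _ x] n unfolding assms(3) by simp
qed

end
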